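(* Let $p,q\ge1$, let $(x,y,h)$ be a standard triple in $\mathfrak{su}(p,q)$, and for each $r\ge0$ let $(W_r,\phi_r)$ be the associated multiplicity spaces; for odd $r$, $\phi_r$ is a non-degenerate skew-Hermitian form on the complex vector space $W_r$, and $(p_r,q_r)$ denotes the signature of the Hermitian form $-i\phi_r$. Then the adjoint orbit of $x$ is stable under negation if and only if for every odd $r$, $-i\phi_r$ has split signature, i.e. $p_r=q_r$. In this case, the adjoint orbit of $x$ admits no Gibbs state.
   Context: $\mathrm{SU}(p,q)$ is the (connected) group of determinant $1$, $\mathbb C$-linear isometries of a Hermitian product $B$ of signature $(p,q)$ on $\mathbb C^{p+q}$; $\mathfrak{su}(p,q)$ is its Lie algebra; adjoint orbits are taken under this group. Sesquilinear forms are antilinear on the left and linear on the right. Standard triple: elements $(x,y,h)$ of a Lie algebra, with $x\ne0$, such that $[h,x]=2x$, $[h,y]=-2y$, $[x,y]=h$. With $X=\begin{pmatrix}0&1\\0&0\end{pmatrix}$, $Y=\begin{pmatrix}0&0\\1&0\end{pmatrix}$, $H=\begin{pmatrix}1&0\\0&-1\end{pmatrix}$, it defines an embedding of $\mathfrak{sl}(2,\mathbb R)$ by $X\mapsto x$, $Y\mapsto y$, $H\mapsto h$. For $r\ge0$, $V_r$ is the irreducible real $\mathfrak{sl}(2,\mathbb R)$-module of dimension $r+1$, with weight spaces $V_r(k)=\ker(H-k)$, and $B_r$ is a fixed nonzero invariant real bilinear form on it (unique up to scale; symmetric if $r$ is even, symplectic if $r$ is odd), normalized so that for $r=2m$ it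 has signature $(m+1,m)$, and for $r$ odd $B_r(v,X\cdot v)\ge0$ for all $v\in V_r(-1)$. Multiplicity spaces: via the standard triple, $\mathbb C^{p+q}$ is a $\mathbb C$-linear $\mathfrak{sl}(2,\mathbb R)$-module with invariant form $B$, and there is a $\mathbb C$-linear isometric isomorphism of $\mathfrak{sl}(2,\mathbb R)$-modules $(\mathbb C^{p+q},B)\simeq\bigoplus_r(V_r\otimes_{\mathbb R}W_r,\;B_r\otimes\phi_r)$ with $W_r$ complex vector spaces on which $\mathfrak{sl}(2,\mathbb R)$ acts trivially; the isometry classes of the $(W_r,\phi_r)$ are well defined. Gibbs states: for a real semisimple Lie algebra $\mathfrak g$ with Killing form $\kappa$, an adjoint orbit $\mathcal O$ carries the symplectic form $\omega_{\mathcal O}|_y([X,y],[Y,y])=\kappa(y,[X,Y])$ and the Liouville form $\lambda_{\mathcal O}=\omega_{\mathcal O}^{\dim\mathcal O/2}$. For $\beta\in\mathfrak g^*$ put $Z(\beta)=\int_{\mathcal O}e^{-\langle\beta,y\rangle}|\lambda_{\mathcal O}|(y)\in(0,+\infty]$. $\mathcal O$ admits a Gibbs state (the probability distribution $Z(\beta)^{-1}e^{-\langle\beta,y\rangle}|\lambda_{\mathcal O}|(y)$) if $Z(\beta)<\infty$ for some $\beta$. *)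

theory Defs
  imports "HOL-Analysis.Analysis" "HOL-Combinatorics.Permutations"
begin

section \<open>Sesquilinear forms on complex vector spaces\<close>

text \<open>Complex vector spaces are subspaces \<open>W\<close> of an ambient space with scalar multiplication \<open>s\<close>.
  Forms are antilinear on the left and linear on the right.\<close>

definition sesquilinear_form ::
  "(complex \<Rightarrow> 'w::ab_group_add \<Rightarrow> 'w) \<Rightarrow> 'w set \<Rightarrow> ('w \<Rightarrow> 'w \<Rightarrow> complex) \<Rightarrow> bool" where
  "sesquilinear_form s W \<phi> \<longleftrightarrow>
     (\<forall>u\<in>W. \<forall>v\<in>W. \<forall>w\<in>W. \<phi> (u + v) w = \<phi> u w + \<phi> v w \<and> \<phi> w (u + v) = \<phi> w u + \<phi> w v) \<and>
     (\<forall>c. \<forall>u\<in>W. \<forall>v\<in>W. \<phi> (s c u) v = cnj c * \<phi> u v \<and> \<phi> u (s c v) = c * \<phi> u v)"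

definition hermitian_form ::
  "(complex \<Rightarrow> 'w::ab_group_add \<Rightarrow> 'w) \<Rightarrow> 'w set \<Rightarrow> ('w \<Rightarrow> 'w \<Rightarrow> complex) \<Rightarrow> bool" where
  "hermitian_form s W \<phi> \<longleftrightarrow>
     sesquilinear_form s W \<phi> \<and> (\<forall>u\<in>W. \<forall>v\<in>W. \<phi> v u = cnj (\<phi> u v))"

definition skew_hermitian_form ::
  "(complex \<Rightarrow> 'w::ab_group_add \<Rightarrow> 'w) \<Rightarrow> 'w set \<Rightarrow> ('w \<Rightarrow> 'w \<Rightarrow> complex) \<Rightarrow> bool" where
  "skew_hermitian_form s W \<phi> \<longleftrightarrow>
     sesquilinear_form s W \<phi> \<and> (\<forall>u\<in>W. \<forall>v\<in>W. \<phi> v u = - cnj (\<phi> u v))"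

definition nondegenerate_form :: "'w::zero set \<Rightarrow> ('w \<Rightarrow> 'w \<Rightarrow> complex) \<Rightarrow> bool" where
  "nondegenerate_form W \<phi> \<longleftrightarrow> (\<forall>u\<in>W. (\<forall>v\<in>W. \<phi> u v = 0) \<longrightarrow> u = 0)"

definition positive_index ::
  "(complex \<Rightarrow> 'w::ab_group_add \<Rightarrow> 'w) \<Rightarrow> 'w set \<Rightarrow> ('w \<Rightarrow> 'w \<Rightarrow> complex) \<Rightarrow> nat" where
  "positive_index s W \<psi> =
     Sup {vector_space.dim s U | U.
            module.subspace s U \<and> U \<subseteq> W \<and> (\<forall>u\<in>U. u \<noteq> 0 \<longrightarrow> 0 < Re (\<psi> u u))}"

text \<open>Signature of a Hermitian form on a finite-dimensional space: the largest dimensions of a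
  positive definite and of a negative definite complex subspace.\<close>

definition hermitian_signature ::
  "(complex \<Rightarrow> 'w::ab_group_add \<Rightarrow> 'w) \<Rightarrow> 'w set \<Rightarrow> ('w \<Rightarrow> 'w \<Rightarrow> complex) \<Rightarrow> nat \<times> nat" where
  "hermitian_signature s W \<psi> = (positive_index s W \<psi>, positive_index s W (\<lambda>u v. - \<psi> u v))"

section \<open>The group, its Lie algebra, and standard triples\<close>

definition special_unitary_group ::
  "(complex^'n \<Rightarrow> complex^'n \<Rightarrow> complex) \<Rightarrow> (complex^'n^'n::finite) set" where
  "special_unitary_group B = {g. det g = 1 \<and> (\<forall>u v. B (g *v u) (g *v v) = B u v)}"

definition special_unitary_algebra ::
  "(complex^'n \<Rightarrow> complex^'n \<Rightarrow> complex) \<Rightarrow> (complex^'n^'n::finite) set" where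
  "special_unitary_algebra B = {A. trace A = 0 \<and> (\<forall>u v. B (A *v u) v + B u (A *v v) = 0)}"

definition adjoint_orbit :: "(complex^'n^'n::finite) set \<Rightarrow> complex^'n^'n \<Rightarrow> (complex^'n^'n) set" where
  "adjoint_orbit G x = {g ** x ** matrix_inv g | g. g \<in> G}"

definition lie_bracket :: "complex^'n^'n::finite \<Rightarrow> complex^'n^'n \<Rightarrow> complex^'n^'n" where
  "lie_bracket A C = A ** C - C ** A"

definition standard_triple ::
  "(complex^'n^'n::finite) set \<Rightarrow> complex^'n^'n \<Rightarrow> complex^'n^'n \<Rightarrow> complex^'n^'n \<Rightarrow> bool" where
  "standard_triple L x y h \<longleftrightarrow>
     x \<in> L \<and> y \<in> L \<and> h \<in> L \<and> x \<noteq> 0 \<and>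
     lie_bracket h x = 2 *\<^sub>R x \<and> lie_bracket h y = - (2 *\<^sub>R y) \<and> lie_bracket x y = h"

section \<open>The irreducible modules and the multiplicity spaces\<close>

text \<open>\<open>V\<^sub>r\<close> is modelled on the real span of a weight basis \<open>e\<^sub>0, \<dots>, e\<^sub>r\<close> with
  \<open>H e\<^sub>j = (r - 2j) e\<^sub>j\<close>, \<open>Y e\<^sub>j = e\<^sub>j\<^sub>+\<^sub>1\<close> (zero for \<open>j = r\<close>) and
  \<open>X e\<^sub>j = j (r - j + 1) e\<^sub>j\<^sub>-\<^sub>1\<close>; entry \<open>(i, j)\<close> of a matrix is the
  coefficient of \<open>e\<^sub>i\<close> in the image of \<open>e\<^sub>j\<close>, for \<open>i, j \<le> r\<close>.\<close>

definition irrep_H :: "nat \<Rightarrow> nat \<Rightarrow> nat \<Rightarrow> real" where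
  "irrep_H r i j = (if i = j then real r - 2 * real j else 0)"

definition irrep_X :: "nat \<Rightarrow> nat \<Rightarrow> nat \<Rightarrow> real" where
  "irrep_X r i j = (if j = Suc i then real j * (real r - real j + 1) else 0)"

definition irrep_Y :: "nat \<Rightarrow> nat \<Rightarrow> nat \<Rightarrow> real" where
  "irrep_Y r i j = (if i = Suc j then 1 else 0)"

text \<open>Gram matrix of the invariant form. Invariance leaves only the scale free, and the sign
  \<open>(-1) ^ ((r + 1) div 2)\<close> realises the normalisation. For \<open>r = 2m\<close> the vectors \<open>e\<^sub>k\<close> and
  \<open>e\<^sub>2\<^sub>m\<^sub>-\<^sub>k\<close>, \<open>k < m\<close>, span hyperbolic planes and \<open>e\<^sub>m\<close> has square \<open>+1\<close>, which gives
  signature \<open>(m + 1, m)\<close>; for odd \<open>r\<close> see \<open>irrep_form_odd\<close> below.\<close>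

definition irrep_form :: "nat \<Rightarrow> nat \<Rightarrow> nat \<Rightarrow> real" where
  "irrep_form r i j = (if i + j = r then (-1) ^ (i + (r + 1) div 2) else 0)"

lemma irrep_relations:
  assumes "i \<le> r" "k \<le> r"
  shows "(\<Sum>j\<le>r. irrep_H r i j * irrep_X r j k) - (\<Sum>j\<le>r. irrep_X r i j * irrep_H r j k)
           = 2 * irrep_X r i k" (is ?a)
    and "(\<Sum>j\<le>r. irrep_H r i j * irrep_Y r j k) - (\<Sum>j\<le>r. irrep_Y r i j * irrep_H r j k)
           = - 2 * irrep_Y r i k" (is ?b)
    and "(\<Sum>j\<le>r. irrep_X r i j * irrep_Y r j k) - (\<Sum>j\<le>r. irrep_Y r i j * irrep_X r j k)
           = irrep_H r i k" (is ?c)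
proof -
  have H1: "(\<Sum>j\<le>r. irrep_H r i j * g j) = (real r - 2 * real i) * g i" for g
    using assms by (simp add: irrep_H_def if_distrib[of "\<lambda>a. a * _"] cong: if_cong)
  have H2: "(\<Sum>j\<le>r. g j * irrep_H r j k) = g k * (real r - 2 * real k)" for g
    using assms by (simp add: irrep_H_def if_distrib[of "\<lambda>a. _ * a"] cong: if_cong)
  show ?a unfolding H1 H2 by (auto simp: irrep_X_def algebra_simps)
  show ?b unfolding H1 H2 by (auto simp: irrep_Y_def algebra_simps)
  have X1: "(\<Sum>j\<le>r. irrep_X r i j * g j) = (real i + 1) * (real r - real i) * (if i < r then g (Suc i) else 0)" for g
    using assms by (simp add: irrep_X_def if_distrib[of "\<lambda>a. a * _"] Suc_le_eq cong: if_cong)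
  have X2: "(\<Sum>j\<le>r. g j * irrep_X r j k) = (if k = 0 then 0 else g (k - 1) * (real k * (real r - real k + 1)))" for g
    using assms by (cases k) (simp_all add: irrep_X_def if_distrib[of "\<lambda>a. _ * a"] cong: if_cong)
  show ?c unfolding X1 X2 using assms
    by (cases k) (auto simp: irrep_H_def irrep_Y_def algebra_simps)
qed

lemma irrep_form_invariant:
  assumes "M = irrep_X r \<or> M = irrep_Y r \<or> M = irrep_H r" "i \<le> r" "k \<le> r"
  shows "(\<Sum>j\<le>r. M j i * irrep_form r j k) + (\<Sum>j\<le>r. M j k * irrep_form r i j) = 0"
proof -
  have a: "irrep_form r j k = (if j = r - k then (-1) ^ (j + (r + 1) div 2) else 0)" if "j \<le> r" for j
    using assms that by (auto simp: irrep_form_def)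
  have b: "irrep_form r i j = (if j = r - i then (-1) ^ (i + (r + 1) div 2) else 0)" if "j \<le> r" for j
    using assms that by (auto simp: irrep_form_def)
  have A: "(\<Sum>j\<le>r. M j i * irrep_form r j k) = M (r - k) i * (-1) ^ (r - k + (r + 1) div 2)"
    using assms(3) by (simp add: a if_distrib[of "\<lambda>a. _ * a"] cong: if_cong)
  have B: "(\<Sum>j\<le>r. M j k * irrep_form r i j) = M (r - i) k * (-1) ^ (i + (r + 1) div 2)"
    using assms(2) by (simp add: b if_distrib[of "\<lambda>a. _ * a"] cong: if_cong)
  obtain n where n: "r = k + n" using assms(3) by (metis le_Suc_ex)
  show ?thesis unfolding A B using assms n
    by (auto simp: irrep_X_def irrep_Y_def irrep_H_def power_add algebra_simps)
qed

lemma irrep_form_even: "irrep_form (2 * m) m m = 1"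
  by (simp add: irrep_form_def)

text \<open>For \<open>r = 2m + 1\<close> the weight \<open>-1\<close> space is spanned by \<open>e\<^sub>m\<^sub>+\<^sub>1\<close>.\<close>

lemma irrep_form_odd:
  "(\<Sum>j\<le>2 * m + 1. irrep_X (2 * m + 1) j (m + 1) * irrep_form (2 * m + 1) (m + 1) j) > 0"
proof -
  have "irrep_X (2 * m + 1) j (m + 1) * irrep_form (2 * m + 1) (m + 1) j
    = (if j = m then (real m + 1)^2 else 0)" for j
    by (auto simp: irrep_X_def irrep_form_def power2_eq_square)
  then show ?thesis by (simp add: add_pos_nonneg)
qed

text \<open>Elements of \<open>\<Oplus>\<^sub>r V\<^sub>r \<otimes>\<^sub>\<real> W\<^sub>r\<close> are given by their coefficients:
  \<open>f\<close> stands for \<open>\<Sum>\<^sub>r \<Sum>\<^sub>i\<^sub>\<le>\<^sub>r e\<^sub>i \<otimes> f r i\<close>.\<close>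

definition isotypic_sum :: "(nat \<Rightarrow> 'w::zero set) \<Rightarrow> (nat \<Rightarrow> nat \<Rightarrow> 'w) set" where
  "isotypic_sum W = {f. (\<forall>r i. (i \<le> r \<longrightarrow> f r i \<in> W r) \<and> (i > r \<longrightarrow> f r i = 0)) \<and>
                        finite {r. \<exists>i. f r i \<noteq> 0}}"

definition isotypic_action ::
  "(complex \<Rightarrow> 'w::ab_group_add \<Rightarrow> 'w) \<Rightarrow> (nat \<Rightarrow> nat \<Rightarrow> nat \<Rightarrow> real) \<Rightarrow>
   (nat \<Rightarrow> nat \<Rightarrow> 'w) \<Rightarrow> (nat \<Rightarrow> nat \<Rightarrow> 'w)" where
  "isotypic_action s M f = (\<lambda>r i. if i \<le> r then \<Sum>j\<le>r. s (of_real (M r i j)) (f r j) else 0)"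

definition isotypic_form ::
  "(nat \<Rightarrow> 'w::zero \<Rightarrow> 'w \<Rightarrow> complex) \<Rightarrow> (nat \<Rightarrow> nat \<Rightarrow> 'w) \<Rightarrow> (nat \<Rightarrow> nat \<Rightarrow> 'w) \<Rightarrow> complex" where
  "isotypic_form \<phi> f g =
     (\<Sum>r\<in>{r. \<exists>i. f r i \<noteq> 0}. \<Sum>i\<le>r. \<Sum>j\<le>r. of_real (irrep_form r i j) * \<phi> r (f r i) (g r j))"

definition multiplicity_spaces ::
  "(complex^'n \<Rightarrow> complex^'n \<Rightarrow> complex) \<Rightarrow>
   complex^'n^'n \<Rightarrow> complex^'n^'n \<Rightarrow> complex^'n^'n::finite \<Rightarrow>
   (complex \<Rightarrow> 'w::ab_group_add \<Rightarrow> 'w) \<Rightarrow> (nat \<Rightarrow> 'w set) \<Rightarrow> (nat \<Rightarrow> 'w \<Rightarrow> 'w \<Rightarrow> complex) \<Rightarrow> bool" where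
  "multiplicity_spaces B x y h s W \<phi> \<longleftrightarrow>
     (\<forall>r. module.subspace s (W r) \<and> sesquilinear_form s (W r) (\<phi> r)) \<and>
     (\<exists>\<Phi>. bij_betw \<Phi> (isotypic_sum W) UNIV \<and>
        (\<forall>f\<in>isotypic_sum W. \<forall>g\<in>isotypic_sum W.
           \<Phi> (\<lambda>r i. f r i + g r i) = \<Phi> f + \<Phi> g \<and> B (\<Phi> f) (\<Phi> g) = isotypic_form \<phi> f g) \<and>
        (\<forall>f\<in>isotypic_sum W.
           (\<forall>c. \<Phi> (\<lambda>r i. s c (f r i)) = c *s \<Phi> f) \<and>
           \<Phi> (isotypic_action s irrep_X f) = x *v \<Phi> f \<and>
           \<Phi> (isotypic_action s irrep_Y f) = y *v \<Phi> f \<and>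
           \<Phi> (isotypic_action s irrep_H f) = h *v \<Phi> f))"

section \<open>The Liouville measure of an adjoint orbit and Gibbs states\<close>

definition trace_on :: "'a::real_vector set \<Rightarrow> ('a \<Rightarrow> 'a) \<Rightarrow> real" where
  "trace_on S T =
     (let E = (SOME E. independent E \<and> span E = S) in \<Sum>b\<in>E. representation E (T b) b)"

definition killing_form :: "(complex^'n^'n::finite) set \<Rightarrow> complex^'n^'n \<Rightarrow> complex^'n^'n \<Rightarrow> real" where
  "killing_form L A C = trace_on L (\<lambda>Z. lie_bracket A (lie_bracket C Z))"

definition orbit_tangent :: "(complex^'n^'n::finite) set \<Rightarrow> complex^'n^'n \<Rightarrow> (complex^'n^'n) set" where
  "orbit_tangent L y = {lie_bracket A y | A. A \<in> L}"

text \<open>The value does not depend on the choice of \<open>A\<close> and \<open>C\<close>, by invariance of the Killing form.\<close>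

definition orbit_symplectic ::
  "(complex^'n^'n::finite) set \<Rightarrow> complex^'n^'n \<Rightarrow> complex^'n^'n \<Rightarrow> complex^'n^'n \<Rightarrow> real" where
  "orbit_symplectic L y v w =
     (THE c. \<exists>A\<in>L. \<exists>C\<in>L. lie_bracket A y = v \<and> lie_bracket C y = w \<and>
                          c = killing_form L y (lie_bracket A C))"

text \<open>\<open>\<omega>\<^sup>m\<close>, the \<open>m\<close>-fold exterior power of a 2-form, evaluated at \<open>v 0, \<dots>, v (2m - 1)\<close>.\<close>

definition wedge_power :: "('a \<Rightarrow> 'a \<Rightarrow> real) \<Rightarrow> nat \<Rightarrow> (nat \<Rightarrow> 'a) \<Rightarrow> real" where
  "wedge_power \<omega> m v =
     (\<Sum>\<sigma> | \<sigma> permutes {..<2 * m}.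
        of_int (sign \<sigma>) * (\<Prod>i<m. \<omega> (v (\<sigma> (2 * i))) (v (\<sigma> (2 * i + 1))))) / 2 ^ m"

text \<open>\<open>\<real>\<^sup>d\<close> with varying \<open>d\<close>, as the space of \<open>\<Pi>\<^sub>M i\<in>{..<d}. lborel\<close>.\<close>

definition coord_space :: "nat \<Rightarrow> (nat \<Rightarrow> real) set" where
  "coord_space d = ({..<d} \<rightarrow>\<^sub>E UNIV)"

definition partial_deriv :: "((nat \<Rightarrow> real) \<Rightarrow> 'a::real_normed_vector) \<Rightarrow> nat \<Rightarrow> (nat \<Rightarrow> real) \<Rightarrow> 'a" where
  "partial_deriv \<psi> i u = vector_derivative (\<lambda>t. \<psi> (u(i := t))) (at (u i))"

text \<open>Local parametrisations of the orbit \<open>N\<close>: injective \<open>C\<^sup>1\<close> maps \<open>\<psi>\<close> from an open \<open>U \<subseteq> \<real>\<^sup>d\<close>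
  to \<open>N\<close> whose differential at each \<open>u\<close> is onto the tangent space, hence bijective when \<open>d\<close>
  is the dimension of \<open>N\<close>. The orbits in question are embedded submanifolds, so that \<open>\<psi>\<close> is
  automatically a diffeomorphism onto an open subset of \<open>N\<close>.\<close>

definition orbit_chart ::
  "(complex^'n^'n::finite) set \<Rightarrow> (complex^'n^'n) set \<Rightarrow> nat \<Rightarrow>
   (nat \<Rightarrow> real) set \<Rightarrow> ((nat \<Rightarrow> real) \<Rightarrow> complex^'n^'n) \<Rightarrow> bool" where
  "orbit_chart L N d U \<psi> \<longleftrightarrow>
     openin (top_of_set (coord_space d)) U \<and> inj_on \<psi> U \<and> \<psi> ` U \<subseteq> N \<and> continuous_on U \<psi> \<and>
     (\<forall>i<d. continuous_on U (partial_deriv \<psi> i) \<and>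
            (\<forall>u\<in>U. (\<lambda>t. \<psi> (u(i := t))) differentiable (at (u i)))) \<and>
     (\<forall>u\<in>U. span ((\<lambda>i. partial_deriv \<psi> i u) ` {..<d}) = orbit_tangent L (\<psi> u))"

text \<open>The restriction of \<open>|\<lambda>|\<close>, with \<open>\<lambda> = \<omega>\<^sup>d\<^sup>/\<^sup>2\<close>, to the image of a chart,
  as a Borel measure on the matrix space.\<close>

definition chart_measure ::
  "(complex^'n^'n::finite) set \<Rightarrow> nat \<Rightarrow>
   (nat \<Rightarrow> real) set \<Rightarrow> ((nat \<Rightarrow> real) \<Rightarrow> complex^'n^'n) \<Rightarrow> (complex^'n^'n) measure" where
  "chart_measure L d U \<psi> =
     distr (density (restrict_space (\<Pi>\<^sub>M i\<in>{..<d}. lborel) U)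
              (\<lambda>u. ennreal \<bar>wedge_power (orbit_symplectic L (\<psi> u)) (d div 2)
                               (\<lambda>i. partial_deriv \<psi> i u)\<bar>))
       borel \<psi>"

text \<open>\<open>|\<lambda>|\<close> itself, for the orbit of \<open>x\<close> under \<open>G\<close> with Lie algebra \<open>L\<close>. The chart measures are
  restrictions of one measure, which is their supremum in the complete lattice of measures, since
  countably many charts cover the orbit.\<close>

definition liouville_measure ::
  "(complex^'n^'n::finite) set \<Rightarrow> (complex^'n^'n) set \<Rightarrow> complex^'n^'n \<Rightarrow> (complex^'n^'n) measure" where
  "liouville_measure G L x =
     (let d = dim (orbit_tangent L x) in
      Sup {chart_measure L d U \<psi> | U \<psi>. orbit_chart L (adjoint_orbit G x) d U \<psi>})"

definition partition_function ::
  "(complex^'n^'n::finite) set \<Rightarrow> (complex^'n^'n) set \<Rightarrow> complex^'n^'n \<Rightarrow>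
   (complex^'n^'n \<Rightarrow> real) \<Rightarrow> ennreal" where
  "partition_function G L x \<beta> = (\<integral>\<^sup>+ y. ennreal (exp (- \<beta> y)) \<partial>liouville_measure G L x)"

text \<open>Elements of the dual of \<open>L\<close> are given by real linear functionals on the matrix space: each
  functional on \<open>L\<close> extends, and only its values on the orbit matter.\<close>

definition admits_gibbs_state ::
  "(complex^'n^'n::finite) set \<Rightarrow> (complex^'n^'n) set \<Rightarrow> complex^'n^'n \<Rightarrow> bool" where
  "admits_gibbs_state G L x \<longleftrightarrow> (\<exists>\<beta>. linear \<beta> \<and> partition_function G L x \<beta> < \<infinity>)"

end

theory Submission
  imports Defs
begin

text \<open>
  On \<open>ker x\<^sup>r\<^sup>+\<^sup>1\<close> the form \<open>B(u, x\<^sup>r v)\<close> is, up to its radical and a nonzero real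
  factor, \<open>\<phi>\<^sub>r\<close>. For odd \<open>r\<close> an isometry conjugating \<open>x\<close> into \<open>-x\<close> reverses the sign of this
  form, so \<open>-\<i> \<phi>\<^sub>r\<close> has split signature. Conversely, a split form has an anti-isometry \<open>T\<^sub>r\<close>,
  and \<open>e\<^sub>i \<otimes> w \<mapsto> (-1)\<^sup>i e\<^sub>i \<otimes> T\<^sub>r w\<close> (with \<open>T\<^sub>r = 1\<close> for even \<open>r\<close>) is an isometry
  conjugating \<open>x\<close> into \<open>-x\<close>.

  The orbit is a cone, and the dilation by \<open>c\<close> multiplies the symplectic form by \<open>c\<close>. Hence the
  Liouville measure, which is positive because of a chart
  \<open>A \<mapsto> g x g\<^sup>-\<^sup>1\<close> with \<open>g = (1 - A)\<^sup>-\<^sup>1 (1 + A)\<close> the Cayley transform, has infinite total mass. If the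
  orbit is stable under negation then \<open>Z(\<beta>) = Z(-\<beta>)\<close>, while \<open>Z(\<beta>) + Z(-\<beta>)\<close> is at least the
  total mass.\<close>

section \<open>Complex matrices and real traces\<close>

text \<open>Scalars conjugate trivially, so the orbit under determinant-one isometries is the orbit
  under all isometries, and determinants disappear after \<open>adjoint_orbit_eq\<close>. The orbit
  is a cone because \<open>exp (t h)\<close> multiplies \<open>x\<close> by
  \<open>exp (2 t)\<close>; the factor 4 keeps all constants rational. With \<open>m\<close> half
  the dimension of the orbit, a dilation by \<open>c\<close> changes the density by
  \<open>\<bar>c\<bar> ^ m\<close>, and \<open>m \<ge> 1\<close> because \<open>x\<close> and
  \<open>h\<close> are both tangent at \<open>x\<close>.

  The Liouville measure is a supremum over all charts. It is controlled from two sides: composing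
  charts with a dilation bounds the measure by its dilate, and one explicit chart bounds it away
  from zero. The Cayley transform suits that chart because it is rational, so derivative and
  injectivity both follow from the resolvent identity. For the density at the origin the Killing
  form is identified with a multiple of the real trace form. Its nondegeneracy makes the radical of
  \<open>(a, c) \<mapsto> \<kappa> (x, [a, c])\<close> equal to the centralizer of \<open>x\<close>,
  so a maximal symplectic family in \<open>L\<close> has exactly as many members as the orbit has
  dimensions.\<close>

lemma matrix_scaleR_left: "(c *\<^sub>R A) ** (C::complex^'n^'m) = c *\<^sub>R (A ** C)"
  by (simp add: vec_eq_iff matrix_matrix_mult_def scaleR_sum_right)
lemma matrix_scaleR_right: "(A::complex^'n^'m) ** (c *\<^sub>R C) = c *\<^sub>R (A ** C)"
  by (simp add: vec_eq_iff matrix_matrix_mult_def scaleR_sum_right)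

lemma matrix_sub_ldistrib: "(A::'a::ring_1^'n^'m) ** (B - C) = A ** B - A ** C"
  by (simp add: vec_eq_iff matrix_matrix_mult_def sum_subtractf right_diff_distrib)
lemma matrix_sub_rdistrib: "((A::'a::ring_1^'n^'m) - B) ** C = A ** C - B ** C"
  by (simp add: vec_eq_iff matrix_matrix_mult_def sum_subtractf left_diff_distrib)
lemma matrix_add_rdistrib: "((A::'a::semiring_1^'n^'m) + B) ** C = A ** C + B ** C"
  by (simp add: vec_eq_iff matrix_matrix_mult_def sum.distrib distrib_right)
lemma matrix_neg_left: "(- (A::'a::ring_1^'n^'m)) ** C = - (A ** C)"
  by (simp add: vec_eq_iff matrix_matrix_mult_def sum_negf)
lemma matrix_neg_right: "(A::'a::ring_1^'n^'m) ** (- C) = - (A ** C)"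
  by (simp add: vec_eq_iff matrix_matrix_mult_def sum_negf)

lemmas matrix_ring_simps = matrix_scaleR_left matrix_scaleR_right matrix_sub_ldistrib
  matrix_sub_rdistrib matrix_neg_left matrix_neg_right matrix_add_ldistrib matrix_add_rdistrib
  matrix_mul_assoc

lemma bilinear_matrix_mult: "bilinear (\<lambda>(A::complex^'n^'m) (C::complex^'p^'n). A ** C)"
  by (auto simp: bilinear_def matrix_ring_simps intro!: linearI)

lemma bounded_bilinear_matrix_mult: "bounded_bilinear (\<lambda>(A::complex^'n^'m) (C::complex^'p^'n). A ** C)"
  using bilinear_matrix_mult bilinear_conv_bounded_bilinear by blast

lemma mat_mult_commute: "mat c ** (A::complex^'n^'n) = A ** mat c"
  by (simp add: vec_eq_iff matrix_matrix_mult_def mat_def if_distrib[of "\<lambda>a. a * _"]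
      if_distrib[of "\<lambda>a. _ * a"] mult.commute cong: if_cong)

lemma mat_mult_component: "(mat c ** (A::complex^'n^'n)) $ i $ j = c * A $ i $ j"
  by (simp add: matrix_matrix_mult_def mat_def if_distrib[of "\<lambda>a. a * _"] cong: if_cong)

lemma mat_mult_vector: "mat c *v (v::complex^'n) = c *s v"
  by (simp add: vec_eq_iff matrix_vector_mult_def mat_def if_distrib[of "\<lambda>a. a * _"] cong: if_cong)

lemma trace_mat_mult: "trace (mat c ** (A::complex^'n^'n)) = c * trace A"
  by (simp add: trace_def mat_mult_component sum_distrib_left)

lemma trace_mat: "trace (mat c :: complex^'n^'n) = of_nat CARD('n) * c"
  by (simp add: trace_def mat_def)

lemma trace_scaleR: "trace (c *\<^sub>R (A::complex^'n^'n)) = c *\<^sub>R trace A"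
  by (simp add: trace_def scaleR_sum_right)

lemma trace_neg: "trace (- (A::complex^'n^'n)) = - trace A"
  by (simp add: trace_def sum_negf)

lemma mult_scaleR_vector: "(c *\<^sub>R (A::complex^'n^'n)) *v v = c *\<^sub>R (A *v v)"
  by (simp add: vec_eq_iff matrix_vector_mult_def scaleR_sum_right)

lemma neg_mult_vector: "(- (A::'a::ring_1^'n^'m)) *v v = - (A *v v)"
  by (simp add: vec_eq_iff matrix_vector_mult_def sum_negf)

definition ctranspose :: "complex^'n^'n \<Rightarrow> complex^'n^'n" where
  "ctranspose A = (\<chi> i j. cnj (A $ j $ i))"

lemma ctranspose_nth [simp]: "ctranspose A $ i $ j = cnj (A $ j $ i)"
  by (simp add: ctranspose_def)

lemma trace_ctranspose: "trace (ctranspose A) = cnj (trace A)"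
  by (simp add: trace_def)

text \<open>The squared Frobenius norm as a value of the trace form; nondegeneracy of the Killing
  form is read off from it.\<close>

lemma trace_mult_ctranspose: "Re (trace ((A::complex^'n^'n) ** ctranspose A)) = (\<Sum>i\<in>UNIV. \<Sum>j\<in>UNIV. (cmod (A $ i $ j))\<^sup>2)"
  unfolding cmod_power2 by (simp add: trace_def matrix_matrix_mult_def power2_eq_square)

lemma det_ctranspose: "det (ctranspose A) = cnj (det (A::complex^'n^'n))"
proof -
  have "det (ctranspose A) = det (transpose (ctranspose A))" by simp
  also have "\<dots> = cnj (det A)"
    unfolding det_def by (simp add: transpose_def)
  finally show ?thesis .
qed

section \<open>Traces of real-linear maps on matrix spaces\<close>

definition real_trace :: "('a::euclidean_space \<Rightarrow> 'a) \<Rightarrow> real" where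
  "real_trace F = (\<Sum>b\<in>Basis. F b \<bullet> b)"

text \<open>A complement of \<open>S\<close> contributes nothing to the trace of \<open>\<pi> \<circ> T\<close>.\<close>

lemma trace_on_projection:
  fixes S :: "'a::euclidean_space set"
  assumes S: "subspace S" and T: "linear T" and TS: "\<And>z. z \<in> S \<Longrightarrow> T z \<in> S"
    and \<pi>: "linear \<pi>" "\<And>z. \<pi> z \<in> S" "\<And>z. z \<in> S \<Longrightarrow> \<pi> z = z"
  shows "trace_on S T = real_trace (\<lambda>z. \<pi> (T z))"
proof -
  define E where "E = (SOME E. independent E \<and> span E = S)"
  have "\<exists>E. independent E \<and> span E = S"
    using basis_exists[of S] span_subspace[OF _ _ S] by metis
  then have E: "independent E" "span E = S"
    unfolding E_def by (metis (mono_tags, lifting) someI_ex)+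
  have fin: "finite E" using E(1) independent_bound by blast
  let ?r = "representation E"
  have lin: "linear (\<lambda>z. \<pi> (T z))" using T \<pi>(1) linear_compose[of T \<pi>] by (simp add: o_def)
  \<comment> \<open>Expanding \<open>b\<close> in the orthonormal ambient basis introduces the
    vectors \<open>\<pi> (T k)\<close>. Summing over \<open>b\<close> first then reassembles each of
    them from its coordinates in \<open>E\<close>.\<close>
  have key: "?r (T b) b = (\<Sum>k\<in>Basis. (b \<bullet> k) * ?r (\<pi> (T k)) b)" if b: "b \<in> E" for b
  proof -
    have "T b = \<pi> (T b)" using \<pi>(3) TS E(2) b span_base by metis
    also have "\<dots> = \<pi> (T (\<Sum>k\<in>Basis. (b \<bullet> k) *\<^sub>R k))" by (simp add: euclidean_representation)
    also have "\<dots> = (\<Sum>k\<in>Basis. (b \<bullet> k) *\<^sub>R \<pi> (T k))"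
      by (simp add: linear_sum[OF lin] linear_scale[OF lin])
    finally show ?thesis
      using E \<pi>(2) S
      by (simp add: representation_sum[OF E(1)] representation_scale[OF E(1)] subspace_scale)
  qed
  have "trace_on S T = (\<Sum>b\<in>E. ?r (T b) b)"
    by (simp add: trace_on_def E_def Let_def)
  also have "\<dots> = (\<Sum>k\<in>Basis. \<Sum>b\<in>E. ?r (\<pi> (T k)) b * (b \<bullet> k))"
    by (subst sum.swap) (simp add: key mult.commute)
  also have "\<dots> = (\<Sum>k\<in>Basis. (\<Sum>b\<in>E. ?r (\<pi> (T k)) b *\<^sub>R b) \<bullet> k)"
    by (simp add: inner_sum_left)
  also have "\<dots> = (\<Sum>k\<in>Basis. \<pi> (T k) \<bullet> k)"
    using sum_representation_eq[OF E(1) _ fin subset_refl] E(2) \<pi>(2) by (intro sum.cong) auto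
  finally show ?thesis by (simp add: real_trace_def)
qed

lemma sum_Basis_vec: "(\<Sum>b\<in>(Basis::('a::euclidean_space^'n) set). f b) = (\<Sum>i\<in>UNIV. \<Sum>u\<in>Basis. f (axis i u))"
proof -
  have "(Basis::('a^'n) set) = (\<lambda>(i,u). axis i u) ` (UNIV \<times> Basis)"
    by (auto simp: Basis_vec_def)
  moreover have "inj_on (\<lambda>(i,u). axis i u) (UNIV \<times> (Basis::'a set))"
    by (auto simp: inj_on_def axis_eq_axis)
  ultimately show ?thesis
    using sum.reindex[of "\<lambda>(i,u). axis i u" "UNIV \<times> Basis" f]
    by (simp add: o_def case_prod_unfold sum.cartesian_product)
qed

lemma real_trace_matrix:
  "real_trace (F :: complex^'n^'n \<Rightarrow> complex^'n^'n) =
    (\<Sum>i\<in>UNIV. \<Sum>j\<in>UNIV. Re (F (axis i (axis j 1)) $ i $ j) + Im (F (axis i (axis j \<i>)) $ i $ j))"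
  by (simp add: real_trace_def sum_Basis_vec inner_axis Basis_complex_def inner_complex_def)

text \<open>As a complex-linear map, \<open>Z \<mapsto> P Z Q\<close> is a tensor product with trace
  \<open>trace P * trace Q\<close>. The underlying real map has twice the real part as trace, since
  the directions \<open>e\<close> and \<open>\<i> e\<close> contribute equally.\<close>

lemma real_trace_sandwich:
  "real_trace (\<lambda>Z::complex^'n^'n. P ** Z ** Q) = 2 * Re (trace P * trace Q)"
proof -
  have *: "(P ** axis i (axis j c) ** Q) $ i $ j = P $ i $ i * c * Q $ j $ j" for i j c
  proof -
    have "(P ** axis i (axis j c)) $ i $ k = (if k = j then P $ i $ i * c else 0)" for k
      by (simp add: matrix_matrix_mult_def axis_def if_distrib[of "\<lambda>a. a $ _"]
          if_distrib[of "\<lambda>a. _ * a"] cong: if_cong) 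
    then show ?thesis
      by (simp add: matrix_matrix_mult_def[of _ Q] if_distrib[of "\<lambda>a. a * _"] cong: if_cong)
  qed
  have "real_trace (\<lambda>Z::complex^'n^'n. P ** Z ** Q)
      = (\<Sum>i\<in>UNIV. \<Sum>j\<in>UNIV. 2 * Re (P $ i $ i * Q $ j $ j))"
    by (simp add: real_trace_matrix * algebra_simps)
  moreover have "trace P * trace Q = (\<Sum>i\<in>UNIV. \<Sum>j\<in>UNIV. P $ i $ i * Q $ j $ j)"
    by (simp only: trace_def sum_product)
  ultimately show ?thesis by (simp add: sum_distrib_left del: times_complex.simps)
qed

text \<open>An antilinear map has real trace zero: the contributions of \<open>e\<close> and \<open>\<i> e\<close> cancel.\<close>

lemma real_trace_antilinear:
  assumes "\<And>Z. F (mat \<i> ** Z) = - (mat \<i> ** F Z)"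
  shows "real_trace (F :: complex^'n^'n \<Rightarrow> complex^'n^'n) = 0"
proof -
  have "axis i (axis j \<i>) = mat \<i> ** (axis i (axis j 1) :: complex^'n^'n)" for i j
    by (auto simp: vec_eq_iff mat_mult_component axis_def)
  then show ?thesis by (simp add: real_trace_matrix assms mat_mult_component)
qed

lemma real_trace_diff: "real_trace (\<lambda>z. F z - G z) = real_trace F - real_trace G"
  by (simp add: real_trace_def inner_diff_left sum_subtractf)

lemma real_trace_scaleR: "real_trace (\<lambda>z. c *\<^sub>R F z) = c * real_trace F"
  by (simp add: real_trace_def sum_distrib_left)

lemma linear_lie_bracket: "linear (lie_bracket A)" "linear (\<lambda>A. lie_bracket A C)"
  by (auto intro!: linearI simp: lie_bracket_def matrix_ring_simps algebra_simps)

lemma lie_bracket_scaleR: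
  "lie_bracket (t *\<^sub>R a) c = t *\<^sub>R lie_bracket a c"
  "lie_bracket a (t *\<^sub>R c) = t *\<^sub>R lie_bracket a (c::complex^'n^'n)"
  by (simp_all add: lie_bracket_def matrix_ring_simps scaleR_diff_right)

lemma lie_bracket_add:
  "lie_bracket (a + a') c = lie_bracket a c + lie_bracket a' c"
  "lie_bracket a (c + c') = lie_bracket a c + lie_bracket a (c'::complex^'n^'n)"
  by (simp_all add: lie_bracket_def matrix_ring_simps)

lemma trace_lie_bracket: "trace (lie_bracket A C) = 0"
  unfolding lie_bracket_def trace_sub by (simp add: trace_mul_sym[of A])

text \<open>\<open>ad A (ad C Z) = A C Z - A Z C - C Z A + Z C A\<close> is a sum of four
  sandwiches. The value is the Killing form of gl(n, C) as a real Lie algebra; on traceless matrices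
  the second term vanishes.\<close>

lemma real_trace_lie_brackets:
  "real_trace (\<lambda>Z. lie_bracket A (lie_bracket C (Z::complex^'n^'n)))
    = 4 * of_nat CARD('n) * Re (trace (A ** C)) - 4 * Re (trace A * trace C)"
proof -
  have "(\<lambda>Z. lie_bracket A (lie_bracket C Z))
     = (\<lambda>Z. ((A ** C) ** Z ** mat 1 - A ** Z ** C) - (C ** Z ** A - mat 1 ** Z ** (C ** A)))"
    by (simp add: fun_eq_iff lie_bracket_def matrix_ring_simps)
  then show ?thesis
    by (simp only: real_trace_diff real_trace_sandwich)
       (simp add: trace_I trace_mul_sym[of C A] algebra_simps)
qed

lemma matrix_inv:
  assumes "invertible (A::complex^'n^'n)"
  shows "A ** matrix_inv A = mat 1" "matrix_inv A ** A = mat 1"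
  using assms unfolding invertible_def matrix_inv_def by (rule someI2_ex; blast)+

lemma matrix_inv_eqI:
  assumes "(g::complex^'n^'n) ** k = mat 1" shows "matrix_inv g = k"
proof -
  have "k ** g = mat 1" using assms matrix_left_right_inverse by blast
  with assms have "invertible g" by (auto simp: invertible_def)
  then have "matrix_inv g ** g = mat 1" by (rule matrix_inv)
  then show ?thesis using assms by (metis matrix_mul_assoc matrix_mul_lid matrix_mul_rid)
qed

section \<open>The algebra of a nondegenerate Hermitian form\<close>

locale su_form =
  fixes B :: "complex^'n \<Rightarrow> complex^'n::finite \<Rightarrow> complex"
  assumes hermitian: "hermitian_form (*s) UNIV B"
    and nondegenerate: "nondegenerate_form UNIV B"
begin

lemma B_add: "B (u + v) w = B u w + B v w" "B w (u + v) = B w u + B w v"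
  using hermitian unfolding hermitian_form_def sesquilinear_form_def by blast+

lemma B_scale: "B (c *s u) v = cnj c * B u v" "B u (c *s v) = c * B u v"
  using hermitian unfolding hermitian_form_def sesquilinear_form_def by blast+

lemma B_commute: "B v u = cnj (B u v)"
  using hermitian unfolding hermitian_form_def by blast

lemma B_zero [simp]: "B 0 v = 0" "B u 0 = 0"
  using B_scale(1)[of 0 0 v] B_scale(2)[of u 0 0] by simp_all

lemma B_minus: "B (- u) v = - B u v" "B u (- v) = - B u v"
  using B_scale(1)[of "-1" u v] B_scale(2)[of u "-1" v] by (simp_all add: vector_smult_lneg)

lemma B_diff: "B (u - v) w = B u w - B v w" "B w (u - v) = B w u - B w v"
  using B_add(1)[of u "- v" w] B_add(2)[of w u "- v"] by (simp_all add: B_minus)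

lemma B_scaleR: "B (r *\<^sub>R u) v = r *\<^sub>R B u v" "B u (r *\<^sub>R v) = r *\<^sub>R B u v"
proof -
  have "r *\<^sub>R w = complex_of_real r *s w" for w :: "complex^'n"
    by (simp add: vec_eq_iff scaleR_conv_of_real[where 'a=complex])
  then show "B (r *\<^sub>R u) v = r *\<^sub>R B u v" "B u (r *\<^sub>R v) = r *\<^sub>R B u v"
    by (simp_all add: B_scale scaleR_conv_of_real[where 'a=complex])
qed

lemma B_eqI:
  assumes "\<And>u. B u v = B u w" shows "v = w"
proof -
  have "B (v - w) u = 0" for u
    unfolding B_commute[of "v - w" u] by (simp add: B_diff assms)
  then have "v - w = 0" using nondegenerate unfolding nondegenerate_form_def by blast
  then show ?thesis by simp
qed

lemma matrix_eqI: "(\<And>u v. B u (M *v v) = B u (N *v v)) \<Longrightarrow> M = N"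
  by (simp add: matrix_eq B_eqI)

definition gram :: "complex^'n^'n" where "gram = (\<chi> i j. B (axis i 1) (axis j 1))"

lemma B_sum: "B (\<Sum>i\<in>I. f i) w = (\<Sum>i\<in>I. B (f i) w)" "B w (\<Sum>i\<in>I. f i) = (\<Sum>i\<in>I. B w (f i))"
  by (induction I rule: infinite_finite_induct; simp add: B_add)+

lemma B_gram: "B u v = (\<Sum>i\<in>UNIV. cnj (u $ i) * (gram *v v) $ i)"
proof -
  have "B u v = B (\<Sum>i\<in>UNIV. u $ i *s axis i 1) (\<Sum>j\<in>UNIV. v $ j *s axis j 1)"
    by (simp add: basis_expansion)
  also have "\<dots> = (\<Sum>i\<in>UNIV. \<Sum>j\<in>UNIV. cnj (u $ i) * (v $ j * B (axis i 1) (axis j 1)))"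
    by (simp only: B_sum B_scale, subst sum.swap) (simp add: sum_distrib_left mult.left_commute)
  finally show ?thesis
    by (simp add: gram_def matrix_vector_mult_def sum_distrib_left mult.commute)
qed

lemma invertible_gram: "invertible gram"
proof -
  have "\<forall>v. gram *v v = 0 \<longrightarrow> v = 0"
    using B_eqI[of _ 0] by (simp add: B_gram)
  then show ?thesis
    by (simp add: invertible_left_inverse matrix_left_invertible_ker)
qed

lemma gram_inv: "gram ** matrix_inv gram = mat 1" "matrix_inv gram ** gram = mat 1"
  using invertible_gram by (auto intro: matrix_inv)

text \<open>The adjoint with respect to \<open>B\<close>, as \<open>B_star\<close> confirms. The
  explicit conjugation of \<open>ctranspose\<close> by the Gram matrix is what yields its trace and
  determinant.\<close>

definition star :: "complex^'n^'n \<Rightarrow> complex^'n^'n" where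
  "star A = matrix_inv gram ** ctranspose A ** gram"

lemma B_star: "B (A *v u) v = B u (star A *v v)"
proof -
  have "gram *v (star A *v v) = ctranspose A *v (gram *v v)"
    by (simp add: star_def matrix_vector_mul_assoc matrix_mul_assoc gram_inv)
  then have "B u (star A *v v) = (\<Sum>k\<in>UNIV. \<Sum>i\<in>UNIV. cnj (u $ k) * (cnj (A $ i $ k) * (gram *v v) $ i))"
    by (simp add: B_gram matrix_vector_mult_def[of "ctranspose A"] sum_distrib_left)
  also have "\<dots> = B (A *v u) v"
    by (subst sum.swap)
       (simp add: B_gram matrix_vector_mult_def[of A] sum_distrib_right sum_distrib_left algebra_simps)
  finally show ?thesis ..
qed

lemma star_eqI: "(\<And>u v. B (A *v u) v = B u (M *v v)) \<Longrightarrow> star A = M"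
  by (rule matrix_eqI) (simp flip: B_star)

lemma star_star [simp]: "star (star A) = A"
  by (rule star_eqI) (metis B_commute B_star)

lemma star_add: "star (A + C) = star A + star C"
  by (rule star_eqI) (simp add: B_star matrix_vector_mult_add_rdistrib B_add)

lemma star_diff: "star (A - C) = star A - star C"
  by (rule star_eqI) (simp add: B_star matrix_vector_mult_diff_rdistrib B_diff)

lemma star_minus: "star (- A) = - star A"
  using star_diff[of 0 A] star_diff[of 0 0] by simp

lemma star_scaleR: "star (r *\<^sub>R A) = r *\<^sub>R star A"
  by (rule star_eqI) (simp add: B_star mult_scaleR_vector B_scaleR)

lemma star_mult: "star (A ** C) = star C ** star A"
  by (rule star_eqI) (simp add: B_star flip: matrix_vector_mul_assoc)

lemma star_mat: "star (mat c) = mat (cnj c)"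
  by (rule star_eqI) (simp add: mat_mult_vector B_scale)

lemma trace_star: "trace (star A) = cnj (trace A)"
  unfolding star_def
  by (subst trace_mul_sym) (simp add: matrix_mul_assoc gram_inv trace_ctranspose)

lemma det_star: "det (star A) = cnj (det A)"
proof -
  have "det (matrix_inv gram) * det gram = 1"
    by (simp flip: det_mul add: gram_inv)
  then show ?thesis by (simp add: star_def det_mul det_ctranspose)
qed

abbreviation L where "L \<equiv> special_unitary_algebra B"
abbreviation G where "G \<equiv> special_unitary_group B"

lemma L_iff: "A \<in> L \<longleftrightarrow> trace A = 0 \<and> star A = - A"
proof -
  have "(\<forall>u v. B (A *v u) v + B u (A *v v) = 0) \<longleftrightarrow> (\<forall>u v. B u (star A *v v) = B u ((- A) *v v))"
    by (simp add: B_star neg_mult_vector B_minus eq_neg_iff_add_eq_0)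
  also have "\<dots> \<longleftrightarrow> star A = - A" by (auto intro: matrix_eqI)
  finally show ?thesis by (simp add: special_unitary_algebra_def)
qed

lemma isometry_iff: "(\<forall>u v. B (g *v u) (g *v v) = B u v) \<longleftrightarrow> star g ** g = mat 1"
proof -
  have "(\<forall>u v. B (g *v u) (g *v v) = B u v) \<longleftrightarrow> (\<forall>u v. B u ((star g ** g) *v v) = B u (mat 1 *v v))"
    by (simp add: B_star flip: matrix_vector_mul_assoc)
  also have "\<dots> \<longleftrightarrow> star g ** g = mat 1" by (auto intro: matrix_eqI)
  finally show ?thesis .
qed

lemma G_iff: "g \<in> G \<longleftrightarrow> det g = 1 \<and> star g ** g = mat 1"
  by (simp add: special_unitary_group_def isometry_iff)

lemma isometry_inv:
  assumes "star g ** g = mat 1"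
  shows "matrix_inv g = star g" "g ** star g = mat 1"
proof -
  show "g ** star g = mat 1" using assms matrix_left_right_inverse by blast
  then show "matrix_inv g = star g" by (rule matrix_inv_eqI)
qed

text \<open>Rescaling an isometry by a unit complex number achieves determinant one.\<close>

lemma isometry_conj_in_orbit:
  assumes g: "star g ** g = mat 1"
  shows "g ** x ** star g \<in> adjoint_orbit G x"
proof -
  have "cnj (det g) * det g = 1" using arg_cong[OF g, of det] by (simp add: det_mul det_star)
  then have "complex_of_real ((cmod (det g))\<^sup>2) = complex_of_real 1"
    by (simp only: complex_norm_square mult.commute of_real_1)
  then have "(cmod (det g))\<^sup>2 = 1" by (simp only: of_real_eq_iff)
  then have "cmod (det g) = 1"
    using norm_ge_zero[of "det g"] by (auto simp: power2_eq_1_iff)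
  define n where "n = CARD('n)"
  have n: "n > 0" by (simp add: n_def)
  \<comment> \<open>An \<open>n\<close>-th root of the inverse of \<open>det g\<close>, on the unit
    circle because \<open>det g\<close> is; the scalar matrix \<open>mat c\<close> has determinant
    \<open>c ^ n\<close>.\<close>
  define c where "c = cis (- Arg (det g) / n)"
  have "real n * (- Arg (det g) / real n) = - Arg (det g)" using n by simp
  then have "c ^ n = cis (- Arg (det g))" by (simp only: c_def Complex.DeMoivre)
  moreover have "det g = cis (Arg (det g))" using \<open>cmod (det g) = 1\<close>
    by (metis cis_rcis_eq rcis_cmod_Arg)
  ultimately have cdet: "c ^ n * det g = 1" by (metis cis_mult add.left_inverse cis_zero)
  have cc: "cnj c * c = 1" by (simp add: c_def cis_cnj cis_mult)
  let ?g = "mat c ** g"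
  have "det (mat c :: complex^'n^'n) = c ^ n"
    by (subst det_diagonal) (simp_all add: mat_def n_def)
  then have "det ?g = 1" using cdet by (simp add: det_mul)
  moreover have 1: "star ?g ** ?g = mat 1"
  proof -
    have "star ?g ** ?g = star g ** (mat (cnj c) ** mat c) ** g"
      by (simp add: star_mult star_mat matrix_mul_assoc)
    also have "mat (cnj c) ** mat c = (mat 1 :: complex^'n^'n)"
      using cc by (simp add: vec_eq_iff mat_mult_component) (simp add: mat_def)
    finally show ?thesis using g by simp
  qed
  ultimately have "?g \<in> G" by (simp add: G_iff)
  moreover have "?g ** x ** matrix_inv ?g = g ** x ** star g"
  proof -
    have "?g ** x ** matrix_inv ?g = mat c ** (g ** x ** star g) ** mat (cnj c)"
      by (simp add: isometry_inv[OF 1] star_mult star_mat matrix_mul_assoc)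
    also have "\<dots> = mat (cnj c) ** (mat c ** (g ** x ** star g))"
      by (simp add: mat_mult_commute[of "cnj c"])
    also have "\<dots> = g ** x ** star g"
      using cc by (simp add: vec_eq_iff mat_mult_component flip: mult.assoc)
    finally show ?thesis .
  qed
  ultimately show ?thesis unfolding adjoint_orbit_def by (metis (mono_tags, lifting) mem_Collect_eq)
qed

text \<open>Scalar matrices act trivially by conjugation, so dropping the determinant condition does
  not enlarge the orbit. From here on group elements are just isometries.\<close>

lemma adjoint_orbit_eq: "adjoint_orbit G x = {g ** x ** star g | g. star g ** g = mat 1}"
proof
  show "adjoint_orbit G x \<subseteq> {g ** x ** star g | g. star g ** g = mat 1}"
    using isometry_inv by (auto simp: adjoint_orbit_def G_iff)
qed (use isometry_conj_in_orbit in auto)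

lemma adjoint_orbit_trans:
  assumes "y \<in> adjoint_orbit G x" "z \<in> adjoint_orbit G y"
  shows "z \<in> adjoint_orbit G x"
proof -
  obtain g k where g: "star g ** g = mat 1" "y = g ** x ** star g"
    and k: "star k ** k = mat 1" "z = k ** y ** star k"
    using assms unfolding adjoint_orbit_eq by blast
  have "z = (k ** g) ** x ** star (k ** g)" by (simp add: g(2) k(2) star_mult matrix_mul_assoc)
  moreover have "star (k ** g) ** (k ** g) = star g ** (star k ** k) ** g"
    by (simp add: star_mult matrix_mul_assoc)
  ultimately show ?thesis using g(1) k(1) unfolding adjoint_orbit_eq by auto
qed

lemma conj_in_L:
  assumes "A \<in> L" "star g ** g = mat 1" shows "g ** A ** star g \<in> L"
  using assms isometry_inv(2)[OF assms(2)]
  by (auto simp: L_iff star_mult matrix_mul_assoc matrix_ring_simps trace_mul_sym[of _ "star g"])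

lemma adjoint_orbit_in_L: "x \<in> L \<Longrightarrow> y \<in> adjoint_orbit G x \<Longrightarrow> y \<in> L"
  by (auto simp: adjoint_orbit_eq intro: conj_in_L)

lemma subspace_L: "subspace L"
proof -
  have "star 0 = 0" using star_diff[of 0 0] by simp
  then show ?thesis
    using trace_0 by (simp add: subspace_def L_iff trace_add star_add star_scaleR trace_scaleR)
qed

lemma lie_bracket_in_L: "A \<in> L \<Longrightarrow> C \<in> L \<Longrightarrow> lie_bracket A C \<in> L"
  by (simp add: L_iff trace_lie_bracket) (simp add: lie_bracket_def star_diff star_mult matrix_ring_simps)

text \<open>The skew part for \<open>star\<close>, after removal of the scalar matrix that carries
  its imaginary trace. This is the projection that \<open>trace_on_projection\<close> asks
  for.\<close>

definition L_proj :: "complex^'n^'n \<Rightarrow> complex^'n^'n" where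
  "L_proj Z = (1/2) *\<^sub>R ((Z - star Z) - mat ((trace Z - cnj (trace Z)) / of_nat CARD('n)))"

lemma L_proj: "linear L_proj" "L_proj Z \<in> L" "Z \<in> L \<Longrightarrow> L_proj Z = Z"
proof -
  have "mat (a + b) = (mat a + mat b :: complex^'n^'n)" "mat (r *\<^sub>R a) = (r *\<^sub>R mat a :: complex^'n^'n)" for a b r
    by (simp_all add: vec_eq_iff mat_def)
  note m = this
  have d: "(a + b - (cnj a + cnj b)) / k = (a - cnj a) / k + (b - cnj b) / k" for a b k :: complex
    by (simp add: add_divide_distrib diff_divide_distrib)
  have e: "(r *\<^sub>R a - r *\<^sub>R cnj a) / k = r *\<^sub>R ((a - cnj a) / k)" for r and a k :: complex
    by (simp add: scaleR_conv_of_real right_diff_distrib)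
  show "linear L_proj"
    by (rule linearI) (simp_all add: L_proj_def star_add trace_add star_scaleR trace_scaleR d e m algebra_simps)
  show "L_proj Z \<in> L"
    unfolding L_iff
  proof
    show "trace (L_proj Z) = 0"
      by (simp add: L_proj_def trace_scaleR trace_sub trace_mat trace_star)
    have "mat (- a) = (- mat a :: complex^'n^'n)" for a by (simp add: vec_eq_iff mat_def)
    moreover have "cnj ((trace Z - cnj (trace Z)) / of_nat CARD('n)) = - ((trace Z - cnj (trace Z)) / of_nat CARD('n))"
      by (simp add: field_simps)
    ultimately show "star (L_proj Z) = - L_proj Z"
      unfolding L_proj_def star_scaleR star_diff star_mat star_star by (simp flip: scaleR_minus_right)
  qed
  show "L_proj Z = Z" if "Z \<in> L"
    using that by (simp add: L_iff L_proj_def flip: scaleR_2)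
qed

text \<open>With \<open>T = ad A ad C\<close>, the projection onto \<open>L\<close> turns \<open>T Z\<close> into \<open>(T Z - star (T Z)) / 2\<close>,
  and the second summand is antilinear in \<open>Z\<close>.\<close>

lemma killing_form_eq:
  assumes A: "A \<in> L" and C: "C \<in> L"
  shows "killing_form L A C = 2 * of_nat CARD('n) * Re (trace (A ** C))"
proof -
  let ?T = "\<lambda>Z. lie_bracket A (lie_bracket C Z)"
  have "linear ?T" using linear_compose[OF linear_lie_bracket(1) linear_lie_bracket(1)] by (simp add: o_def)
  then have "killing_form L A C = real_trace (\<lambda>z. L_proj (?T z))"
    unfolding killing_form_def
    by (intro trace_on_projection subspace_L L_proj lie_bracket_in_L A C)
  \<comment> \<open>Brackets are traceless, so the scalar correction in \<open>L_proj\<close>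
    disappears.\<close>
  also have "(\<lambda>z. L_proj (?T z)) = (\<lambda>z. (1/2) *\<^sub>R (?T z - star (?T z)))"
    by (simp add: L_proj_def trace_lie_bracket)
  also have "real_trace \<dots> = (real_trace ?T - real_trace (\<lambda>z. star (?T z))) / 2"
    by (simp add: real_trace_scaleR real_trace_diff)
  also have "real_trace (\<lambda>z. star (?T z)) = 0"
  proof (rule real_trace_antilinear)
    fix Z
    have lie: "lie_bracket M (mat \<i> ** N) = mat \<i> ** lie_bracket M N" for M N :: "complex^'n^'n"
      unfolding lie_bracket_def matrix_ring_simps mat_mult_commute[of \<i> M, symmetric] ..
    have "mat (- \<i>) = (- mat \<i> :: complex^'n^'n)" by (simp add: vec_eq_iff mat_def)
    then show "star (?T (mat \<i> ** Z)) = - (mat \<i> ** star (?T Z))"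
      unfolding lie star_mult star_mat by (simp add: mat_mult_commute matrix_ring_simps)
  qed
  finally show ?thesis using A C by (simp add: real_trace_lie_brackets L_iff)
qed

lemma killing_form_invariant:
  assumes "A \<in> L" "C \<in> L" "D \<in> L"
  shows "killing_form L A (lie_bracket C D) = killing_form L (lie_bracket A C) D"
proof -
  have "trace (A ** D ** C) = trace (C ** A ** D)"
    by (simp add: trace_mul_sym[of "A ** D" C] matrix_mul_assoc)
  then show ?thesis
    using assms
    by (simp add: killing_form_eq lie_bracket_in_L)
       (simp add: lie_bracket_def matrix_ring_simps trace_sub)
qed

text \<open>For skew traceless \<open>A\<close>,
  \<open>Re (trace (A ** L_proj Z)) = Re (trace (A ** Z))\<close>. Orthogonality to \<open>L\<close>
  is therefore orthogonality to all matrices, in particular to \<open>ctranspose A\<close>.\<close>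

lemma killing_form_nondegenerate:
  assumes A: "A \<in> L" and 0: "\<And>C. C \<in> L \<Longrightarrow> killing_form L A C = 0"
  shows "A = 0"
proof -
  have "Re (trace (A ** Z)) = 0" for Z
  proof -
    have "A ** L_proj Z = (1/2) *\<^sub>R ((A ** Z - A ** star Z) - mat ((trace Z - cnj (trace Z)) / of_nat CARD('n)) ** A)"
      by (simp add: L_proj_def matrix_ring_simps mat_mult_commute)
    then have "Re (trace (A ** L_proj Z)) = (Re (trace (A ** Z)) - Re (trace (A ** star Z))) / 2"
      using A by (simp add: trace_scaleR trace_sub trace_mat_mult L_iff)
    moreover have "A ** star Z = - star (Z ** A)" using A by (simp add: star_mult L_iff matrix_ring_simps)
    then have "Re (trace (A ** star Z)) = - Re (trace (A ** Z))"
      by (simp add: trace_neg trace_star trace_mul_sym[of Z])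
    ultimately show ?thesis using 0[OF L_proj(2)] A by (simp add: killing_form_eq L_proj(2))
  qed
  then have "(\<Sum>i\<in>UNIV. \<Sum>j\<in>UNIV. (cmod (A $ i $ j))\<^sup>2) = 0"
    by (simp flip: trace_mult_ctranspose)
  then show ?thesis
    by (simp add: sum_nonneg_eq_0_iff sum_nonneg vec_eq_iff)
qed

lemma orbit_symplectic_eq:
  assumes y: "y \<in> L" and A: "A \<in> L" and C: "C \<in> L"
  shows "orbit_symplectic L y (lie_bracket A y) (lie_bracket C y) = killing_form L y (lie_bracket A C)"
  unfolding orbit_symplectic_def
proof (rule the_equality)
  fix c assume "\<exists>A'\<in>L. \<exists>C'\<in>L. lie_bracket A' y = lie_bracket A y \<and> lie_bracket C' y = lie_bracket C y \<and>
      c = killing_form L y (lie_bracket A' C')"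
  then obtain A' C' where *: "A' \<in> L" "C' \<in> L" "lie_bracket A' y = lie_bracket A y" "lie_bracket C' y = lie_bracket C y"
      "c = killing_form L y (lie_bracket A' C')" by blast
  have sw: "lie_bracket a b = - lie_bracket b a" for a b :: "complex^'n^'n" by (simp add: lie_bracket_def)
  have r: "lie_bracket y A' = lie_bracket y A" "lie_bracket y C' = lie_bracket y C"
    using *(3,4) sw by metis+
  have anti: "killing_form L y (lie_bracket a b) = - killing_form L y (lie_bracket b a)" if "a \<in> L" "b \<in> L" for a b
  proof -
    have "trace (y ** lie_bracket a b) = - trace (y ** lie_bracket b a)"
      by (subst sw) (simp add: matrix_ring_simps trace_neg)
    then show ?thesis using that y by (simp add: killing_form_eq lie_bracket_in_L)
  qed
  \<comment> \<open>Invariance moves \<open>y\<close> into a bracket with \<open>A'\<close>, where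
    \<open>A'\<close> may be exchanged for \<open>A\<close>; antisymmetry then allows the same
    exchange for \<open>C'\<close>.\<close>
  have "c = killing_form L y (lie_bracket A C')"
    using * y A by (simp add: killing_form_invariant r)
  also have "\<dots> = - killing_form L y (lie_bracket C A)"
    using * y A C by (subst anti) (auto simp: killing_form_invariant r)
  also have "\<dots> = killing_form L y (lie_bracket A C)" by (simp only: anti[OF C A] minus_minus)
  finally show "c = killing_form L y (lie_bracket A C)" .
qed (use A C in blast)

end

section \<open>Symplectic families\<close>

context vector_space
begin

lemma independent_indexed_family:
  fixes e :: "nat \<Rightarrow> 'b"
  assumes 0: "\<And>c i. (\<Sum>i<k. scale (c i) (e i)) = 0 \<Longrightarrow> i < k \<Longrightarrow> c i = 0"
  shows "inj_on e {..<k}" "independent (e ` {..<k})"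
proof -
  show inj: "inj_on e {..<k}"
  proof (rule inj_onI)
    fix i j assume ij: "i \<in> {..<k}" "j \<in> {..<k}" "e i = e j"
    show "i = j"
    proof (rule ccontr)
      assume "i \<noteq> j"
      let ?c = "\<lambda>l. if l = i then 1 else if l = j then - 1 else (0::'a)"
      have "(\<Sum>l<k. scale (?c l) (e l)) = (\<Sum>l<k. (if l = i then e i else 0) + (if l = j then - e j else 0))"
        using \<open>i \<noteq> j\<close> by (intro sum.cong) auto
      also have "\<dots> = 0" using ij by (simp add: sum.distrib)
      finally have "?c i = 0" using ij by (intro 0[where c = ?c]) auto
      then show False by simp
    qed
  qed
  show "independent (e ` {..<k})"
  proof (rule independent_if_scalars_zero)
    fix f x assume f: "(\<Sum>x\<in>e ` {..<k}. scale (f x) x) = 0" and "x \<in> e ` {..<k}"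
    then obtain i where i: "i < k" "x = e i" by auto
    have "(\<Sum>i<k. scale (f (e i)) (e i)) = 0" using f by (simp add: sum.reindex[OF inj])
    then show "f x = 0" using i 0[where c = "\<lambda>i. f (e i)"] by simp
  qed simp
qed

end

text \<open>The standard symplectic matrix, with the conjugate basis vectors at the adjacent indices
  \<open>2 k\<close> and \<open>2 k + 1\<close> instead of in two halves: this is how
  \<open>wedge_power\<close> pairs its arguments.\<close>

definition symplectic_unit :: "nat \<Rightarrow> nat \<Rightarrow> real" where
  "symplectic_unit i j = (if even i \<and> j = i + 1 then 1 else if even j \<and> i = j + 1 then - 1 else 0)"

lemma double_neq_Suc_double: "2 * a \<noteq> Suc (2 * b)" "Suc (2 * b) \<noteq> 2 * a"
  by presburger+

lemma symplectic_unit_simps [simp]: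
  "symplectic_unit (2 * k) (2 * l) = 0" "symplectic_unit (Suc (2 * k)) (Suc (2 * l)) = 0"
  "symplectic_unit (2 * k) (Suc (2 * l)) = (if k = l then 1 else 0)"
  "symplectic_unit (Suc (2 * k)) (2 * l) = (if k = l then - 1 else 0)"
  by (simp_all add: symplectic_unit_def double_neq_Suc_double)

text \<open>Exchanges the pairs with numbers \<open>a\<close> and \<open>b\<close>, keeping the
  order inside each pair. As a product of two transpositions it is even.\<close>

definition pair_transpose :: "nat \<Rightarrow> nat \<Rightarrow> nat \<Rightarrow> nat" where
  "pair_transpose a b = Transposition.transpose (2 * a) (2 * b) \<circ> Transposition.transpose (Suc (2 * a)) (Suc (2 * b))"

lemma pair_transpose_simps:
  "pair_transpose a b (2 * k) = 2 * Transposition.transpose a b k"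
  "pair_transpose a b (Suc (2 * k)) = Suc (2 * Transposition.transpose a b k)"
  by (auto simp: pair_transpose_def Transposition.transpose_def double_neq_Suc_double)

lemma symplectic_unit_pair_transpose:
  "symplectic_unit (pair_transpose a b i) (pair_transpose a b j) = symplectic_unit i j"
proof -
  have "\<exists>k. i = 2 * k \<or> i = Suc (2 * k)" "\<exists>k. j = 2 * k \<or> j = Suc (2 * k)"
    by presburger+
  moreover have "Transposition.transpose a b k = Transposition.transpose a b l \<longleftrightarrow> k = l" for k l
    by (metis transpose_involutory)
  ultimately show ?thesis by (auto simp: pair_transpose_simps)
qed

lemma sign_pair_transpose: "sign (pair_transpose a b) = 1"
  by (simp add: pair_transpose_def sign_compose permutation_swap_id sign_swap_id)

text \<open>A permutation with nonzero contribution permutes the pairs \<open>{2i, 2i + 1}\<close>. Swapping two pairs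
  is an even permutation, and a swap inside a pair changes both factors.\<close>

lemma symplectic_term_nonneg:
  assumes "\<sigma> permutes {..<2 * m}"
  shows "0 \<le> of_int (sign \<sigma>) * (\<Prod>i<m. symplectic_unit (\<sigma> (2 * i)) (\<sigma> (Suc (2 * i))))"
  using assms
proof (induction m arbitrary: \<sigma>)
  case (Suc m)
  let ?F = "\<lambda>m \<sigma>. of_int (sign \<sigma>) * (\<Prod>i<m. symplectic_unit (\<sigma> (2 * i)) (\<sigma> (Suc (2 * i))))"
  let ?N = "{..<2 * Suc m}"
  show ?case
  proof (cases "symplectic_unit (\<sigma> (2 * m)) (\<sigma> (Suc (2 * m))) = 0")
    case False
    have perm: "permutation \<tau>" if "\<tau> permutes ?N" for \<tau>
      using that permutation_permutes by blast
    obtain \<sigma>' where s': "\<sigma>' permutes ?N" "?F (Suc m) \<sigma>' = ?F (Suc m) \<sigma>"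
      "even (\<sigma>' (2 * m))" "\<sigma>' (Suc (2 * m)) = Suc (\<sigma>' (2 * m))"
    proof (cases "even (\<sigma> (2 * m))")
      case True
      with False have "\<sigma> (Suc (2 * m)) = Suc (\<sigma> (2 * m))"
        by (auto simp: symplectic_unit_def split: if_splits)
      then show ?thesis using that[of \<sigma>] Suc.prems True by blast
    next
      case odd: False
      with False have *: "\<sigma> (2 * m) = Suc (\<sigma> (Suc (2 * m)))" "even (\<sigma> (Suc (2 * m)))"
        by (auto simp: symplectic_unit_def split: if_splits)
      let ?t = "Transposition.transpose (2 * m) (Suc (2 * m))"
      have t: "?t permutes ?N" by (rule permutes_swap_id) auto
      have p: "(\<sigma> \<circ> ?t) permutes ?N" using permutes_compose[OF t Suc.prems] .
      have "sign (\<sigma> \<circ> ?t) = - sign \<sigma>"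
        using perm[OF Suc.prems] perm[OF t] by (simp add: sign_compose sign_swap_id)
      moreover have "(\<Prod>i<m. symplectic_unit ((\<sigma> \<circ> ?t) (2 * i)) ((\<sigma> \<circ> ?t) (Suc (2 * i))))
          = (\<Prod>i<m. symplectic_unit (\<sigma> (2 * i)) (\<sigma> (Suc (2 * i))))"
        by (intro prod.cong) (auto simp: Transposition.transpose_def double_neq_Suc_double)
      moreover have "symplectic_unit ((\<sigma> \<circ> ?t) (2 * m)) ((\<sigma> \<circ> ?t) (Suc (2 * m))) = 1"
        "symplectic_unit (\<sigma> (2 * m)) (\<sigma> (Suc (2 * m))) = - 1"
        using * by (auto simp: symplectic_unit_def)
      ultimately have "?F (Suc m) (\<sigma> \<circ> ?t) = ?F (Suc m) \<sigma>" by simp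
      then show ?thesis using that[of "\<sigma> \<circ> ?t"] p * by simp
    qed
    obtain j where j: "\<sigma>' (2 * m) = 2 * j" using s'(3) by blast
    have "\<sigma>' (2 * m) \<in> ?N" using permutes_in_image[OF s'(1)] by simp
    then have "j \<le> m" using j by simp
    \<comment> \<open>Brings the image of the last pair back to its own place, so that the composite
      fixes both indices and the induction hypothesis applies to the first \<open>m\<close>
      pairs.\<close>
    define \<rho> where "\<rho> = pair_transpose j m"
    have r: "\<rho> permutes ?N" unfolding \<rho>_def pair_transpose_def
      using \<open>j \<le> m\<close> by (intro permutes_compose permutes_swap_id) auto
    have p: "(\<rho> \<circ> \<sigma>') permutes ?N" using permutes_compose[OF s'(1) r] .
    have fx: "(\<rho> \<circ> \<sigma>') (2 * m) = 2 * m" "(\<rho> \<circ> \<sigma>') (Suc (2 * m)) = Suc (2 * m)"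
      using s'(4) j by (simp_all add: \<rho>_def pair_transpose_simps)
    have "sign (\<rho> \<circ> \<sigma>') = sign \<sigma>'"
      using perm[OF r] perm[OF s'(1)] by (simp add: sign_compose \<rho>_def sign_pair_transpose)
    then have "?F (Suc m) (\<rho> \<circ> \<sigma>') = ?F (Suc m) \<sigma>'"
      by (simp add: \<rho>_def symplectic_unit_pair_transpose)
    moreover have "(\<rho> \<circ> \<sigma>') permutes {..<2 * m}"
    proof (rule permutes_superset[OF p])
      fix i assume "i \<in> ?N - {..<2 * m}"
      then have "i = 2 * m \<or> i = Suc (2 * m)" by auto
      then show "(\<rho> \<circ> \<sigma>') i = i" using fx by blast
    qed
    then have "0 \<le> ?F m (\<rho> \<circ> \<sigma>')" by (rule Suc.IH)
    moreover have "?F (Suc m) (\<rho> \<circ> \<sigma>') = ?F m (\<rho> \<circ> \<sigma>')"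
      using fx by simp
    ultimately show ?thesis using s'(2) by simp
  qed simp
qed simp

text \<open>Every term of the expansion is nonnegative and the identity contributes 1, so positivity
  follows without counting the contributing permutations.\<close>

lemma wedge_power_symplectic_pos:
  assumes "\<And>i j. i < 2 * m \<Longrightarrow> j < 2 * m \<Longrightarrow> \<omega> (v i) (v j) = symplectic_unit i j"
  shows "wedge_power \<omega> m v > 0"
proof -
  let ?P = "{\<sigma>. \<sigma> permutes {..<2 * m}}"
  let ?F = "\<lambda>\<sigma>. of_int (sign \<sigma>) * (\<Prod>i<m. \<omega> (v (\<sigma> (2 * i))) (v (\<sigma> (2 * i + 1))))"
  have eq: "?F \<sigma> = of_int (sign \<sigma>) * (\<Prod>i<m. symplectic_unit (\<sigma> (2 * i)) (\<sigma> (Suc (2 * i))))"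
    if "\<sigma> \<in> ?P" for \<sigma>
  proof -
    have "\<sigma> (2 * i) < 2 * m" "\<sigma> (Suc (2 * i)) < 2 * m" if "i < m" for i
      using permutes_in_image[of \<sigma> "{..<2 * m}"] \<open>\<sigma> \<in> ?P\<close> that by auto
    then show ?thesis by (simp add: assms)
  qed
  have id: "id \<in> ?P" by (simp add: permutes_id)
  have "0 < sum ?F ?P"
  proof (rule sum_pos2[OF _ id])
    show "finite ?P" by (simp add: finite_permutations)
    show "0 < ?F id" unfolding eq[OF id] by simp
    show "0 \<le> ?F \<sigma>" if "\<sigma> \<in> ?P" for \<sigma>
      unfolding eq[OF that] using that symplectic_term_nonneg by blast
  qed
  then show ?thesis by (simp add: wedge_power_def)
qed

text \<open>Solved for the first index: \<open>j\<close> has exactly one partner, so that sums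
  against a column collapse to a single term.\<close>

lemma symplectic_unit_partner:
  "symplectic_unit i j = (if i = (if even j then j + 1 else j - 1) then if even j then - 1 else 1 else 0)"
  by (cases "even j"; auto simp: symplectic_unit_def double_neq_Suc_double elim!: evenE oddE)

lemma symplectic_family_coeffs:
  fixes \<Omega> :: "'a::real_vector \<Rightarrow> 'a \<Rightarrow> real"
  assumes "bilinear \<Omega>" and v: "\<And>i j. i < 2 * m \<Longrightarrow> j < 2 * m \<Longrightarrow> \<Omega> (v i) (v j) = symplectic_unit i j"
    and j: "j < 2 * m"
  shows "\<Omega> (\<Sum>i<2 * m. c i *\<^sub>R v i) (v j) = (if even j then - c (j + 1) else c (j - 1))"
proof -
  let ?p = "if even j then j + 1 else j - 1"
  have "?p < 2 * m" using j by (auto elim: oddE evenE)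
  have lin: "linear (\<lambda>a. \<Omega> a (v j))" using assms(1) by (simp add: bilinear_def)
  have "\<Omega> (\<Sum>i<2 * m. c i *\<^sub>R v i) (v j) = (\<Sum>i<2 * m. c i * \<Omega> (v i) (v j))"
    by (simp add: linear_sum[OF lin] linear_scale[OF lin])
  also have "\<dots> = (\<Sum>i<2 * m. if i = ?p then c i * (if even j then - 1 else 1) else 0)"
    using v j by (intro sum.cong) (auto simp: symplectic_unit_partner[of _ j])
  also have "\<dots> = c ?p * (if even j then - 1 else 1)"
    using \<open>?p < 2 * m\<close> by (subst sum.delta) auto
  finally show ?thesis by auto
qed

lemma symplectic_family_coeffs_0:
  fixes \<Omega> :: "'a::real_vector \<Rightarrow> 'a \<Rightarrow> real"
  assumes "bilinear \<Omega>" and v: "\<And>i j. i < 2 * m \<Longrightarrow> j < 2 * m \<Longrightarrow> \<Omega> (v i) (v j) = symplectic_unit i j"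
    and 0: "\<And>j. j < 2 * m \<Longrightarrow> \<Omega> (\<Sum>i<2 * m. c i *\<^sub>R v i) (v j) = 0" and i: "i < 2 * m"
  shows "c i = 0"
proof (cases "even i")
  case True
  then have *: "i + 1 < 2 * m" "odd (i + 1)" using i by presburger+
  show ?thesis using symplectic_family_coeffs[OF assms(1,2) *(1), of c] 0[OF *(1)] *(2) by simp
next
  case False
  then have *: "i - 1 < 2 * m" "even (i - 1)" "i - 1 + 1 = i" using i by (auto elim: oddE)
  show ?thesis using symplectic_family_coeffs[OF assms(1,2) *(1), of c] 0[OF *(1)] *(2,3) by simp
qed

lemma symplectic_projection:
  fixes \<Omega> :: "'a::real_vector \<Rightarrow> 'a \<Rightarrow> real"
  assumes "bilinear \<Omega>" and v: "\<And>i j. i < 2 * m \<Longrightarrow> j < 2 * m \<Longrightarrow> \<Omega> (v i) (v j) = symplectic_unit i j"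
  obtains c where "\<And>j. j < 2 * m \<Longrightarrow> \<Omega> (a - (\<Sum>i<2 * m. c i *\<^sub>R v i)) (v j) = 0"
proof
  \<comment> \<open>The coefficient of a vector is detected by its partner, with the sign dictated
    by \<open>symplectic_family_coeffs\<close>.\<close>
  let ?c = "\<lambda>i. if even i then \<Omega> a (v (i + 1)) else - \<Omega> a (v (i - 1))"
  fix j assume j: "j < 2 * m"
  have lin: "linear (\<lambda>a. \<Omega> a (v j))" using assms(1) by (simp add: bilinear_def)
  show "\<Omega> (a - (\<Sum>i<2 * m. ?c i *\<^sub>R v i)) (v j) = 0"
    using symplectic_family_coeffs[OF assms j, of ?c] unfolding linear_diff[OF lin]
    by (auto elim: oddE)
qed

text \<open>A family of maximal length, which exists because symplectic families are independent. If
  the residual of some \<open>a\<close> paired nontrivially with some \<open>b\<close> in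
  \<open>S\<close>, then the residuals of \<open>a\<close> and \<open>b\<close> would form one more
  hyperbolic pair. The last conclusion thus says that the family spans \<open>S\<close> modulo the
  radical of the form.\<close>

lemma exists_symplectic_family:
  fixes \<Omega> :: "'a::euclidean_space \<Rightarrow> 'a \<Rightarrow> real"
  assumes bil: "bilinear \<Omega>" and alt: "\<And>a b. \<Omega> a b = - \<Omega> b a" and S: "subspace S"
  obtains m v where "\<And>i. i < 2 * m \<Longrightarrow> v i \<in> S"
    "\<And>i j. i < 2 * m \<Longrightarrow> j < 2 * m \<Longrightarrow> \<Omega> (v i) (v j) = symplectic_unit i j"
    "\<And>a. a \<in> S \<Longrightarrow> \<exists>c. \<forall>b\<in>S. \<Omega> (a - (\<Sum>i<2 * m. c i *\<^sub>R v i)) b = 0"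
proof -
  define P where "P m v \<longleftrightarrow> (\<forall>i<2 * m. v i \<in> S) \<and>
    (\<forall>i<2 * m. \<forall>j<2 * m. \<Omega> (v i) (v j) = symplectic_unit i j)" for m and v :: "nat \<Rightarrow> 'a"
  have lin: "linear (\<lambda>a. \<Omega> a b)" "linear (\<Omega> b)" for b using bil by (auto simp: bilinear_def)
  have bound: "m \<le> DIM('a)" if "P m v" for m v
  proof -
    have v: "\<And>i j. i < 2 * m \<Longrightarrow> j < 2 * m \<Longrightarrow> \<Omega> (v i) (v j) = symplectic_unit i j"
      using that by (simp add: P_def)
    have "c i = 0" if "(\<Sum>i<2 * m. c i *\<^sub>R v i) = 0" "i < 2 * m" for c i
      by (rule symplectic_family_coeffs_0[OF bil v _ that(2), where c = c])
         (simp_all add: that(1) linear_0[OF lin(1)])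
    then have "inj_on v {..<2 * m}" "independent (v ` {..<2 * m})"
      using real_vector.independent_indexed_family by blast+
    then have "2 * m \<le> DIM('a)"
      using independent_bound[of "v ` {..<2 * m}"] by (simp add: card_image)
    then show ?thesis by simp
  qed
  define m where "m = (GREATEST m. \<exists>v. P m v)"
  have P0: "\<exists>v. P 0 v" by (simp add: P_def)
  have "\<exists>v. P m v" unfolding m_def
    by (rule GreatestI_nat[where P = "\<lambda>m. \<exists>v. P m v", OF P0]) (use bound in blast)
  then obtain v where v: "P m v" by blast
  have max: "\<not> P (Suc m) w" for w
  proof
    assume "P (Suc m) w"
    then have "Suc m \<le> m" unfolding m_def
      by (intro Greatest_le_nat[where P = "\<lambda>m. \<exists>v. P m v"]) (use bound in blast)+
    then show False by simp
  qed
  have vS: "\<And>i. i < 2 * m \<Longrightarrow> v i \<in> S"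
    and ve: "\<And>i j. i < 2 * m \<Longrightarrow> j < 2 * m \<Longrightarrow> \<Omega> (v i) (v j) = symplectic_unit i j"
    using v by (auto simp: P_def)
  have "\<exists>c. \<forall>b\<in>S. \<Omega> (a - (\<Sum>i<2 * m. c i *\<^sub>R v i)) b = 0" if a: "a \<in> S" for a
  proof -
    obtain c where c: "\<And>j. j < 2 * m \<Longrightarrow> \<Omega> (a - (\<Sum>i<2 * m. c i *\<^sub>R v i)) (v j) = 0"
      using symplectic_projection[OF bil ve] by blast
    define r where "r = a - (\<Sum>i<2 * m. c i *\<^sub>R v i)"
    have rS: "r \<in> S" unfolding r_def
      using a vS S by (intro subspace_diff subspace_sum subspace_scale) auto
    have "\<Omega> r b = 0" if b: "b \<in> S" for b
    proof (rule ccontr)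
      assume nz: "\<Omega> r b \<noteq> 0"
      obtain d where d: "\<And>j. j < 2 * m \<Longrightarrow> \<Omega> (b - (\<Sum>i<2 * m. d i *\<^sub>R v i)) (v j) = 0"
        using symplectic_projection[OF bil ve] by blast
      \<comment> \<open>The residual \<open>r\<close> is orthogonal to every \<open>v i\<close>, so
        subtracting the projection of \<open>b\<close> leaves the pairing with \<open>r\<close>
        unchanged, and the scaling makes it 1.\<close>
      define t where "t = (1 / \<Omega> r b) *\<^sub>R (b - (\<Sum>i<2 * m. d i *\<^sub>R v i))"
      have tS: "t \<in> S" unfolding t_def
        using b vS S by (intro subspace_diff subspace_sum subspace_scale) auto
      have tv: "\<Omega> t (v j) = 0" "\<Omega> r (v j) = 0" if "j < 2 * m" for j
        using d[OF that] c[OF that] by (simp_all add: t_def r_def linear_scale[OF lin(1)])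
      have vt: "\<Omega> (v j) t = 0" "\<Omega> (v j) r = 0" if "j < 2 * m" for j
        using tv[OF that] alt[of "v j"] by simp_all
      have rt: "\<Omega> r t = 1"
        using nz tv(2) by (simp add: t_def linear_scale[OF lin(2)] linear_diff[OF lin(2)] linear_sum[OF lin(2)])
      have self: "\<Omega> z z = 0" for z using alt[of z z] by simp
      define w where "w = v(2 * m := r, Suc (2 * m) := t)"
      have w: "w i = v i" if "i < 2 * m" for i using that by (simp add: w_def)
      have w': "w (2 * m) = r" "w (Suc (2 * m)) = t" by (simp_all add: w_def)
      have cases: "i < 2 * m \<or> i = 2 * m \<or> i = Suc (2 * m)" if "i < 2 * Suc m" for i using that by auto
      have far: "symplectic_unit i (2 * m) = 0" "symplectic_unit i (Suc (2 * m)) = 0"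
         "symplectic_unit (2 * m) i = 0" "symplectic_unit (Suc (2 * m)) i = 0" if "i < 2 * m" for i
        using that by (auto simp: symplectic_unit_def; presburger)+
      have "P (Suc m) w"
        unfolding P_def
      proof (intro conjI allI impI)
        fix i assume "i < 2 * Suc m"
        then show "w i \<in> S" using cases[of i] vS rS tS by (auto simp: w w')
        fix j assume "j < 2 * Suc m"
        show "\<Omega> (w i) (w j) = symplectic_unit i j"
          using cases[OF \<open>i < 2 * Suc m\<close>] cases[OF \<open>j < 2 * Suc m\<close>] tv vt rt self alt[of t r]
          by (elim disjE) (simp_all add: w w' ve far)
      qed
      then show False using max by blast
    qed
    then show ?thesis unfolding r_def by blast
  qed
  then show ?thesis using that vS ve by blast
qed

section \<open>Cayley charts of an adjoint orbit\<close>

lemma lie_bracket_mat: "lie_bracket (A - mat c) C = lie_bracket A (C::complex^'n^'n)"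
  by (simp add: lie_bracket_def matrix_ring_simps mat_mult_commute)

text \<open>\<open>K\<close> is the bound of the bilinear matrix product. For
  \<open>norm A < 1 / (2 * K)\<close> multiplication by \<open>A\<close> at least halves norms:
  hence \<open>1 - A\<close> is injective, and the equation \<open>R = 1 + A R\<close> bounds its
  inverse \<open>R\<close> by twice the norm of the identity.\<close>

lemma resolvent_bounds:
  obtains K r b :: real where "K > 0" "r > 0" "b > 0"
    "\<And>(P :: complex^'n^'n::finite) (Q :: complex^'n^'n). norm (P ** Q) \<le> K * norm P * norm Q"
    "\<And>A :: complex^'n^'n. norm A < r \<Longrightarrow> invertible (mat 1 - A) \<and> norm (matrix_inv (mat 1 - A)) \<le> b"
proof -
  obtain K where K: "K > 0" "\<forall>(P :: complex^'n^'n) (Q :: complex^'n^'n). norm (P ** Q) \<le> norm P * norm Q * K"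
    using bounded_bilinear.pos_bounded[OF bounded_bilinear_matrix_mult] by blast
  define r where "r = 1 / (2 * K)"
  define b where "b = 2 * norm (mat 1 :: complex^'n^'n) + 1"
  have half: "norm (A ** C) \<le> norm C / 2" if "norm A < r" for A C :: "complex^'n^'n"
  proof -
    have "norm (A ** C) \<le> (norm A * K) * norm C" using K(2)[rule_format, of A C] by (simp add: mult_ac)
    also have "\<dots> \<le> (1 / 2) * norm C"
      using that K(1) by (intro mult_right_mono) (auto simp: r_def field_simps)
    finally show ?thesis by simp
  qed
  have res: "invertible (mat 1 - A) \<and> norm (matrix_inv (mat 1 - A)) \<le> b" if A: "norm A < r" for A :: "complex^'n^'n"
  proof
    have "v = 0" if "(mat 1 - A) *v v = 0" for v
    proof -
      \<comment> \<open>A kernel vector is repeated in all columns, so that the estimate for matrix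
        products applies to it.\<close>
      define C :: "complex^'n^'n" where "C = (\<chi> i j. v $ i)"
      have "(A ** C) $ i $ j = (A *v v) $ i" for i j
        by (simp add: matrix_matrix_mult_def matrix_vector_mult_def C_def)
      moreover have "A *v v = v" using that by (simp add: matrix_vector_mult_diff_rdistrib)
      ultimately have "A ** C = C" by (simp add: vec_eq_iff C_def)
      then have "norm C = 0" using half[OF A, of C] by simp
      then show "v = 0" by (simp add: vec_eq_iff C_def)
    qed
    then show inv: "invertible (mat 1 - A)"
      by (auto simp: invertible_left_inverse matrix_left_invertible_ker)
    let ?R = "matrix_inv (mat 1 - A)"
    have "?R = mat 1 + A ** ?R"
      using matrix_inv(1)[OF inv] by (simp add: matrix_ring_simps diff_eq_eq)
    then have "norm ?R \<le> norm (mat 1 :: complex^'n^'n) + norm ?R / 2"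
      using half[OF A, of ?R] norm_triangle_ineq[of "mat 1" "A ** ?R"] by simp
    then show "norm ?R \<le> b" by (simp add: b_def)
  qed
  have mul: "norm (P ** Q) \<le> K * norm P * norm Q" for P Q :: "complex^'n^'n"
    using K(2)[rule_format, of P Q] by (simp add: mult_ac)
  have rb: "r > 0" "b > 0" using K(1) by (auto simp: r_def b_def add_nonneg_pos)
  show ?thesis by (rule that[OF K(1) rb mul res])
qed

text \<open>The constants of \<open>resolvent_bounds\<close> become parameters shared by all
  estimates; \<open>exists_positive_chart\<close> discharges them.\<close>

locale cayley = su_form B
  for B :: "complex^'n \<Rightarrow> complex^'n::finite \<Rightarrow> complex" +
  fixes K r b :: real
  assumes pos: "K > 0" "r > 0" "b > 0"
    and norm_mult_le: "\<And>(P :: complex^'n^'n) (Q :: complex^'n^'n). norm (P ** Q) \<le> K * norm P * norm Q"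
    and resolvent: "\<And>A :: complex^'n^'n. norm A < r \<Longrightarrow> invertible (mat 1 - A) \<and> norm (matrix_inv (mat 1 - A)) \<le> b"
begin

definition R :: "complex^'n^'n \<Rightarrow> complex^'n^'n" where "R A = matrix_inv (mat 1 - A)"

lemma R_inv:
  assumes "norm A < r"
  shows "(mat 1 - A) ** R A = mat 1" "R A ** (mat 1 - A) = mat 1"
    "(mat 1 + A) ** R (- A) = mat 1" "R (- A) ** (mat 1 + A) = mat 1"
  using matrix_inv[of "mat 1 - A"] matrix_inv[of "mat 1 - (- A)"] resolvent[of A] resolvent[of "- A"] assms
  by (simp_all add: R_def)

lemma norm_R: "norm A < r \<Longrightarrow> norm (R A) \<le> b"
  using resolvent by (simp add: R_def)

text \<open>The resolvent identity. It is the source of the Lipschitz bound, of the derivative, and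
  of the injectivity of the chart.\<close>

lemma R_diff:
  assumes A: "norm A < r" and C: "norm C < r"
  shows "R A - R C = R A ** (A - C) ** R C"
proof -
  have "R A ** ((mat 1 - C) - (mat 1 - A)) ** R C = R A ** ((mat 1 - C) ** R C) - (R A ** (mat 1 - A)) ** R C"
    by (simp add: matrix_sub_ldistrib matrix_sub_rdistrib matrix_mul_assoc)
  then show ?thesis by (simp add: R_inv(1)[OF C] R_inv(2)[OF A])
qed

lemma norm_mult3_le:
  fixes P Q S :: "complex^'n^'n"
  shows "norm (P ** Q ** S) \<le> K * K * norm P * norm Q * norm S"
proof -
  have "norm (P ** Q ** S) \<le> K * norm (P ** Q) * norm S" by (rule norm_mult_le)
  also have "\<dots> \<le> K * (K * norm P * norm Q) * norm S"
    using pos norm_mult_le by (intro mult_right_mono mult_left_mono) auto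
  finally show ?thesis by (simp add: mult_ac)
qed

lemma R_lipschitz:
  assumes A: "norm A < r" and C: "norm C < r"
  shows "norm (R A - R C) \<le> K * K * b * b * norm (A - C)"
proof -
  have "norm (R A - R C) \<le> K * K * norm (R A) * norm (A - C) * norm (R C)"
    unfolding R_diff[OF assms] by (rule norm_mult3_le)
  also have "\<dots> \<le> K * K * b * norm (A - C) * b"
    using pos norm_R[OF A] norm_R[OF C] by (intro mult_mono mult_right_mono mult_left_mono) auto
  finally show ?thesis by (simp add: mult_ac)
qed

lemma continuous_on_R: "continuous_on {A. norm A < r} R"
proof (rule lipschitz_on_continuous_on)
  show "(K * K * b * b)-lipschitz_on {A. norm A < r} R"
    using R_lipschitz pos by (auto simp: lipschitz_on_def dist_norm)
qed

lemma R_0: "R 0 = mat 1"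
  using R_inv(1)[of 0] pos by simp

text \<open>By the resolvent identity the remainder is \<open>(R C - R A) ((t - t0) H) R A\<close>,
  which is quadratic in \<open>t - t0\<close> because \<open>R\<close> is Lipschitz.\<close>

lemma has_vector_derivative_R:
  assumes A: "norm A < r"
  shows "((\<lambda>t. R (A + (t - t0) *\<^sub>R H)) has_vector_derivative R A ** H ** R A) (at t0)"
proof -
  \<comment> \<open>A radius within which the perturbed matrix stays in the ball; the
    \<open>+ 1\<close> in the denominator covers \<open>H = 0\<close>.\<close>
  obtain e where e: "e > 0" "\<And>t. \<bar>t - t0\<bar> < e \<Longrightarrow> norm (A + (t - t0) *\<^sub>R H) < r"
  proof
    show "(r - norm A) / (norm H + 1) > 0" using A by (simp add: add_nonneg_pos)
    fix t assume "\<bar>t - t0\<bar> < (r - norm A) / (norm H + 1)"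
    then have "\<bar>t - t0\<bar> * (norm H + 1) < r - norm A"
      by (simp add: pos_less_divide_eq add_nonneg_pos)
    moreover have "\<bar>t - t0\<bar> * norm H \<le> \<bar>t - t0\<bar> * (norm H + 1)" by (intro mult_left_mono) auto
    ultimately show "norm (A + (t - t0) *\<^sub>R H) < r"
      using norm_triangle_ineq[of A "(t - t0) *\<^sub>R H"] by simp
  qed
  define c where "c = K * K * (K * K * b * b * norm H) * norm H * b"
  show ?thesis unfolding has_vector_derivative_def
  proof (rule has_derivativeI_sandwich[OF e(1), where H = "\<lambda>t. c * \<bar>t - t0\<bar>"])
    show "bounded_linear (\<lambda>x. x *\<^sub>R (R A ** H ** R A))" by (rule bounded_linear_scaleR_left)
    have "((\<lambda>t. c * \<bar>t - t0\<bar>) \<longlongrightarrow> c * \<bar>t0 - t0\<bar>) (at t0)" by (intro tendsto_intros)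
    then show "((\<lambda>t. c * \<bar>t - t0\<bar>) \<longlongrightarrow> 0) (at t0)" by simp
    fix t assume t: "t \<noteq> t0" "dist t t0 < e"
    let ?C = "A + (t - t0) *\<^sub>R H"
    have C: "norm ?C < r" using e(2) t(2) by (simp add: dist_real_def)
    have "R ?C - R A - (t - t0) *\<^sub>R (R A ** H ** R A) = (R ?C - R A) ** ((t - t0) *\<^sub>R H) ** R A"
      by (subst R_diff[OF C A]) (simp add: matrix_ring_simps scaleR_diff_right)
    then have "norm (R ?C - R A - (t - t0) *\<^sub>R (R A ** H ** R A))
        \<le> K * K * norm (R ?C - R A) * norm ((t - t0) *\<^sub>R H) * norm (R A)"
      by (simp only: norm_mult3_le)
    also have "\<dots> \<le> K * K * (K * K * b * b * norm ((t - t0) *\<^sub>R H)) * norm ((t - t0) *\<^sub>R H) * b"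
      using pos norm_R[OF A] R_lipschitz[OF C A] by (intro mult_mono mult_left_mono mult_nonneg_nonneg) auto
    also have "\<dots> = c * \<bar>t - t0\<bar> * \<bar>t - t0\<bar>" by (simp add: c_def)
    finally show "norm (R (A + (t - t0) *\<^sub>R H) - R (A + (t0 - t0) *\<^sub>R H) - (t - t0) *\<^sub>R (R A ** H ** R A)) / norm (t - t0)
        \<le> c * \<bar>t - t0\<bar>"
      using t(1) by (simp add: field_simps)
  qed
qed

text \<open>Equals \<open>(1 - A)^-1 (1 + A)\<close>; in this form continuity and derivative are
  inherited directly from \<open>R\<close>.\<close>

definition cay :: "complex^'n^'n \<Rightarrow> complex^'n^'n" where "cay A = 2 *\<^sub>R R A - mat 1"

text \<open>\<open>cay A\<close> is \<open>R A\<close> times \<open>1 + A\<close> in either order,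
  and \<open>R (- A)\<close> inverts \<open>1 + A\<close>. The later simplifications of tangent
  vectors rest on these four products.\<close>

lemma cay_R:
  assumes A: "norm A < r"
  shows "cay A ** R (- A) = R A" "R (- A) ** cay A = R A"
    "cay (- A) ** R A = R (- A)" "R A ** cay (- A) = R (- A)"
proof -
  have key: "cay A ** R (- A) = R A \<and> R (- A) ** cay A = R A" if A: "norm A < r" for A
  proof -
    have "cay A = R A ** (2 *\<^sub>R mat 1 - (mat 1 - A))" "cay A = (2 *\<^sub>R mat 1 - (mat 1 - A)) ** R A"
      by (simp_all only: cay_def matrix_sub_ldistrib[of "R A" "2 *\<^sub>R mat 1"] matrix_sub_rdistrib[of "2 *\<^sub>R mat 1"] R_inv[OF A])
         (simp_all add: matrix_scaleR_left matrix_scaleR_right)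
    then have *: "cay A = R A ** (mat 1 + A)" "cay A = (mat 1 + A) ** R A"
      by (simp_all add: scaleR_2)
    have "cay A ** R (- A) = R A ** ((mat 1 + A) ** R (- A))"
      unfolding *(1) by (simp add: matrix_mul_assoc)
    moreover have "R (- A) ** cay A = (R (- A) ** (mat 1 + A)) ** R A"
      unfolding *(2) by (simp add: matrix_mul_assoc)
    ultimately show ?thesis by (simp add: R_inv[OF A])
  qed
  show "cay A ** R (- A) = R A" "R (- A) ** cay A = R A"
    "cay (- A) ** R A = R (- A)" "R A ** cay (- A) = R (- A)"
    using key[of A] key[of "- A"] A by simp_all
qed

lemma cay_inverse:
  assumes A: "norm A < r"
  shows "cay A ** cay (- A) = mat 1"
proof -
  have "cay A ** cay (- A) = (cay A ** cay (- A)) ** (R A ** (mat 1 - A))" by (simp add: R_inv[OF A])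
  also have "\<dots> = cay A ** (cay (- A) ** R A) ** (mat 1 - A)" by (simp add: matrix_mul_assoc)
  also have "\<dots> = mat 1" by (simp add: cay_R[OF A] R_inv[OF A])
  finally show ?thesis .
qed

lemma star_R:
  assumes A: "norm A < r" and L: "star A = - A"
  shows "star (R A) = R (- A)"
proof -
  have s1: "star (mat 1) = mat 1" by (simp add: star_mat)
  have "star (R A ** (mat 1 - A)) = mat 1" by (simp add: R_inv[OF A] s1)
  then have "(mat 1 - (- A)) ** star (R A) = mat 1" by (simp add: star_mult star_diff L s1)
  then show ?thesis unfolding R_def using matrix_inv_eqI by metis
qed

lemma star_cay:
  assumes "norm A < r" "star A = - A"
  shows "star (cay A) = cay (- A)"
  by (simp add: cay_def star_diff star_scaleR star_R[OF assms] star_mat)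

text \<open>A conjugate of \<open>x\<close>, because \<open>cay (- A)\<close> inverts
  \<open>cay A\<close>; for skew \<open>A\<close> it is also the adjoint, which keeps the point on
  the orbit.\<close>

definition orb :: "complex^'n^'n \<Rightarrow> complex^'n^'n \<Rightarrow> complex^'n^'n" where
  "orb x A = cay A ** x ** cay (- A)"

text \<open>The logarithmic derivative of \<open>cay\<close> at \<open>A\<close> in direction
  \<open>H\<close>: the derivative \<open>2 R A H R A\<close> times the inverse
  \<open>cay (- A)\<close>. The derivative of \<open>orb x\<close> is therefore the bracket with
  \<open>Z A H\<close>.\<close>

definition Z :: "complex^'n^'n \<Rightarrow> complex^'n^'n \<Rightarrow> complex^'n^'n" where
  "Z A H = 2 *\<^sub>R (R A ** H ** R (- A))"

lemma orb_in_orbit: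
  assumes "norm A < r" "star A = - A"
  shows "orb x A \<in> adjoint_orbit G x"
proof -
  have "star (cay A) ** cay A = mat 1"
    using cay_inverse[of "- A"] assms by (simp add: star_cay[OF assms])
  moreover have "orb x A = cay A ** x ** star (cay A)" by (simp add: orb_def star_cay[OF assms])
  ultimately show ?thesis unfolding adjoint_orbit_eq by blast
qed

lemma Z_bracket:
  assumes A: "norm A < r"
  shows "lie_bracket (Z A H) (orb x A) = 2 *\<^sub>R (R A ** H ** R A ** x ** cay (- A)) - 2 *\<^sub>R (cay A ** x ** R (- A) ** H ** R (- A))"
proof -
  have "R A ** H ** R (- A) ** orb x A = R A ** H ** (R (- A) ** cay A) ** x ** cay (- A)"
    "orb x A ** (R A ** H ** R (- A)) = cay A ** x ** (cay (- A) ** R A) ** H ** R (- A)"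
    by (simp_all add: orb_def matrix_mul_assoc)
  then show ?thesis by (simp add: lie_bracket_def Z_def matrix_scaleR_left matrix_scaleR_right cay_R[OF A])
qed

lemma has_vector_derivative_orb:
  assumes A: "norm A < r"
  shows "((\<lambda>t. orb x (A + (t - t0) *\<^sub>R H)) has_vector_derivative lie_bracket (Z A H) (orb x A)) (at t0)"
proof -
  note bb = bounded_bilinear.has_vector_derivative[OF bounded_bilinear_matrix_mult]
  have 1: "((\<lambda>t. cay (A + (t - t0) *\<^sub>R H)) has_vector_derivative 2 *\<^sub>R (R A ** H ** R A)) (at t0)"
    unfolding cay_def
    by (rule derivative_eq_intros has_vector_derivative_R[OF A] refl | simp)+
  have m: "- (A + (t - t0) *\<^sub>R H) = - A + (t - t0) *\<^sub>R (- H)" for t by simp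
  have 2: "((\<lambda>t. cay (- (A + (t - t0) *\<^sub>R H))) has_vector_derivative 2 *\<^sub>R (R (- A) ** (- H) ** R (- A))) (at t0)"
    unfolding cay_def m
    by (rule derivative_eq_intros has_vector_derivative_R refl | simp add: A)+
  have "((\<lambda>t. (cay (A + (t - t0) *\<^sub>R H) ** x) ** cay (- (A + (t - t0) *\<^sub>R H))) has_vector_derivative
      (cay (A + (t0 - t0) *\<^sub>R H) ** x) ** (2 *\<^sub>R (R (- A) ** (- H) ** R (- A)))
      + (cay (A + (t0 - t0) *\<^sub>R H) ** 0 + 2 *\<^sub>R (R A ** H ** R A) ** x) ** cay (- (A + (t0 - t0) *\<^sub>R H))) (at t0)"
    by (intro bb 1 2 has_vector_derivative_const)
  then show ?thesis
    unfolding orb_def[symmetric] Z_bracket[OF A]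
    by (simp add: matrix_ring_simps)
qed

lemma star_Z:
  assumes "norm A < r" "star A = - A" "star H = - H"
  shows "star (Z A H) = - Z A H"
  using assms star_R[of A] star_R[of "- A"]
  by (simp add: Z_def star_scaleR star_mult star_minus matrix_ring_simps)

text \<open>A skew matrix differs from its projection to \<open>L\<close> by a scalar matrix, which
  is central. So \<open>Z A H\<close>, whose trace need not vanish, can stand in for an element of
  \<open>L\<close>.\<close>

lemma bracket_L_proj:
  assumes "star M = - M" shows "lie_bracket (L_proj M) y = lie_bracket M y" "lie_bracket y (L_proj M) = lie_bracket y M"
proof -
  have "L_proj M = M - mat ((trace M - cnj (trace M)) / of_nat CARD('n) / 2)"
    by (simp add: vec_eq_iff L_proj_def assms mat_def) (simp add: scaleR_conv_of_real[where 'a=complex] field_simps)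
  then show "lie_bracket (L_proj M) y = lie_bracket M y" by (simp add: lie_bracket_mat)
  moreover have "lie_bracket a c = - lie_bracket c a" for a c :: "complex^'n^'n"
    by (simp add: lie_bracket_def)
  ultimately show "lie_bracket y (L_proj M) = lie_bracket y M" by metis
qed

text \<open>Replaces the description of the symplectic form by \<open>THE\<close> with an expression
  that is visibly continuous in \<open>A\<close>.\<close>

lemma orbit_symplectic_orb:
  assumes x: "x \<in> L" and A: "norm A < r" "star A = - A" and H: "star H = - H" "star H' = - H'"
  shows "orbit_symplectic L (orb x A) (lie_bracket (Z A H) (orb x A)) (lie_bracket (Z A H') (orb x A))
    = 2 * of_nat CARD('n) * Re (trace (orb x A ** lie_bracket (Z A H) (Z A H')))"
proof -
  have o: "orb x A \<in> L" using adjoint_orbit_in_L[OF x] orb_in_orbit[OF A] by blast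
  note s = star_Z[OF A H(1)] star_Z[OF A H(2)]
  have "lie_bracket (Z A H) (Z A H') \<in> L"
    using lie_bracket_in_L[OF L_proj(2)[of "Z A H"] L_proj(2)[of "Z A H'"]] by (simp add: bracket_L_proj s)
  then show ?thesis
    using orbit_symplectic_eq[OF o L_proj(2)[of "Z A H"] L_proj(2)[of "Z A H'"]]
    by (simp add: bracket_L_proj s killing_form_eq o)
qed

text \<open>Near \<open>0\<close> the map \<open>H \<mapsto> [R (-A) H R C, x]\<close> is a small perturbation of \<open>H \<mapsto> [H, x]\<close>.\<close>

lemma perturbed_bracket_injective:
  fixes S :: "(complex^'n^'n) set"
  assumes S: "subspace S" and inj: "\<And>H. H \<in> S \<Longrightarrow> lie_bracket H x = 0 \<Longrightarrow> H = 0"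
  obtains e where "e > 0" "e \<le> r"
    "\<And>A C H. norm A < e \<Longrightarrow> norm C < e \<Longrightarrow> H \<in> S \<Longrightarrow> lie_bracket (R (- A) ** H ** R C) x = 0 \<Longrightarrow> H = 0"
proof -
  have "bounded_linear (\<lambda>H. lie_bracket H x)"
    using linear_lie_bracket(2) linear_conv_bounded_linear by blast
  then obtain k where k: "k > 0" "\<And>H. H \<in> S \<Longrightarrow> k * norm H \<le> norm (lie_bracket H x)"
    using injective_imp_isometric[of S "\<lambda>H. lie_bracket H x"] inj S closed_subspace by blast
  \<comment> \<open>The relative error of \<open>R (- A) ** H ** R C\<close> against
    \<open>H\<close> is at most \<open>c * e\<close>, one summand for each resolvent. The choice of
    \<open>e\<close> ensures \<open>D * e \<le> k\<close>, so the error cannot cancel the lower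
    bound \<open>k\<close>; \<open>norm x + 1\<close> makes \<open>D\<close> positive and the final
    estimate strict.\<close>
  define c where "c = K * K * (K * b) * b + K * (K * b)"
  define D where "D = 2 * K * (norm x + 1) * c"
  have cD: "c > 0" "D > 0" using pos by (auto simp: c_def D_def add_pos_pos add_nonneg_pos)
  define e where "e = min r (k / D)"
  have "H = 0" if A: "norm A < e" and C: "norm C < e" and H: "H \<in> S"
    and 0: "lie_bracket (R (- A) ** H ** R C) x = 0" for A C H
  proof (rule ccontr)
    assume "H \<noteq> 0"
    have Ar: "norm (- A) < r" and Cr: "norm C < r" using A C by (auto simp: e_def)
    have small: "norm (R M - mat 1) \<le> K * b * e" if "norm M < r" "norm M \<le> e" for M
    proof -
      have "R M - mat 1 = R M ** M"
        using R_inv(2)[OF that(1)] by (simp add: matrix_sub_ldistrib algebra_simps)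
      then have "norm (R M - mat 1) \<le> K * norm (R M) * norm M" using norm_mult_le by simp
      also have "\<dots> \<le> K * b * e"
        using pos norm_R[OF that(1)] that(2) by (intro mult_mono) auto
      finally show ?thesis .
    qed
    have e0: "e > 0" using pos k cD by (simp add: e_def)
    let ?M = "R (- A) ** H ** R C"
    have "?M - H = (R (- A) - mat 1) ** H ** R C + H ** (R C - mat 1)"
      by (simp add: matrix_ring_simps)
    then have "norm (?M - H) \<le> norm ((R (- A) - mat 1) ** H ** R C) + norm (H ** (R C - mat 1))"
      by (metis norm_triangle_ineq)
    also have "\<dots> \<le> K * K * norm (R (- A) - mat 1) * norm H * norm (R C) + K * norm H * norm (R C - mat 1)"
      by (intro add_mono norm_mult3_le norm_mult_le)
    also have "\<dots> \<le> K * K * (K * b * e) * norm H * b + K * norm H * (K * b * e)"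
      using pos e0 norm_R[OF Cr] small[OF Ar] small[OF Cr] A C
      by (intro add_mono mult_mono mult_left_mono mult_nonneg_nonneg) auto
    also have "\<dots> = c * e * norm H" by (simp add: c_def algebra_simps)
    finally have MH: "norm (?M - H) \<le> c * e * norm H" .
    have "lie_bracket H x = - lie_bracket (?M - H) x"
      using 0 linear_diff[OF linear_lie_bracket(2), of ?M H x] by simp
    then have "norm (lie_bracket H x) = norm ((?M - H) ** x - x ** (?M - H))"
      by (simp add: lie_bracket_def norm_minus_commute)
    also have "\<dots> \<le> norm ((?M - H) ** x) + norm (x ** (?M - H))" by (rule norm_triangle_ineq4)
    also have "\<dots> \<le> 2 * K * norm x * norm (?M - H)"
      using norm_mult_le[of "?M - H" x] norm_mult_le[of x "?M - H"] by (simp add: mult_ac)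
    also have "\<dots> \<le> 2 * K * norm x * (c * e * norm H)"
      using MH pos by (intro mult_left_mono) auto
    also have "\<dots> < 2 * K * (norm x + 1) * (c * e * norm H)"
      using \<open>H \<noteq> 0\<close> pos cD e0 by (intro mult_strict_right_mono) auto
    also have "\<dots> = (D * e) * norm H" by (simp add: D_def mult_ac)
    also have "\<dots> \<le> k * norm H"
      using cD by (intro mult_right_mono) (auto simp: e_def min_def field_simps)
    finally show False using k(2)[OF H] by simp
  qed
  moreover have "e > 0" "e \<le> r" using pos k cD by (simp_all add: e_def)
  ultimately show ?thesis using that by blast
qed

end

section \<open>Measurability and positivity on coordinate boxes\<close>

lemma borel_measurable_coord_restrict:
  fixes f :: "(nat \<Rightarrow> real) \<Rightarrow> 'a::topological_space"
  assumes f: "continuous_on U f"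
  shows "f \<in> borel_measurable (restrict_space (\<Pi>\<^sub>M i\<in>{..<d}. lborel) U)"
proof -
  \<comment> \<open>Continuity refers to the product topology on all functions
    \<open>nat \<Rightarrow> real\<close>, whereas the measure space only records the first
    \<open>d\<close> coordinates; the inclusion between the two is measurable.\<close>
  have "(\<lambda>u. u) \<in> (\<Pi>\<^sub>M i\<in>{..<d}. (lborel::real measure)) \<rightarrow>\<^sub>M (\<Pi>\<^sub>M i\<in>UNIV. borel)"
  proof (rule measurable_PiM_single')
    fix i :: nat
    show "(\<lambda>u. u i) \<in> borel_measurable (\<Pi>\<^sub>M i\<in>{..<d}. (lborel::real measure))"
    proof (cases "i < d")
      case True
      then have "(\<lambda>u. u i) \<in> (\<Pi>\<^sub>M i\<in>{..<d}. (lborel::real measure)) \<rightarrow>\<^sub>M lborel"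
        by (intro measurable_component_singleton) simp
      then show ?thesis by simp
    next
      \<comment> \<open>On this space the coordinates from \<open>d\<close> on are constantly
        \<open>undefined\<close>.\<close>
      case False
      then show ?thesis
        by (subst measurable_cong[where g = "\<lambda>_. undefined"]) (auto simp: space_PiM PiE_def extensional_def)
    qed
  qed auto
  then have "(\<lambda>u. u) \<in> (\<Pi>\<^sub>M i\<in>{..<d}. (lborel::real measure)) \<rightarrow>\<^sub>M borel"
    by (simp add: measurable_cong_sets[OF refl sets_PiM_equal_borel])
  then have "(\<lambda>u. u) \<in> restrict_space (\<Pi>\<^sub>M i\<in>{..<d}. (lborel::real measure)) U \<rightarrow>\<^sub>M restrict_space borel U"
    by (intro measurable_restrict_space3) auto
  then show ?thesis
    using measurable_compose borel_measurable_continuous_on_restrict[OF f] by blast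
qed

text \<open>The box has measure \<open>(2 * \<delta>) ^ d\<close>, positive also for
  \<open>d = 0\<close>, and a strictly positive function cannot vanish almost everywhere on
  it.\<close>

lemma nn_integral_box_pos:
  fixes U :: "(nat \<Rightarrow> real) set"
  assumes "\<delta> > 0" and f: "continuous_on U f" and pos: "\<And>u. u \<in> U \<Longrightarrow> f u > (0::real)"
    and U: "U = ({..<d} \<rightarrow>\<^sub>E {-\<delta><..<\<delta>})"
  shows "(\<integral>\<^sup>+u. ennreal (f u) \<partial>restrict_space (\<Pi>\<^sub>M i\<in>{..<d}. lborel) U) > 0"
proof -
  let ?M = "\<Pi>\<^sub>M i\<in>{..<d}. (lborel :: real measure)"
  have Us: "U \<in> sets ?M" unfolding U by (intro sets_PiM_I_finite) auto
  interpret product_sigma_finite "\<lambda>i::nat. lborel :: real measure"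
    by (intro product_sigma_finite.intro) (rule sigma_finite_lborel)
  have "emeasure ?M U = (\<Prod>i<d. emeasure lborel {-\<delta><..<\<delta>})"
    unfolding U by (intro emeasure_PiM) auto
  also have "\<dots> = (\<Prod>i<d. ennreal (2 * \<delta>))" using \<open>\<delta> > 0\<close> by simp
  also have "\<dots> = ennreal ((2 * \<delta>) ^ d)" using \<open>\<delta> > 0\<close> by (simp add: ennreal_power)
  finally have eU: "emeasure ?M U \<noteq> 0" using \<open>\<delta> > 0\<close> by simp
  let ?N = "restrict_space ?M U"
  have spU: "space ?N = U" using sets.sets_into_space[OF Us] by (auto simp: space_restrict_space)
  have meas: "(\<lambda>u. ennreal (f u)) \<in> borel_measurable ?N"
    using borel_measurable_coord_restrict[OF f] by simp
  have "(\<integral>\<^sup>+u. ennreal (f u) \<partial>?N) \<noteq> 0"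
  proof
    assume "(\<integral>\<^sup>+u. ennreal (f u) \<partial>?N) = 0"
    then have "AE u in ?N. ennreal (f u) = 0" by (simp add: nn_integral_0_iff_AE[OF meas])
    moreover have "AE u in ?N. ennreal (f u) \<noteq> 0"
      using pos by (intro AE_I2) (auto simp: spU dest!: pos)
    ultimately have "AE u in ?N. False" by eventually_elim auto
    then have "emeasure ?N (space ?N) = 0"
      by (simp add: eventually_False ae_filter_eq_bot_iff)
    then show False using eU Us spU by (simp add: emeasure_restrict_space)
  qed
  then show ?thesis by (simp add: zero_less_iff_neq_zero)
qed

lemma openin_coord_box:
  "openin (top_of_set (coord_space d)) ({..<d} \<rightarrow>\<^sub>E {-\<delta><..<\<delta>})"
proof -
  have "open (\<Inter>i\<in>{..<d}. (\<lambda>u::nat \<Rightarrow> real. u i) -` {-\<delta><..<\<delta>})"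
    by (intro open_INT ballI open_vimage) (auto intro: continuous_on_product_coordinates)
  moreover have "({..<d} \<rightarrow>\<^sub>E {-\<delta><..<\<delta>}) = coord_space d \<inter> (\<Inter>i\<in>{..<d}. (\<lambda>u::nat \<Rightarrow> real. u i) -` {-\<delta><..<\<delta>})"
    by (auto simp: coord_space_def PiE_iff)
  ultimately show ?thesis unfolding openin_open by blast
qed

section \<open>The Cayley chart and the positivity of its density\<close>

context cayley
begin

lemma continuous_on_Rm: "continuous_on {A. norm A < r} (\<lambda>A. R (- A))"
  by (rule continuous_on_compose2[OF continuous_on_R]) (auto intro: continuous_intros)

lemmas continuous_on_matrix_mult = bounded_bilinear.continuous_on[OF bounded_bilinear_matrix_mult]

lemma continuous_on_orb: "continuous_on {A. norm A < r} (orb x)"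
  unfolding orb_def[abs_def] cay_def
  by (intro continuous_on_matrix_mult continuous_on_R continuous_on_Rm continuous_intros)

lemma continuous_on_Z: "continuous_on {A. norm A < r} (\<lambda>A. Z A H)"
  unfolding Z_def
  by (intro continuous_on_matrix_mult continuous_on_R continuous_on_Rm continuous_intros)

lemma continuous_on_lie_bracket:
  "continuous_on S f \<Longrightarrow> continuous_on S g \<Longrightarrow> continuous_on S (\<lambda>A. lie_bracket (f A) (g A :: complex^'n^'n))"
  unfolding lie_bracket_def
  by (intro continuous_on_matrix_mult continuous_intros)

lemma linear_Re_trace: "linear (\<lambda>A::complex^'n^'n. Re (trace A))"
  by (rule linearI) (simp_all add: trace_add trace_scaleR)

lemma continuous_on_Re_trace:
  "continuous_on S f \<Longrightarrow> continuous_on S (\<lambda>A. Re (trace (f A :: complex^'n^'n)))"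
  using continuous_on_compose2[OF linear_continuous_on[of "\<lambda>A. Re (trace A)" UNIV]]
    linear_Re_trace linear_conv_bounded_linear by blast

text \<open>Transports a tangent vector at \<open>orb x A\<close> back to \<open>x\<close>, where
  \<open>perturbed_bracket_injective\<close> with \<open>C = A\<close> shows that independent
  directions stay independent.\<close>

lemma conj_Z:
  assumes A: "norm A < r"
  shows "cay (- A) ** lie_bracket (Z A H) (orb x A) ** cay A = 2 *\<^sub>R lie_bracket (R (- A) ** H ** R A) x"
proof -
  have c: "cay (- A) ** cay A = mat 1" using cay_inverse[of "- A"] A by simp
  have "cay (- A) ** lie_bracket (Z A H) (orb x A) ** cay A
    = 2 *\<^sub>R ((cay (- A) ** R A) ** H ** R A ** x ** (cay (- A) ** cay A))
      - 2 *\<^sub>R ((cay (- A) ** cay A) ** x ** R (- A) ** H ** (R (- A) ** cay A))"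
    unfolding Z_bracket[OF A] by (simp add: matrix_ring_simps)
  also have "\<dots> = 2 *\<^sub>R lie_bracket (R (- A) ** H ** R A) x"
    by (simp add: c cay_R[OF A] lie_bracket_def matrix_mul_assoc scaleR_diff_right)
  finally show ?thesis .
qed

text \<open>Equal orbit points mean that \<open>k = cay (- A) ** cay C\<close> commutes with
  \<open>x\<close>, and the resolvent identity gives
  \<open>k - 1 = 2 R (- A) (C - A) R C\<close>.\<close>

lemma orb_eq_imp_commute:
  assumes A: "norm A < r" and C: "norm C < r" and eq: "orb x A = orb x C"
  shows "lie_bracket (R (- A) ** (C - A) ** R C) x = 0"
proof -
  have cA: "cay (- A) ** cay A = mat 1" using cay_inverse[of "- A"] A by simp
  have cC: "cay (- C) ** cay C = mat 1" using cay_inverse[of "- C"] C by simp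
  define k where "k = cay (- A) ** cay C"
  have "cay (- A) ** orb x A ** cay C = cay (- A) ** orb x C ** cay C" using eq by simp
  moreover have "cay (- A) ** orb x A ** cay C = (cay (- A) ** cay A) ** x ** k"
    "cay (- A) ** orb x C ** cay C = k ** x ** (cay (- C) ** cay C)"
    by (simp_all add: orb_def k_def matrix_mul_assoc)
  ultimately have kx: "k ** x = x ** k" by (simp add: cA cC)
  have "k - mat 1 = cay (- A) ** (cay C - cay A)" by (simp add: k_def matrix_sub_ldistrib cA)
  also have "\<dots> = 2 *\<^sub>R ((cay (- A)) ** (R C - R A))"
    by (simp add: cay_def[of C] cay_def[of A] matrix_scaleR_right flip: scaleR_diff_right)
  also have "R C - R A = R A ** (C - A) ** R C"
    using R_diff[OF A C] by (simp add: matrix_ring_simps algebra_simps)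
  also have "cay (- A) ** (R A ** (C - A) ** R C) = (cay (- A) ** R A) ** (C - A) ** R C"
    by (simp add: matrix_mul_assoc)
  finally have "R (- A) ** (C - A) ** R C = (1/2) *\<^sub>R (k - mat 1)" by (simp add: cay_R[OF A])
  then show ?thesis using kx by (simp add: lie_bracket_def matrix_ring_simps)
qed

text \<open>The Gram matrix of the symplectic form on the derivatives of the chart, by
  \<open>orbit_symplectic_orb\<close>, as a function of the matrix \<open>A\<close> instead of the
  coordinates.\<close>

definition gram_Z :: "complex^'n^'n \<Rightarrow> (nat \<Rightarrow> complex^'n^'n) \<Rightarrow> complex^'n^'n \<Rightarrow> nat \<Rightarrow> nat \<Rightarrow> real" where
  "gram_Z x v A i j = 2 * of_nat CARD('n) * Re (trace (orb x A ** lie_bracket (Z A (v i)) (Z A (v j))))"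

lemma continuous_on_wedge_gram_Z:
  "continuous_on {A. norm A < r} (\<lambda>A. wedge_power (gram_Z x v A) m id)"
  unfolding wedge_power_def gram_Z_def
  by (intro continuous_intros continuous_on_Re_trace continuous_on_matrix_mult continuous_on_lie_bracket
      continuous_on_orb continuous_on_Z) auto

text \<open>The chart is \<open>u \<mapsto> orb x (\<Sum> u i v i)\<close> on a small box, where the
  \<open>v i\<close> form a maximal symplectic family in \<open>L\<close>. Such a family is
  complementary to the centralizer of \<open>x\<close>, so its length \<open>2 m\<close> is the
  dimension of the orbit; the density is positive at 0 and then nearby by continuity.\<close>

lemma chart_exists:
  assumes x: "x \<in> L" 
  obtains U \<psi> where "orbit_chart L (adjoint_orbit G x) (dim (orbit_tangent L x)) U \<psi>"
    "emeasure (chart_measure L (dim (orbit_tangent L x)) U \<psi>) UNIV > 0"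
proof -
  \<comment> \<open>The factor 8 is \<open>2 * 2 * 2\<close>: one 2 from the Killing form, and one
    for each argument because \<open>Z 0 H = 2 H\<close>. Thus \<open>gram_Z\<close> at 0 is exactly
    \<open>\<Omega>\<close>.\<close>
  define \<Omega> where "\<Omega> = (\<lambda>a c :: complex^'n^'n. 8 * of_nat CARD('n) * Re (trace (x ** lie_bracket a c)))"
  note lb = lie_bracket_add lie_bracket_scaleR
  have alt: "lie_bracket a c = - lie_bracket c a" for a c :: "complex^'n^'n"
    by (simp add: lie_bracket_def)
  have bil: "bilinear \<Omega>"
    unfolding bilinear_def \<Omega>_def
    by (intro conjI allI linearI)
       (simp_all add: lb matrix_add_ldistrib matrix_scaleR_right trace_add trace_scaleR algebra_simps)
  have "\<Omega> a c = - \<Omega> c a" for a c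
    unfolding \<Omega>_def by (subst alt) (simp add: matrix_neg_right trace_neg)
  from exists_symplectic_family[OF bil this subspace_L]
  obtain m v where vL: "\<And>i. i < 2 * m \<Longrightarrow> v i \<in> L"
    and ve: "\<And>i j. i < 2 * m \<Longrightarrow> j < 2 * m \<Longrightarrow> \<Omega> (v i) (v j) = symplectic_unit i j"
    and vsp: "\<And>a. a \<in> L \<Longrightarrow> \<exists>c. \<forall>b\<in>L. \<Omega> (a - (\<Sum>i<2 * m. c i *\<^sub>R v i)) b = 0"
    by blast
  define d where "d = 2 * m"
  have star_L: "star A = - A" if "A \<in> L" for A using that by (simp add: L_iff)
  have lbx: "linear (\<lambda>H. lie_bracket H x)" by (rule linear_lie_bracket)
  \<comment> \<open>The residual of \<open>a\<close> lies in the radical of \<open>\<Omega>\<close>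
    on \<open>L\<close>. By invariance and nondegeneracy of the Killing form it commutes with
    \<open>x\<close>, so it does not affect the bracket with \<open>x\<close>.\<close>
  have spanx: "\<exists>c. lie_bracket a x = (\<Sum>i<d. c i *\<^sub>R lie_bracket (v i) x)" if a: "a \<in> L" for a
  proof -
    obtain c where c: "\<And>b. b \<in> L \<Longrightarrow> \<Omega> (a - (\<Sum>i<2 * m. c i *\<^sub>R v i)) b = 0" using vsp[OF a] by blast
    define w where "w = a - (\<Sum>i<2 * m. c i *\<^sub>R v i)"
    have w: "w \<in> L" unfolding w_def
      using a vL subspace_L by (intro subspace_diff subspace_sum subspace_scale) auto
    have "killing_form L (lie_bracket x w) b = 0" if b: "b \<in> L" for b
      using c[OF b] killing_form_invariant[OF x w b] killing_form_eq[OF x lie_bracket_in_L[OF w b]]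
      by (simp add: \<Omega>_def w_def)
    then have "lie_bracket x w = 0" using killing_form_nondegenerate lie_bracket_in_L[OF x w] by blast
    then have "lie_bracket w x = 0" using alt[of w x] by simp
    then have "lie_bracket a x = lie_bracket (\<Sum>i<2 * m. c i *\<^sub>R v i) x"
      unfolding w_def linear_diff[OF lbx] by simp
    also have "\<dots> = (\<Sum>i<d. c i *\<^sub>R lie_bracket (v i) x)"
      by (simp add: linear_sum[OF lbx] linear_scale[OF lbx] d_def)
    finally show ?thesis by blast
  qed
  \<comment> \<open>Conversely, a combination of the \<open>v i\<close> that commutes with
    \<open>x\<close> pairs to zero with every \<open>v j\<close>, hence has zero
    coefficients.\<close>
  have comm0: "c i = 0" if 0: "lie_bracket (\<Sum>i<d. c i *\<^sub>R v i) x = 0" and i: "i < d" for c i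
  proof (rule symplectic_family_coeffs_0[OF bil ve])
    fix j assume "j < 2 * m"
    let ?H = "\<Sum>i<2 * m. c i *\<^sub>R v i"
    have H: "?H \<in> L" using vL subspace_L by (intro subspace_sum subspace_scale) auto
    have "lie_bracket x ?H = 0" using 0 alt[of x ?H] by (simp add: d_def)
    then have "killing_form L x (lie_bracket ?H (v j)) = killing_form L 0 (v j)"
      using killing_form_invariant[OF x H vL[OF \<open>j < 2 * m\<close>]] by simp
    also have "\<dots> = 0"
      using killing_form_eq[of 0 "v j"] subspace_0[OF subspace_L] vL[OF \<open>j < 2 * m\<close>] by (simp add: trace_def)
    finally show "\<Omega> ?H (v j) = 0"
      using killing_form_eq[OF x lie_bracket_in_L[OF H vL[OF \<open>j < 2 * m\<close>]]] by (simp add: \<Omega>_def)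
  next
    show "i < 2 * m" using i by (simp only: d_def)
  qed
  let ?T = "orbit_tangent L x"
  have T: "?T = span ((\<lambda>i. lie_bracket (v i) x) ` {..<d})"
  proof
    show "?T \<subseteq> span ((\<lambda>i. lie_bracket (v i) x) ` {..<d})"
    proof
      fix w assume "w \<in> ?T"
      then obtain c where "w = (\<Sum>i<d. c i *\<^sub>R lie_bracket (v i) x)"
        using spanx by (auto simp: orbit_tangent_def)
      then show "w \<in> span ((\<lambda>i. lie_bracket (v i) x) ` {..<d})"
        by (simp only:) (intro span_sum span_scale span_base imageI)
    qed
    have "subspace ?T"
    proof -
      have "?T = (\<lambda>H. lie_bracket H x) ` L" by (auto simp: orbit_tangent_def)
      then show ?thesis using linear_subspace_image[OF lbx subspace_L] by simp
    qed
    then show "span ((\<lambda>i. lie_bracket (v i) x) ` {..<d}) \<subseteq> ?T"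
      using vL by (intro span_minimal) (auto simp: orbit_tangent_def d_def)
  qed
  have "(\<Sum>i<d. c i *\<^sub>R lie_bracket (v i) x) = lie_bracket (\<Sum>i<d. c i *\<^sub>R v i) x" for c
    by (simp add: linear_sum[OF lbx] linear_scale[OF lbx])
  then have ind: "inj_on (\<lambda>i. lie_bracket (v i) x) {..<d}" "independent ((\<lambda>i. lie_bracket (v i) x) ` {..<d})"
    using comm0 by (intro real_vector.independent_indexed_family; simp)+
  have dimT: "dim ?T = d" unfolding T dim_span
    using dim_eq_card_independent[OF ind(2)] card_image[OF ind(1)] by simp
  let ?S = "span (v ` {..<d})"
  have S_sum: "\<exists>c. H = (\<Sum>i<d. c i *\<^sub>R v i)" if "H \<in> ?S" for H
    using that
  proof (induction rule: span_induct_alt)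
    case base
    show ?case by (rule exI[of _ "\<lambda>_. 0"]) simp
  next
    case (step t y z)
    then obtain i c where *: "i < d" "y = v i" "z = (\<Sum>i<d. c i *\<^sub>R v i)" by auto
    have "(\<Sum>k<d. (c(i := c i + t)) k *\<^sub>R v k) = (\<Sum>k<d. (if k = i then t *\<^sub>R v i else 0) + c k *\<^sub>R v k)"
      by (intro sum.cong) (auto simp: algebra_simps)
    also have "\<dots> = t *\<^sub>R y + z" using * by (simp add: sum.distrib)
    finally show ?case by metis
  qed
  have injS: "H = 0" if HS: "H \<in> ?S" and H0: "lie_bracket H x = 0" for H
  proof -
    obtain c where "H = (\<Sum>i<d. c i *\<^sub>R v i)" using S_sum[OF HS] by blast
    then show ?thesis using comm0[of c] H0 by simp
  qed
  \<comment> \<open>One radius serves twice: for pairs of points it gives injectivity of the chart,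
    and for \<open>A = C\<close> independence of its partial derivatives.\<close>
  obtain e where e: "e > 0" "e \<le> r"
    and pert: "\<And>A C H. norm A < e \<Longrightarrow> norm C < e \<Longrightarrow> H \<in> ?S \<Longrightarrow> lie_bracket (R (- A) ** H ** R C) x = 0 \<Longrightarrow> H = 0"
    using perturbed_bracket_injective[OF subspace_span injS] by blast
  define w where "w = (\<lambda>A. wedge_power (gram_Z x v A) m id)"
  have "w 0 > 0" unfolding w_def
  proof (rule wedge_power_symplectic_pos)
    fix i j assume ij: "i < 2 * m" "j < 2 * m"
    have "cay 0 = mat 1" by (simp add: cay_def R_0 scaleR_2)
    then have "gram_Z x v 0 i j = \<Omega> (v i) (v j)"
      by (simp add: gram_Z_def orb_def R_0 Z_def lb \<Omega>_def matrix_scaleR_right trace_scaleR)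
    then show "gram_Z x v 0 (id i) (id j) = symplectic_unit i j" using ve[OF ij] by simp
  qed
  moreover have "continuous_on {A. norm A < r} w" unfolding w_def by (rule continuous_on_wedge_gram_Z)
  then have "continuous (at 0 within {A. norm A < r}) w"
    using pos by (auto simp: continuous_on_eq_continuous_within)
  \<comment> \<open>Values within \<open>w 0\<close> of \<open>w 0\<close> are positive.\<close>
  ultimately obtain e1 where e1: "e1 > 0" "\<And>A. norm A < r \<Longrightarrow> norm A < e1 \<Longrightarrow> dist (w A) (w 0) < w 0"
    unfolding continuous_within_eps_delta by (metis dist_0_norm dist_commute mem_Collect_eq)
  define e' where "e' = min e e1"
  have e': "e' > 0" "e' \<le> e" "e' \<le> r" "\<And>A. norm A < e' \<Longrightarrow> w A > 0"
  proof -
    show "w A > 0" if "norm A < e'" for A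
      using e1(2)[of A] that e by (auto simp: e'_def dist_real_def)
  qed (use e e1(1) in \<open>auto simp: e'_def\<close>)
  \<comment> \<open>Keeps \<open>norm (A u) < e'\<close> on the whole box; the \<open>+ 1\<close>
    avoids a zero denominator.\<close>
  define \<delta> where "\<delta> = e' / ((\<Sum>i<d. norm (v i)) + 1)"
  have s0: "(\<Sum>i<d. norm (v i)) \<ge> 0" by (simp add: sum_nonneg)
  have \<delta>: "\<delta> > 0" using e'(1) s0 by (simp add: \<delta>_def)
  define U where "U = ({..<d} \<rightarrow>\<^sub>E {-\<delta><..<\<delta>})"
  define A where "A = (\<lambda>u. \<Sum>i<d. u i *\<^sub>R v i)"
  define \<psi> where "\<psi> = (\<lambda>u. orb x (A u))"
  have A_L: "A u \<in> L" for u unfolding A_def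
    using vL subspace_L by (intro subspace_sum subspace_scale) (auto simp: d_def)
  have A_S: "A u \<in> ?S" for u unfolding A_def by (intro span_sum span_scale span_base) auto
  have A_small: "norm (A u) < e'" if "u \<in> U" for u
  proof -
    have "norm (A u) \<le> (\<Sum>i<d. \<bar>u i\<bar> * norm (v i))"
      unfolding A_def by (rule sum_norm_le) simp
    also have "\<dots> \<le> (\<Sum>i<d. \<delta> * norm (v i))"
      using that by (intro sum_mono mult_right_mono) (auto simp: U_def PiE_iff abs_le_iff less_imp_le minus_le_iff)
    also have "\<dots> = \<delta> * (\<Sum>i<d. norm (v i))" by (simp add: sum_distrib_left)
    also have "\<dots> < \<delta> * ((\<Sum>i<d. norm (v i)) + 1)" using \<delta> by simp
    also have "\<dots> = e'" using s0 by (simp add: \<delta>_def)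
    finally show ?thesis .
  qed
  have A_r: "norm (A u) < r" "norm (A u) < e" if "u \<in> U" for u using A_small[OF that] e' by auto
  have A_upd: "A (u(i := t)) = A u + (t - u i) *\<^sub>R v i" if "i < d" for u i t
  proof -
    have "A (u(i := t)) = (\<Sum>k<d. u k *\<^sub>R v k + (if k = i then (t - u i) *\<^sub>R v i else 0))"
      unfolding A_def by (intro sum.cong) (auto simp: algebra_simps)
    then show ?thesis using that by (simp add: sum.distrib A_def)
  qed
  have der: "((\<lambda>t. \<psi> (u(i := t))) has_vector_derivative lie_bracket (Z (A u) (v i)) (\<psi> u)) (at (u i))"
    if "u \<in> U" "i < d" for u i
    unfolding \<psi>_def A_upd[OF that(2)] by (rule has_vector_derivative_orb[OF A_r(1)[OF that(1)]])
  then have pd: "partial_deriv \<psi> i u = lie_bracket (Z (A u) (v i)) (\<psi> u)" if "u \<in> U" "i < d" for u i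
    unfolding partial_deriv_def using that by (intro vector_derivative_at) blast
  have contA: "continuous_on U A"
    unfolding A_def by (intro continuous_intros continuous_on_product_coordinates continuous_on_subset[OF _ subset_UNIV])
  have AU: "A ` U \<subseteq> {A. norm A < r}" using A_r(1) by auto
  have cont\<psi>: "continuous_on U \<psi>"
    unfolding \<psi>_def by (rule continuous_on_compose2[OF continuous_on_orb contA AU])
  have psi_orbit: "\<psi> u \<in> adjoint_orbit G x" if "u \<in> U" for u
    unfolding \<psi>_def using orb_in_orbit A_r[OF that] star_L A_L by blast
  have inj: "inj_on \<psi> U"
  proof (rule inj_onI)
    fix u u' assume u: "u \<in> U" "u' \<in> U" "\<psi> u = \<psi> u'"
    have "lie_bracket (R (- A u) ** (A u' - A u) ** R (A u')) x = 0"
      using u A_r by (intro orb_eq_imp_commute) (auto simp: \<psi>_def)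
    then have "A u' - A u = 0"
      by (rule pert[OF A_r(2)[OF u(1)] A_r(2)[OF u(2)] span_diff[OF A_S A_S]])
    then have "(\<Sum>i<d. (u' i - u i) *\<^sub>R v i) = 0" by (simp add: A_def scaleR_diff_left sum_subtractf)
    then have "u' i - u i = 0" if "i < d" for i
      using that comm0[of "\<lambda>i. u' i - u i"] linear_0[OF lbx] by simp
    then show "u = u'" using u(1,2) by (intro PiE_ext[of u _ _ u']) (auto simp: U_def)
  qed
  have tangent: "span ((\<lambda>i. partial_deriv \<psi> i u) ` {..<d}) = orbit_tangent L (\<psi> u)" if u: "u \<in> U" for u
  proof -
    let ?D = "\<lambda>i. lie_bracket (Z (A u) (v i)) (\<psi> u)"
    note Au = A_r(1)[OF u] star_L[OF A_L[of u]]
    have "(\<lambda>i. partial_deriv \<psi> i u) ` {..<d} = ?D ` {..<d}" using pd[OF u] by auto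
    moreover have "?D i \<in> orbit_tangent L (\<psi> u)" if "i < d" for i
    proof -
      have "star (Z (A u) (v i)) = - Z (A u) (v i)" using that vL star_L Au by (intro star_Z) (auto simp: d_def)
      then have "?D i = lie_bracket (L_proj (Z (A u) (v i))) (\<psi> u)" by (simp add: bracket_L_proj)
      then show ?thesis using L_proj(2) by (auto simp: orbit_tangent_def)
    qed
    then have sub: "?D ` {..<d} \<subseteq> orbit_tangent L (\<psi> u)" by auto
    have D0: "c i = 0" if 0: "(\<Sum>i<d. c i *\<^sub>R ?D i) = 0" and i: "i < d" for c i
    proof -
      have lin: "linear (\<lambda>M. cay (- A u) ** M ** cay (A u))"
        by (rule linearI) (simp_all add: matrix_ring_simps)
      have lin2: "linear (\<lambda>H. lie_bracket (R (- A u) ** H ** R (A u)) x)"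
        by (rule linearI) (simp_all add: matrix_ring_simps lb)
      have "0 = cay (- A u) ** (\<Sum>i<d. c i *\<^sub>R ?D i) ** cay (A u)" using 0 by simp
      also have "\<dots> = (\<Sum>i<d. c i *\<^sub>R (cay (- A u) ** ?D i ** cay (A u)))"
        by (simp add: linear_sum[OF lin] linear_scale[OF lin])
      also have "\<dots> = 2 *\<^sub>R (\<Sum>i<d. c i *\<^sub>R lie_bracket (R (- A u) ** v i ** R (A u)) x)"
        by (simp add: \<psi>_def conj_Z[OF Au(1)] scaleR_sum_right mult.commute)
      also have "\<dots> = 2 *\<^sub>R lie_bracket (R (- A u) ** (\<Sum>i<d. c i *\<^sub>R v i) ** R (A u)) x"
        by (simp add: linear_sum[OF lin2] linear_scale[OF lin2])
      finally have "lie_bracket (R (- A u) ** (\<Sum>i<d. c i *\<^sub>R v i) ** R (A u)) x = 0" by simp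
      moreover have "(\<Sum>i<d. c i *\<^sub>R v i) \<in> ?S" by (intro span_sum span_scale span_base imageI)
      ultimately have "(\<Sum>i<d. c i *\<^sub>R v i) = 0"
        using pert[OF A_r(2)[OF u] A_r(2)[OF u]] by blast
      then show ?thesis using comm0[of c i] i linear_0[OF lbx] by simp
    qed
    have Dind: "inj_on ?D {..<d}" "independent (?D ` {..<d})"
      by (rule real_vector.independent_indexed_family[of ?D d]; rule D0; assumption)+
    \<comment> \<open>Conjugation by \<open>cay (A u)\<close> maps the tangent space at
      \<open>x\<close> onto a space containing the one at \<open>\<psi> u\<close>. With this bound
      the \<open>d\<close> independent derivatives span the latter.\<close>
    have "dim (orbit_tangent L (\<psi> u)) \<le> d"
    proof -
      have cs: "star (cay (A u)) = cay (- A u)" using star_cay Au by blast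
      have cc: "cay (- A u) ** cay (A u) = mat 1" "cay (A u) ** cay (- A u) = mat 1"
        using cay_inverse[of "- A u"] cay_inverse[of "A u"] Au(1) by auto
      have "orbit_tangent L (\<psi> u) \<subseteq> (\<lambda>M. cay (A u) ** M ** cay (- A u)) ` ?T"
      proof
        fix y assume "y \<in> orbit_tangent L (\<psi> u)"
        then obtain C where C: "C \<in> L" "y = lie_bracket C (\<psi> u)" by (auto simp: orbit_tangent_def)
        define C' where "C' = cay (- A u) ** C ** cay (A u)"
        have "star (cay (- A u)) = cay (A u)" using cs star_star by metis
        then have "C' \<in> L" using conj_in_L[OF C(1), of "cay (- A u)"] cc by (simp add: C'_def)
        moreover have "y = cay (A u) ** lie_bracket C' x ** cay (- A u)"
        proof -
          have "cay (A u) ** lie_bracket C' x ** cay (- A u)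
            = (cay (A u) ** cay (- A u)) ** C ** cay (A u) ** x ** cay (- A u)
              - cay (A u) ** x ** cay (- A u) ** C ** (cay (A u) ** cay (- A u))"
            by (simp add: C'_def lie_bracket_def matrix_ring_simps)
          then show ?thesis by (simp add: C(2) \<psi>_def orb_def lie_bracket_def cc matrix_mul_assoc)
        qed
        ultimately show "y \<in> (\<lambda>M. cay (A u) ** M ** cay (- A u)) ` ?T" by (auto simp: orbit_tangent_def)
      qed
      then have "dim (orbit_tangent L (\<psi> u)) \<le> dim ((\<lambda>M. cay (A u) ** M ** cay (- A u)) ` ?T)"
        by (rule dim_subset)
      also have "\<dots> \<le> dim ?T"
        by (rule dim_image_le) (auto intro!: linearI simp: matrix_ring_simps)
      finally show ?thesis by (simp add: dimT)
    qed
    then have "orbit_tangent L (\<psi> u) \<subseteq> span (?D ` {..<d})"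
      using Dind by (intro card_ge_dim_independent sub) (auto simp: card_image)
    moreover have "subspace (orbit_tangent L (\<psi> u))"
    proof -
      have "orbit_tangent L (\<psi> u) = (\<lambda>H. lie_bracket H (\<psi> u)) ` L" by (auto simp: orbit_tangent_def)
      then show ?thesis using linear_subspace_image[OF linear_lie_bracket(2) subspace_L] by simp
    qed
    then have "span (?D ` {..<d}) \<subseteq> orbit_tangent L (\<psi> u)" using sub by (intro span_minimal)
    ultimately show ?thesis using \<open>(\<lambda>i. partial_deriv \<psi> i u) ` {..<d} = ?D ` {..<d}\<close> by auto
  qed
  have contD: "continuous_on U (partial_deriv \<psi> i)" if "i < d" for i
  proof -
    have "continuous_on U (\<lambda>u. lie_bracket (Z (A u) (v i)) (\<psi> u))"
      by (intro continuous_on_lie_bracket cont\<psi> continuous_on_compose2[OF continuous_on_Z contA AU])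
    then show ?thesis using pd that by (simp cong: continuous_on_cong)
  qed
  have chart: "orbit_chart L (adjoint_orbit G x) d U \<psi>"
    unfolding orbit_chart_def
  proof (intro conjI allI impI ballI)
    show "openin (top_of_set (coord_space d)) U" unfolding U_def by (rule openin_coord_box)
    show "(\<lambda>t. \<psi> (u(i := t))) differentiable at (u i)" if "i < d" "u \<in> U" for i u
      using der[OF that(2,1)] by (rule differentiableI_vector)
  qed (use inj psi_orbit cont\<psi> contD tangent in auto)
  have dens: "wedge_power (orbit_symplectic L (\<psi> u)) (d div 2) (\<lambda>i. partial_deriv \<psi> i u) = w (A u)"
    if u: "u \<in> U" for u
  proof -
    have "orbit_symplectic L (\<psi> u) (partial_deriv \<psi> i u) (partial_deriv \<psi> j u) = gram_Z x v (A u) i j"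
      if "i < d" "j < d" for i j
      unfolding pd[OF u that(1)] pd[OF u that(2)] gram_Z_def unfolding \<psi>_def
      using that u vL A_L by (intro orbit_symplectic_orb x A_r star_L) (simp_all add: d_def)
    moreover have "\<sigma> (2 * i) < d" "\<sigma> (Suc (2 * i)) < d" if "\<sigma> permutes {..<2 * m}" "i < m" for \<sigma> i
      using permutes_in_image[OF that(1)] that(2) by (auto simp: d_def)
    ultimately show ?thesis
      unfolding w_def wedge_power_def by (simp add: d_def)
  qed
  have contw: "continuous_on U (\<lambda>u. w (A u))"
    by (rule continuous_on_compose2[OF \<open>continuous_on {A. norm A < r} w\<close> contA AU])
  have wpos: "w (A u) > 0" if "u \<in> U" for u using e'(4) A_small[OF that] by blast
  let ?N = "restrict_space (\<Pi>\<^sub>M i\<in>{..<d}. (lborel::real measure)) U"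
  let ?f = "\<lambda>u. ennreal \<bar>wedge_power (orbit_symplectic L (\<psi> u)) (d div 2) (\<lambda>i. partial_deriv \<psi> i u)\<bar>"
  have spN: "u \<in> U" if "u \<in> space ?N" for u using that by (simp add: space_restrict_space)
  have f_eq: "?f u = ennreal (w (A u))" if "u \<in> space ?N" for u
    using dens[OF spN[OF that]] wpos[OF spN[OF that]] by simp
  have "(\<lambda>u. ennreal (w (A u))) \<in> borel_measurable ?N"
    using borel_measurable_coord_restrict[OF contw] by simp
  then have fm: "?f \<in> borel_measurable ?N" using f_eq by (simp cong: measurable_cong)
  have "0 < (\<integral>\<^sup>+u. ennreal (w (A u)) \<partial>?N)"
    by (rule nn_integral_box_pos[OF \<delta> contw wpos U_def])
  also have "\<dots> = (\<integral>\<^sup>+u. ?f u \<partial>?N)" using f_eq by (intro nn_integral_cong) simp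
  also have "\<dots> = emeasure (density ?N ?f) (space ?N)"
    by (subst emeasure_density[OF fm sets.top]) (auto intro!: nn_integral_cong)
  also have "\<dots> = emeasure (chart_measure L d U \<psi>) UNIV"
    unfolding chart_measure_def
    using borel_measurable_coord_restrict[OF cont\<psi>, of d] by (subst emeasure_distr) auto
  finally show ?thesis using that[of U \<psi>] chart dimT by simp
qed

end

lemma (in su_form) exists_positive_chart:
  assumes "x \<in> L" 
  obtains U \<psi> where "orbit_chart L (adjoint_orbit G x) (dim (orbit_tangent L x)) U \<psi>"
    "emeasure (chart_measure L (dim (orbit_tangent L x)) U \<psi>) UNIV > 0"
proof -
  show thesis
  proof (rule resolvent_bounds)
    fix K r b :: real
    assume *: "K > 0" "r > 0" "b > 0"
      "\<And>(P :: complex^'n^'n) (Q :: complex^'n^'n). norm (P ** Q) \<le> K * norm P * norm Q"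
      "\<And>A :: complex^'n^'n. norm A < r \<Longrightarrow> invertible (mat 1 - A) \<and> norm (matrix_inv (mat 1 - A)) \<le> b"
    interpret cayley B K r b
      by unfold_locales (fact *)+
    show thesis using chart_exists[OF assms] that by blast
  qed
qed

section \<open>Scaling the Liouville measure\<close>

text \<open>Densities of charts are not known to be measurable, so the scaling rules are needed without
  measurability assumptions.\<close>

lemma nn_integral_cmult_any:
  fixes r :: real
  assumes "0 < r"
  shows "(\<integral>\<^sup>+x. ennreal r * f x \<partial>M) = ennreal r * (\<integral>\<^sup>+x. f x \<partial>M)"
proof (rule antisym)
  let ?c = "ennreal r" and ?i = "ennreal (1 / r)"
  \<comment> \<open>This inequality comes from simple functions below \<open>f\<close>. Used for
    \<open>r\<close> and, after rescaling, for \<open>1 / r\<close>, it gives both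
    directions.\<close>
  have le: "c * (\<integral>\<^sup>+x. f x \<partial>M) \<le> (\<integral>\<^sup>+x. c * f x \<partial>M)" for c :: ennreal and f
    unfolding nn_integral_def[of M f] SUP_mult_left_ennreal
  proof (rule SUP_least)
    fix g assume "g \<in> {g. simple_function M g \<and> g \<le> f}"
    then have g: "simple_function M g" "g \<le> f" by auto
    have "c * integral\<^sup>S M g = integral\<^sup>S M (\<lambda>x. c * g x)" using g(1) by simp
    also have "\<dots> \<le> (\<integral>\<^sup>+x. c * f x \<partial>M)"
      unfolding nn_integral_def using g
      by (intro SUP_upper) (auto simp: le_fun_def intro: mult_left_mono simple_function_mult)
    finally show "c * integral\<^sup>S M g \<le> (\<integral>\<^sup>+x. c * f x \<partial>M)" .
  qed
  show "?c * (\<integral>\<^sup>+x. f x \<partial>M) \<le> (\<integral>\<^sup>+x. ?c * f x \<partial>M)" by (rule le)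
  have inv: "?i * ?c = 1" "?c * ?i = 1" using assms by (simp_all flip: ennreal_mult)
  have "?i * (\<integral>\<^sup>+x. ?c * f x \<partial>M) \<le> (\<integral>\<^sup>+x. ?i * (?c * f x) \<partial>M)" by (rule le)
  then have "?i * (\<integral>\<^sup>+x. ?c * f x \<partial>M) \<le> (\<integral>\<^sup>+x. f x \<partial>M)"
    by (simp only: inv mult_1_left flip: mult.assoc)
  then have "?c * (?i * (\<integral>\<^sup>+x. ?c * f x \<partial>M)) \<le> ?c * (\<integral>\<^sup>+x. f x \<partial>M)" by (rule mult_left_mono) simp
  then show "(\<integral>\<^sup>+x. ?c * f x \<partial>M) \<le> ?c * (\<integral>\<^sup>+x. f x \<partial>M)"
    by (simp only: inv mult_1_left flip: mult.assoc)
qed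

lemma density_cong_space:
  assumes "\<And>x. x \<in> space M \<Longrightarrow> f x = g x"
  shows "density M f = density M g"
proof -
  have "(\<integral>\<^sup>+x. f x * indicator A x \<partial>M) = (\<integral>\<^sup>+x. g x * indicator A x \<partial>M)" for A
    using assms by (intro nn_integral_cong) simp
  then show ?thesis by (simp add: density_def)
qed

text \<open>When the set function given by integration is not a measure, \<open>density\<close>
  falls back to the zero measure. Scaling by a positive constant is invertible, so both sides fall
  into the same case.\<close>

lemma density_cmult_any:
  fixes r :: real
  assumes r: "0 < r"
  shows "density M (\<lambda>x. ennreal r * f x) = scale_measure (ennreal r) (density M f)"
proof -
  define \<mu> where "\<mu> = (\<lambda>f A. \<integral>\<^sup>+x. f x * indicator A x \<partial>M)"
  have mu: "\<mu> (\<lambda>x. ennreal c * f x) = (\<lambda>A. ennreal c * \<mu> f A)" if "0 < c" for c f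
    by (simp add: \<mu>_def fun_eq_iff mult.assoc nn_integral_cmult_any[OF that])
  have ms: "measure_space (space M) (sets M) (\<mu> (\<lambda>x. ennreal c * f x))"
    if "measure_space (space M) (sets M) (\<mu> f)" "0 < c" for c f
    using that unfolding mu[OF that(2)]
    by (auto simp: measure_space_def positive_def countably_additive_def)
  have "ennreal (1 / r) * ennreal r = 1" using r by (simp flip: ennreal_mult)
  then have "(\<lambda>x. ennreal (1 / r) * (ennreal r * f x)) = f" by (simp flip: mult.assoc)
  then have iff: "measure_space (space M) (sets M) (\<mu> (\<lambda>x. ennreal r * f x)) \<longleftrightarrow> measure_space (space M) (sets M) (\<mu> f)"
    using ms[OF _ r, of f] ms[of "\<lambda>x. ennreal r * f x" "1 / r"] r by auto
  have e: "emeasure (density M f) = (\<lambda>B. if B \<in> sets M \<and> measure_space (space M) (sets M) (\<mu> f) then \<mu> f B else 0)" for f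
    unfolding density_def \<mu>_def by (simp add: emeasure_measure_of_conv sets.sigma_sets_eq)
  show ?thesis
    by (rule measure_eqI) (simp_all add: e iff, simp add: mu[OF r])
qed

lemma distr_scale_measure:
  assumes "f \<in> M \<rightarrow>\<^sub>M N"
  shows "distr (scale_measure c M) N f = scale_measure c (distr M N f)"
proof (rule measure_eqI)
  fix A assume "A \<in> sets (distr (scale_measure c M) N f)"
  moreover have "f \<in> scale_measure c M \<rightarrow>\<^sub>M N" using assms by simp
  ultimately show "emeasure (distr (scale_measure c M) N f) A = emeasure (scale_measure c (distr M N f)) A"
    using assms by (simp add: emeasure_distr space_scale_measure)
qed simp

lemma partial_deriv_scaleR:
  assumes "(\<lambda>t. \<psi> (u(i := t))) differentiable at (u i)"
  shows "partial_deriv (\<lambda>u. c *\<^sub>R \<psi> u) i u = c *\<^sub>R partial_deriv \<psi> i u"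
  unfolding partial_deriv_def
  using assms
  by (intro vector_derivative_at bounded_linear.has_vector_derivative[OF bounded_linear_scaleR_right])
     (simp add: vector_derivative_works[symmetric])

lemma wedge_power_scaleR:
  assumes "\<And>i j. i < 2 * m \<Longrightarrow> j < 2 * m \<Longrightarrow> \<omega>' (v' i) (v' j) = c * \<omega> (v i) (v j)"
  shows "wedge_power \<omega>' m v' = c ^ m * wedge_power \<omega> m v"
proof -
  have "(\<Prod>i<m. \<omega>' (v' (\<sigma> (2 * i))) (v' (\<sigma> (2 * i + 1)))) = c ^ m * (\<Prod>i<m. \<omega> (v (\<sigma> (2 * i))) (v (\<sigma> (2 * i + 1))))"
    if "\<sigma> permutes {..<2 * m}" for \<sigma>
  proof -
    have "\<sigma> (2 * i) < 2 * m \<and> \<sigma> (2 * i + 1) < 2 * m" if "i < m" for i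
      using permutes_in_image[OF \<open>\<sigma> permutes {..<2 * m}\<close>] that by auto
    then have "(\<Prod>i<m. \<omega>' (v' (\<sigma> (2 * i))) (v' (\<sigma> (2 * i + 1)))) = (\<Prod>i<m. c * \<omega> (v (\<sigma> (2 * i))) (v (\<sigma> (2 * i + 1))))"
      using assms by (intro prod.cong) auto
    then show ?thesis by (simp add: prod.distrib)
  qed
  then show ?thesis
    unfolding wedge_power_def by (simp add: sum_distrib_left mult.left_commute)
qed

text \<open>Push-forward under \<open>y \<mapsto> c y\<close>, times the factor by which the
  \<open>m\<close>-th power of a symplectic form changes when that form is multiplied by
  \<open>c\<close>.\<close>

definition dilate_measure :: "nat \<Rightarrow> real \<Rightarrow> 'a::real_normed_vector measure \<Rightarrow> 'a measure" where
  "dilate_measure m c \<nu> = scale_measure (ennreal (\<bar>c\<bar> ^ m)) (distr \<nu> borel ((*\<^sub>R) c))"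

lemma sets_dilate_measure [simp]: "sets (dilate_measure m c \<nu>) = sets borel"
  by (simp add: dilate_measure_def)

lemma measurable_scaleR: "((*\<^sub>R) c :: 'a::real_normed_vector \<Rightarrow> 'a) \<in> borel_measurable borel"
  by (intro borel_measurable_continuous_onI continuous_intros)

lemma emeasure_dilate_measure:
  fixes \<nu> :: "'a::real_normed_vector measure"
  assumes "sets \<nu> = sets borel" "A \<in> sets borel"
  shows "emeasure (dilate_measure m c \<nu>) A = ennreal (\<bar>c\<bar> ^ m) * emeasure \<nu> ((*\<^sub>R) c -` A)"
proof -
  have "space \<nu> = UNIV" using sets_eq_imp_space_eq[OF assms(1)] by simp
  moreover have "((*\<^sub>R) c) \<in> \<nu> \<rightarrow>\<^sub>M (borel :: 'a measure)"
    using measurable_scaleR measurable_cong_sets[OF assms(1) refl] by blast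
  ultimately show ?thesis using assms by (simp add: dilate_measure_def emeasure_distr)
qed

lemma dilate_measure_mono:
  fixes \<mu> :: "'a::real_normed_vector measure"
  assumes "sets \<nu> = sets borel" "sets \<mu> = sets borel" "\<nu> \<le> \<mu>"
  shows "dilate_measure m c \<nu> \<le> dilate_measure m c \<mu>"
proof (rule less_eq_measure.intros(3))
  show "space (dilate_measure m c \<nu>) = space (dilate_measure m c \<mu>)"
    by (intro sets_eq_imp_space_eq) simp
  show "emeasure (dilate_measure m c \<nu>) \<le> emeasure (dilate_measure m c \<mu>)"
  proof (rule le_funI)
    fix A
    have "emeasure \<nu> C \<le> emeasure \<mu> C" for C
      using le_measureD3[OF assms(3)] assms(1,2) by simp
    then show "emeasure (dilate_measure m c \<nu>) A \<le> emeasure (dilate_measure m c \<mu>) A"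
      using assms(1,2)
      by (cases "A \<in> sets borel") (auto simp: emeasure_dilate_measure emeasure_notin_sets intro: mult_left_mono)
  qed
qed simp

section \<open>Homogeneity of charts and of the Liouville measure\<close>

context su_form
begin

lemma orbit_tangent_scaleR: "c \<noteq> 0 \<Longrightarrow> orbit_tangent L (c *\<^sub>R y) = orbit_tangent L y"
proof -
  have sub: "orbit_tangent L (c *\<^sub>R y) \<subseteq> orbit_tangent L y" for c y
  proof
    fix w assume "w \<in> orbit_tangent L (c *\<^sub>R y)"
    then obtain A where "A \<in> L" "w = lie_bracket (c *\<^sub>R A) y"
      by (auto simp: orbit_tangent_def lie_bracket_scaleR)
    then show "w \<in> orbit_tangent L y" using subspace_scale[OF subspace_L] by (auto simp: orbit_tangent_def)
  qed
  assume "c \<noteq> 0"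
  then show ?thesis using sub[of c y] sub[of "inverse c" "c *\<^sub>R y"] by simp
qed

text \<open>The vectors \<open>c v\<close> and \<open>c w\<close> at \<open>c y\<close> have the
  same generators in \<open>L\<close> as \<open>v\<close> and \<open>w\<close> at \<open>y\<close>.
  Only the first argument of the Killing form is scaled, hence the factor \<open>c\<close> rather
  than its square.\<close>

lemma orbit_symplectic_scaleR:
  assumes y: "y \<in> L" and v: "v \<in> orbit_tangent L y" and w: "w \<in> orbit_tangent L y"
  shows "orbit_symplectic L (c *\<^sub>R y) (c *\<^sub>R v) (c *\<^sub>R w) = c * orbit_symplectic L y v w"
proof -
  obtain A C where AC: "A \<in> L" "C \<in> L" "v = lie_bracket A y" "w = lie_bracket C y"
    using v w by (auto simp: orbit_tangent_def)
  have cy: "c *\<^sub>R y \<in> L" using y subspace_scale[OF subspace_L] by blast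
  have "orbit_symplectic L (c *\<^sub>R y) (c *\<^sub>R v) (c *\<^sub>R w) = killing_form L (c *\<^sub>R y) (lie_bracket A C)"
    using orbit_symplectic_eq[OF cy AC(1,2)] AC(3,4) by (simp add: lie_bracket_scaleR)
  also have "\<dots> = c * killing_form L y (lie_bracket A C)"
    using y cy AC by (simp add: killing_form_eq lie_bracket_in_L matrix_scaleR_left trace_scaleR)
  finally show ?thesis using orbit_symplectic_eq[OF y AC(1,2)] AC(3,4) by simp
qed

lemma orbit_chart_scaleR:
  assumes c: "c \<noteq> 0" and N: "(*\<^sub>R) c ` N \<subseteq> N'" and ch: "orbit_chart L N d U \<psi>"
  shows "orbit_chart L N' d U (\<lambda>u. c *\<^sub>R \<psi> u)"
proof -
  have pd: "partial_deriv (\<lambda>u. c *\<^sub>R \<psi> u) i u = c *\<^sub>R partial_deriv \<psi> i u" if "i < d" "u \<in> U" for i u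
    using ch that by (intro partial_deriv_scaleR) (auto simp: orbit_chart_def)
  have "span ((\<lambda>i. partial_deriv (\<lambda>u. c *\<^sub>R \<psi> u) i u) ` {..<d}) = orbit_tangent L (c *\<^sub>R \<psi> u)" if u: "u \<in> U" for u
  proof -
    have "(\<lambda>i. partial_deriv (\<lambda>u. c *\<^sub>R \<psi> u) i u) ` {..<d} = (*\<^sub>R) c ` (\<lambda>i. partial_deriv \<psi> i u) ` {..<d}"
      using pd[OF _ u] by (auto simp: image_image)
    then have "span ((\<lambda>i. partial_deriv (\<lambda>u. c *\<^sub>R \<psi> u) i u) ` {..<d}) = span ((\<lambda>i. partial_deriv \<psi> i u) ` {..<d})"
      using c by (simp add: span_image_scale)
    then show ?thesis using ch u c by (simp add: orbit_chart_def orbit_tangent_scaleR)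
  qed
  moreover have "continuous_on U (partial_deriv (\<lambda>u. c *\<^sub>R \<psi> u) i)" if "i < d" for i
  proof -
    have "continuous_on U (\<lambda>u. c *\<^sub>R partial_deriv \<psi> i u)"
      using ch that by (intro continuous_intros) (auto simp: orbit_chart_def)
    then show ?thesis using pd that by (simp cong: continuous_on_cong)
  qed
  moreover have "(\<lambda>t. c *\<^sub>R \<psi> (u(i := t))) differentiable at (u i)" if "i < d" "u \<in> U" for i u
    using ch that by (intro differentiable_scaleR differentiable_const) (auto simp: orbit_chart_def)
  moreover have "inj_on (\<lambda>u. c *\<^sub>R \<psi> u) U" using ch c by (auto simp: orbit_chart_def inj_on_def)
  moreover have "continuous_on U (\<lambda>u. c *\<^sub>R \<psi> u)" using ch by (intro continuous_intros) (auto simp: orbit_chart_def)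
  moreover have "(\<lambda>u. c *\<^sub>R \<psi> u) ` U \<subseteq> N'" using ch N by (auto simp: orbit_chart_def)
  ultimately show ?thesis using ch by (simp add: orbit_chart_def)
qed

lemma chart_measure_scaleR:
  assumes c: "c \<noteq> 0" and N: "N \<subseteq> L" and ch: "orbit_chart L N d U \<psi>"
  shows "chart_measure L d U (\<lambda>u. c *\<^sub>R \<psi> u) = dilate_measure (d div 2) c (chart_measure L d U \<psi>)"
proof -
  define M where "M = restrict_space (\<Pi>\<^sub>M i\<in>{..<d}. (lborel::real measure)) U"
  define f where "f = (\<lambda>\<psi> u. ennreal \<bar>wedge_power (orbit_symplectic L (\<psi> u)) (d div 2) (\<lambda>i. partial_deriv \<psi> i u)\<bar>)"
  let ?c = "ennreal (\<bar>c\<bar> ^ (d div 2))"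
  have spM: "u \<in> U" if "u \<in> space M" for u using that by (simp add: M_def space_restrict_space)
  have f: "f (\<lambda>u. c *\<^sub>R \<psi> u) u = ?c * f \<psi> u" if "u \<in> space M" for u
  proof -
    have u: "u \<in> U" using spM that .
    have y: "\<psi> u \<in> L" using ch N u by (auto simp: orbit_chart_def)
    have "partial_deriv \<psi> i u \<in> orbit_tangent L (\<psi> u)" if "i < d" for i
    proof -
      have "partial_deriv \<psi> i u \<in> span ((\<lambda>i. partial_deriv \<psi> i u) ` {..<d})"
        using that by (intro span_base) auto
      then show ?thesis using ch u by (simp add: orbit_chart_def)
    qed
    moreover have "partial_deriv (\<lambda>u. c *\<^sub>R \<psi> u) i u = c *\<^sub>R partial_deriv \<psi> i u" if "i < d" for i
      using ch that u by (intro partial_deriv_scaleR) (auto simp: orbit_chart_def)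
    ultimately have "wedge_power (orbit_symplectic L (c *\<^sub>R \<psi> u)) (d div 2) (\<lambda>i. partial_deriv (\<lambda>u. c *\<^sub>R \<psi> u) i u)
       = c ^ (d div 2) * wedge_power (orbit_symplectic L (\<psi> u)) (d div 2) (\<lambda>i. partial_deriv \<psi> i u)"
      using y by (intro wedge_power_scaleR) (simp add: orbit_symplectic_scaleR)
    then show ?thesis by (simp add: f_def abs_mult power_abs ennreal_mult)
  qed
  have meas: "\<psi> \<in> borel_measurable M"
    unfolding M_def using ch by (intro borel_measurable_coord_restrict) (simp add: orbit_chart_def)
  then have meas': "\<psi> \<in> borel_measurable (density M (f \<psi>))" by simp
  have "density M (f (\<lambda>u. c *\<^sub>R \<psi> u)) = scale_measure ?c (density M (f \<psi>))"
    using c f by (subst density_cmult_any[symmetric]) (auto intro: density_cong_space)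
  then have "chart_measure L d U (\<lambda>u. c *\<^sub>R \<psi> u) = distr (scale_measure ?c (density M (f \<psi>))) borel ((*\<^sub>R) c \<circ> \<psi>)"
    by (simp add: chart_measure_def M_def f_def o_def)
  also have "\<dots> = scale_measure ?c (distr (density M (f \<psi>)) borel ((*\<^sub>R) c \<circ> \<psi>))"
    using meas' measurable_scaleR by (intro distr_scale_measure measurable_comp)
  also have "distr (density M (f \<psi>)) borel ((*\<^sub>R) c \<circ> \<psi>) = distr (distr (density M (f \<psi>)) borel \<psi>) borel ((*\<^sub>R) c)"
    using distr_distr[OF measurable_scaleR meas'] by simp
  finally show ?thesis by (simp add: dilate_measure_def chart_measure_def M_def f_def)
qed

text \<open>Every chart is \<open>c\<close> times another chart of the same orbit, so each chart
  measure is the dilate of a chart measure and lies below the dilate of the supremum. The inequality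
  serves both \<open>0 < c < 1\<close> and \<open>c = - 1\<close>.\<close>

lemma liouville_le_dilate:
  assumes x: "x \<in> L" and c: "c \<noteq> 0" and inv: "(*\<^sub>R) (inverse c) ` adjoint_orbit G x \<subseteq> adjoint_orbit G x"
  shows "sets (liouville_measure G L x) = sets borel"
    and "liouville_measure G L x \<le> dilate_measure (dim (orbit_tangent L x) div 2) c (liouville_measure G L x)"
proof -
  define d where "d = dim (orbit_tangent L x)"
  define S where "S = {chart_measure L d U \<psi> | U \<psi>. orbit_chart L (adjoint_orbit G x) d U \<psi>}"
  have mu: "liouville_measure G L x = Sup S" by (simp add: liouville_measure_def d_def S_def Let_def)
  obtain U0 \<psi>0 where "orbit_chart L (adjoint_orbit G x) d U0 \<psi>0" "emeasure (chart_measure L d U0 \<psi>0) UNIV > 0"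
    unfolding d_def by (rule exists_positive_chart[OF x])
  \<comment> \<open>The supremum of an empty family would not carry the Borel sigma-algebra.\<close>
  then have "S \<noteq> {}" unfolding S_def by blast
  have setsS: "sets \<nu> = sets borel" if "\<nu> \<in> S" for \<nu> using that by (auto simp: S_def chart_measure_def)
  have "sets (SUP \<nu>\<in>S. \<nu>) = sets (borel :: (complex^'n^'n) measure)"
    using setsS \<open>S \<noteq> {}\<close> by (intro sets_SUP)
  then show sets: "sets (liouville_measure G L x) = sets borel" by (simp add: mu)
  have "Sup S \<le> dilate_measure (d div 2) c (Sup S)"
  proof (rule Sup_least)
    fix \<nu> assume "\<nu> \<in> S"
    then obtain U \<psi> where \<nu>: "\<nu> = chart_measure L d U \<psi>" "orbit_chart L (adjoint_orbit G x) d U \<psi>"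
      by (auto simp: S_def)
    define \<psi>' where "\<psi>' = (\<lambda>u. inverse c *\<^sub>R \<psi> u)"
    have ch: "orbit_chart L (adjoint_orbit G x) d U \<psi>'"
      unfolding \<psi>'_def using c inv \<nu>(2) by (intro orbit_chart_scaleR) auto
    have "adjoint_orbit G x \<subseteq> L" using adjoint_orbit_in_L[OF x] by blast
    from chart_measure_scaleR[OF c this ch]
    have "\<nu> = dilate_measure (d div 2) c (chart_measure L d U \<psi>')"
      using c by (simp add: \<nu>(1) \<psi>'_def)
    also have "\<dots> \<le> dilate_measure (d div 2) c (Sup S)"
    proof (rule dilate_measure_mono)
      have "chart_measure L d U \<psi>' \<in> S" using ch by (auto simp: S_def)
      then show "chart_measure L d U \<psi>' \<le> Sup S" "sets (chart_measure L d U \<psi>') = sets borel"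
        using Sup_upper setsS by blast+
      show "sets (Sup S) = sets borel" using sets by (simp add: mu)
    qed
    finally show "\<nu> \<le> dilate_measure (d div 2) c (Sup S)" .
  qed
  then show "liouville_measure G L x \<le> dilate_measure (dim (orbit_tangent L x) div 2) c (liouville_measure G L x)"
    by (simp add: mu d_def)
qed

lemma liouville_pos:
  assumes x: "x \<in> L" 
  shows "emeasure (liouville_measure G L x) UNIV > 0"
proof -
  obtain U \<psi> where ch: "orbit_chart L (adjoint_orbit G x) (dim (orbit_tangent L x)) U \<psi>"
    "emeasure (chart_measure L (dim (orbit_tangent L x)) U \<psi>) UNIV > 0"
    using exists_positive_chart[OF x] by blast
  have le: "chart_measure L (dim (orbit_tangent L x)) U \<psi> \<le> liouville_measure G L x"
    unfolding liouville_measure_def Let_def using ch(1) by (intro Sup_upper) blast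
  have "sets (liouville_measure G L x) = sets borel"
    using liouville_le_dilate(1)[OF x, of 1] by simp
  then have "emeasure (chart_measure L (dim (orbit_tangent L x)) U \<psi>) UNIV \<le> emeasure (liouville_measure G L x) UNIV"
    by (intro le_measureD3[OF le]) (simp add: chart_measure_def)
  then show ?thesis using ch(2) by (rule less_le_trans[rotated])
qed

text \<open>A finite positive mass \<open>t\<close> would satisfy \<open>t \<le> c ^ m * t\<close>.
  The bound on the dimension gives \<open>m \<ge> 1\<close> and thereby
  \<open>c ^ m < 1\<close>.\<close>

lemma liouville_infinite:
  assumes x: "x \<in> L" and d: "2 \<le> dim (orbit_tangent L x)"
    and c: "0 < c" "c < 1" "(*\<^sub>R) (inverse c) ` adjoint_orbit G x \<subseteq> adjoint_orbit G x"
  shows "emeasure (liouville_measure G L x) UNIV = \<infinity>"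
proof (rule ccontr)
  let ?\<mu> = "liouville_measure G L x" and ?m = "dim (orbit_tangent L x) div 2"
  assume "emeasure ?\<mu> UNIV \<noteq> \<infinity>"
  then obtain t where t: "emeasure ?\<mu> UNIV = ennreal t" "t \<ge> 0"
    by (cases "emeasure ?\<mu> UNIV") auto
  have t0: "t > 0" using liouville_pos[OF x] t by simp
  note le = liouville_le_dilate[OF x _ c(3)]
  have "emeasure ?\<mu> UNIV \<le> emeasure (dilate_measure ?m c ?\<mu>) UNIV"
    using le_measureD3[OF le(2)] le(1) c(1) by simp
  also have "\<dots> = ennreal (c ^ ?m * t)"
    using c(1) le(1) t by (simp add: emeasure_dilate_measure ennreal_mult)
  finally have "t \<le> c ^ ?m * t" using t c(1) by (simp add: ennreal_le_iff)
  moreover have "c ^ ?m \<le> c ^ 1" using d c by (intro power_decreasing) auto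
  then have "c ^ ?m * t < 1 * t" using c(2) t0 by (intro mult_strict_right_mono) auto
  ultimately show False by simp
qed

lemma no_gibbs_state:
  assumes x: "x \<in> L" and d: "2 \<le> dim (orbit_tangent L x)"
    and c: "0 < c" "c < 1" "(*\<^sub>R) (inverse c) ` adjoint_orbit G x \<subseteq> adjoint_orbit G x"
    and neg: "uminus ` adjoint_orbit G x \<subseteq> adjoint_orbit G x"
  shows "\<not> admits_gibbs_state G L x"
proof
  let ?\<mu> = "liouville_measure G L x" and ?m = "dim (orbit_tangent L x) div 2"
  assume "admits_gibbs_state G L x"
  then obtain \<beta> where lin: "linear \<beta>" and fin: "partition_function G L x \<beta> < \<infinity>"
    by (auto simp: admits_gibbs_state_def)
  define E where "E = (\<lambda>y. ennreal (exp (- \<beta> y)))"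
  have "continuous_on UNIV \<beta>" using lin by (simp add: linear_continuous_on linear_conv_bounded_linear)
  then have Eb: "E \<in> borel_measurable borel" "(\<lambda>y. E (- y)) \<in> borel_measurable borel"
    unfolding E_def linear_neg[OF lin]
    by (auto intro!: borel_measurable_continuous_onI measurable_compose[OF _ measurable_ennreal] continuous_intros)
  \<comment> \<open>For the dilation by \<open>- 1\<close> the factor
    \<open>\<bar>- 1\<bar> ^ m\<close> is 1, so the measure lies below its image under
    negation.\<close>
  have neg': "(*\<^sub>R) (inverse (- 1)) ` adjoint_orbit G x \<subseteq> adjoint_orbit G x" using neg by auto
  note le = liouville_le_dilate[OF x _ neg']
  have sets: "sets ?\<mu> = sets borel" using le(1) by simp
  have meas: "f \<in> borel_measurable ?\<mu>" if "f \<in> borel_measurable borel" for f :: "_ \<Rightarrow> ennreal"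
    using that measurable_cong_sets[OF sets refl] by blast
  have um: "(*\<^sub>R) (- 1) \<in> ?\<mu> \<rightarrow>\<^sub>M (borel :: (complex^'n^'n) measure)"
    using measurable_scaleR measurable_cong_sets[OF sets refl] by blast
  have "(\<integral>\<^sup>+y. E (- y) \<partial>?\<mu>) \<le> (\<integral>\<^sup>+y. E (- y) \<partial>dilate_measure ?m (- 1) ?\<mu>)"
    using le(2) sets by (intro nn_integral_mono_measure) auto
  also have "\<dots> = (\<integral>\<^sup>+y. E (- y) \<partial>distr ?\<mu> borel ((*\<^sub>R) (- 1)))"
    unfolding dilate_measure_def by (subst nn_integral_scale_measure) (simp_all add: Eb)
  also have "\<dots> = (\<integral>\<^sup>+y. E y \<partial>?\<mu>)"
    using um Eb(2) by (subst nn_integral_distr) auto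
  also have "\<dots> < \<infinity>" using fin by (simp add: partition_function_def E_def)
  finally have "(\<integral>\<^sup>+y. E (- y) \<partial>?\<mu>) < \<infinity>" .
  moreover have "(\<integral>\<^sup>+y. E y \<partial>?\<mu>) < \<infinity>" using fin by (simp add: partition_function_def E_def)
  moreover have "(\<integral>\<^sup>+y. E y + E (- y) \<partial>?\<mu>) = (\<integral>\<^sup>+y. E y \<partial>?\<mu>) + (\<integral>\<^sup>+y. E (- y) \<partial>?\<mu>)"
    by (rule nn_integral_add[OF meas[OF Eb(1)] meas[OF Eb(2)]])
  moreover have "emeasure ?\<mu> UNIV \<le> (\<integral>\<^sup>+y. E y + E (- y) \<partial>?\<mu>)"
  proof -
    have "1 \<le> E y + E (- y)" for y
    proof -
      have "1 \<le> exp (- \<beta> y) + exp (\<beta> y)"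
        by (cases "\<beta> y \<ge> 0") (auto simp: add_increasing add_increasing2)
      then show ?thesis by (simp add: E_def linear_neg[OF lin] flip: ennreal_plus ennreal_1)
    qed
    then have "(\<integral>\<^sup>+y. 1 \<partial>?\<mu>) \<le> (\<integral>\<^sup>+y. E y + E (- y) \<partial>?\<mu>)" by (intro nn_integral_mono)
    moreover have "space ?\<mu> = UNIV" using sets_eq_imp_space_eq[OF sets] by simp
    ultimately show ?thesis by simp
  qed
  ultimately show False using liouville_infinite[OF x d c] by (auto simp: top_unique)
qed

end

section \<open>Signatures of Hermitian forms\<close>

context vector_space_pair
begin

text \<open>The maps between multiplicity spaces are additive and homogeneous on a subspace of the
  ambient space. A linear extension makes the results on images and dimensions applicable to
  them.\<close>

lemma extend_from_subspace:
  assumes U: "vs1.subspace U" and add: "\<And>u v. u \<in> U \<Longrightarrow> v \<in> U \<Longrightarrow> T (u + v) = T u + T v"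
    and scale: "\<And>c u. u \<in> U \<Longrightarrow> T (s1 c u) = s2 c (T u)"
  obtains g where "Vector_Spaces.linear s1 s2 g" "\<And>u. u \<in> U \<Longrightarrow> g u = T u"
proof -
  obtain b where b: "b \<subseteq> U" "vs1.independent b" "U \<subseteq> vs1.span b" "card b = vs1.dim U"
    by (rule vs1.basis_exists[of U])
  obtain g where g: "Vector_Spaces.linear s1 s2 g" "\<forall>x\<in>b. g x = T x"
    using linear_independent_extend[OF b(2)] by blast
  interpret g: Vector_Spaces.linear s1 s2 g by (rule g(1))
  have sp: "vs1.span b = U" using vs1.span_subspace[OF b(1,3) U] .
  have T0: "T 0 = 0" using scale[OF vs1.subspace_0[OF U], of 0] by simp
  have "u \<in> U \<and> g u = T u" if "u \<in> vs1.span b" for u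
    using that
  proof (induction rule: vs1.span_induct_alt)
    case base
    show ?case using T0 vs1.subspace_0[OF U] by simp
  next
    case (step c u v)
    then have "u \<in> U" "v \<in> U" using b(1) by auto
    moreover have "s1 c u \<in> U" using \<open>u \<in> U\<close> U vs1.subspace_scale by blast
    ultimately show ?case
      using step g(2) vs1.subspace_add[OF U] by (simp add: g.add g.scale add scale)
  qed
  then show ?thesis using that g(1) sp by blast
qed

lemma extend_injective_from_subspace:
  assumes U: "vs1.subspace U" and add: "\<And>u v. u \<in> U \<Longrightarrow> v \<in> U \<Longrightarrow> T (u + v) = T u + T v"
    and scale: "\<And>c u. u \<in> U \<Longrightarrow> T (s1 c u) = s2 c (T u)"
    and inj: "\<And>u. u \<in> U \<Longrightarrow> T u = 0 \<Longrightarrow> u = 0"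
  obtains g b where "Vector_Spaces.linear s1 s2 g" "\<And>u. u \<in> U \<Longrightarrow> g u = T u" "inj_on g U"
    "vs1.span b = U" "b \<subseteq> U" "card b = vs1.dim U" "vs2.independent (g ` b)"
proof -
  obtain g where g: "Vector_Spaces.linear s1 s2 g" "\<And>u. u \<in> U \<Longrightarrow> g u = T u"
    using extend_from_subspace[OF U add scale] by blast
  interpret g: Vector_Spaces.linear s1 s2 g by (rule g(1))
  have inj_g: "inj_on g U"
  proof (rule inj_onI)
    fix u v assume uv: "u \<in> U" "v \<in> U" "g u = g v"
    have d: "u - v \<in> U" using uv U vs1.subspace_diff by blast
    have "T (u - v) = 0" using g(2)[OF d] uv(3) by (simp add: g.diff)
    then show "u = v" using inj[OF d] by simp
  qed
  obtain b where b: "b \<subseteq> U" "vs1.independent b" "U \<subseteq> vs1.span b" "card b = vs1.dim U"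
    by (rule vs1.basis_exists[of U])
  have sp: "vs1.span b = U" using vs1.span_subspace[OF b(1,3) U] .
  have ind: "vs2.independent (g ` b)"
    using g.independent_injective_image[OF b(2)] inj_g sp by simp
  show ?thesis by (rule that[OF g inj_g sp b(1,4) ind])
qed

lemma image_of_subspace:
  assumes U: "vs1.subspace U" and add: "\<And>u v. u \<in> U \<Longrightarrow> v \<in> U \<Longrightarrow> T (u + v) = T u + T v"
    and scale: "\<And>c u. u \<in> U \<Longrightarrow> T (s1 c u) = s2 c (T u)"
    and inj: "\<And>u. u \<in> U \<Longrightarrow> T u = 0 \<Longrightarrow> u = 0"
  shows "vs2.subspace (T ` U)" and "vs2.dim (T ` U) = vs1.dim U"
proof -
  obtain g b where g: "Vector_Spaces.linear s1 s2 g" "\<And>u. u \<in> U \<Longrightarrow> g u = T u" "inj_on g U"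
    and b: "vs1.span b = U" "b \<subseteq> U" "card b = vs1.dim U" "vs2.independent (g ` b)"
    using extend_injective_from_subspace[OF U add scale inj] by blast
  interpret g: Vector_Spaces.linear s1 s2 g by (rule g(1))
  have im: "T ` U = g ` U" using g(2) by auto
  show "vs2.subspace (T ` U)" unfolding im using U by (rule g.subspace_image)
  have "vs2.span (g ` b) = g ` U" by (simp add: g.span_image b(1))
  moreover have "card (g ` b) = card b" using g(3) b(2) by (meson card_image inj_on_subset)
  ultimately show "vs2.dim (T ` U) = vs1.dim U"
    unfolding im using vs2.dim_span_eq_card_independent[OF b(4)] b(3) by metis
qed

text \<open>The ambient space of the multiplicity spaces may be infinite-dimensional; finite
  dimension is pulled back along an embedding.\<close>

lemma finite_dim_of_injective:
  assumes U: "vs1.subspace U" and add: "\<And>u v. u \<in> U \<Longrightarrow> v \<in> U \<Longrightarrow> T (u + v) = T u + T v"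
    and scale: "\<And>c u. u \<in> U \<Longrightarrow> T (s1 c u) = s2 c (T u)"
    and inj: "\<And>u. u \<in> U \<Longrightarrow> T u = 0 \<Longrightarrow> u = 0"
    and fin: "finite F" "T ` U \<subseteq> vs2.span F"
  obtains b where "finite b" "U \<subseteq> vs1.span b"
proof -
  obtain g b where g: "Vector_Spaces.linear s1 s2 g" "\<And>u. u \<in> U \<Longrightarrow> g u = T u" "inj_on g U"
    and b: "vs1.span b = U" "b \<subseteq> U" "card b = vs1.dim U" "vs2.independent (g ` b)"
    using extend_injective_from_subspace[OF U add scale inj] by blast
  have "g ` b \<subseteq> vs2.span F" using fin(2) b(2) g(2) by auto
  then have "finite (g ` b)" using vs2.independent_span_bound[OF fin(1) b(4)] by blast
  then have "finite b" using finite_imageD inj_on_subset[OF g(3) b(2)] by blast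
  then show ?thesis using that b(1) by blast
qed

end

text \<open>\<open>T\<close> carries positive definite subspaces to negative definite ones and vice
  versa, and is injective on them by definiteness alone. So the two suprema range over the same set
  of dimensions.\<close>

lemma positive_index_anti_isometry:
  fixes s :: "complex \<Rightarrow> 'w::ab_group_add \<Rightarrow> 'w"
  assumes vs: "vector_space s" and W: "module.subspace s W"
    and add: "\<And>u v. u \<in> W \<Longrightarrow> v \<in> W \<Longrightarrow> T (u + v) = T u + T v"
    and scale: "\<And>c u. u \<in> W \<Longrightarrow> T (s c u) = s c (T u)"
    and TW: "\<And>u. u \<in> W \<Longrightarrow> T u \<in> W" and neg: "\<And>u. u \<in> W \<Longrightarrow> \<psi> (T u) (T u) = - \<psi> u u"
    and zero: "\<psi> 0 0 = 0"
  shows "positive_index s W \<psi> = positive_index s W (\<lambda>u v. - \<psi> u v)"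
proof -
  interpret vector_space_pair s s by (intro vector_space_pair.intro vs)
  let ?D = "\<lambda>\<psi>. {vs1.dim U | U. vs1.subspace U \<and> U \<subseteq> W \<and> (\<forall>u\<in>U. u \<noteq> 0 \<longrightarrow> 0 < Re (\<psi> u u))}"
  have sub: "?D \<psi> \<subseteq> ?D \<psi>'"
    if neg': "\<And>u. u \<in> W \<Longrightarrow> \<psi>' (T u) (T u) = \<psi> u u" and zero': "\<psi>' 0 0 = 0" for \<psi> \<psi>' :: "'w \<Rightarrow> 'w \<Rightarrow> complex"
  proof
    fix n assume "n \<in> ?D \<psi>"
    then obtain U where "n = vs1.dim U \<and> vs1.subspace U \<and> U \<subseteq> W \<and> (\<forall>u\<in>U. u \<noteq> 0 \<longrightarrow> 0 < Re (\<psi> u u))"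
      unfolding mem_Collect_eq by (elim exE)
    then have U: "n = vs1.dim U" "vs1.subspace U" "U \<subseteq> W" "\<And>u. u \<in> U \<Longrightarrow> u \<noteq> 0 \<Longrightarrow> 0 < Re (\<psi> u u)"
      by auto
    have inj: "u = 0" if u: "u \<in> U" "T u = 0" for u
    proof (rule ccontr)
      assume "u \<noteq> 0"
      then have "0 < Re (\<psi> u u)" using U(4) u by blast
      moreover have "\<psi> u u = 0" using neg'[of u] u U(3) zero' by auto
      ultimately show False by simp
    qed
    have "vs1.subspace (T ` U)" "vs1.dim (T ` U) = n"
      using image_of_subspace[of U T] U inj add scale by (auto simp: subset_iff)
    moreover have "T ` U \<subseteq> W" using U(3) TW by auto
    moreover have "0 < Re (\<psi>' v v)" if v: "v \<in> T ` U" "v \<noteq> 0" for v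
    proof -
      obtain u where u: "u \<in> U" "v = T u" using v(1) by blast
      have T0: "T 0 = 0" using scale[OF vs1.subspace_0[OF W], of 0] by simp
      have "u \<noteq> 0" using u v(2) T0 by auto
      then show ?thesis using U(3,4) u neg'[of u] by auto
    qed
    ultimately show "n \<in> ?D \<psi>'" unfolding mem_Collect_eq by (intro exI[of _ "T ` U"]) auto
  qed
  have "?D \<psi> = ?D (\<lambda>u v. - \<psi> u v)"
    using sub[of "\<lambda>u v. - \<psi> u v" \<psi>] sub[of \<psi> "\<lambda>u v. - \<psi> u v"] neg zero by (intro antisym) simp_all
  then show ?thesis by (simp add: positive_index_def)
qed

locale hermitian_subspace = vector_space s
  for s :: "complex \<Rightarrow> 'w::ab_group_add \<Rightarrow> 'w" +
  fixes W :: "'w set" and \<psi> :: "'w \<Rightarrow> 'w \<Rightarrow> complex"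
  assumes W: "subspace W" and herm: "hermitian_form s W \<psi>"
begin

lemma form_add: "u \<in> W \<Longrightarrow> v \<in> W \<Longrightarrow> w \<in> W \<Longrightarrow> \<psi> (u + v) w = \<psi> u w + \<psi> v w"
  "u \<in> W \<Longrightarrow> v \<in> W \<Longrightarrow> w \<in> W \<Longrightarrow> \<psi> w (u + v) = \<psi> w u + \<psi> w v"
  using herm unfolding hermitian_form_def sesquilinear_form_def by blast+

lemma form_scale: "u \<in> W \<Longrightarrow> v \<in> W \<Longrightarrow> \<psi> (s c u) v = cnj c * \<psi> u v"
  "u \<in> W \<Longrightarrow> v \<in> W \<Longrightarrow> \<psi> u (s c v) = c * \<psi> u v"
  using herm unfolding hermitian_form_def sesquilinear_form_def by blast+

lemma form_commute: "u \<in> W \<Longrightarrow> v \<in> W \<Longrightarrow> \<psi> v u = cnj (\<psi> u v)"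
  using herm unfolding hermitian_form_def by blast

lemma form_zero: "v \<in> W \<Longrightarrow> \<psi> 0 v = 0" "v \<in> W \<Longrightarrow> \<psi> v 0 = 0"
  using form_scale(1)[of 0 v 0] form_scale(2)[of v 0 0] subspace_0[OF W] by simp_all

lemma form_diff: "u \<in> W \<Longrightarrow> v \<in> W \<Longrightarrow> w \<in> W \<Longrightarrow> \<psi> (u - v) w = \<psi> u w - \<psi> v w"
  "u \<in> W \<Longrightarrow> v \<in> W \<Longrightarrow> w \<in> W \<Longrightarrow> \<psi> w (u - v) = \<psi> w u - \<psi> w v"
  using form_add(1)[of "u - v" v w] form_add(2)[of "u - v" v w] subspace_diff[OF W] by simp_all

lemma sum_in_W: "(\<And>i. i \<in> I \<Longrightarrow> e i \<in> W) \<Longrightarrow> (\<Sum>i\<in>I. s (c i) (e i)) \<in> W"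
  using W by (intro subspace_sum subspace_scale)

lemma form_sum:
  assumes "finite I" "\<And>i. i \<in> I \<Longrightarrow> e i \<in> W" "w \<in> W"
  shows "\<psi> (\<Sum>i\<in>I. s (c i) (e i)) w = (\<Sum>i\<in>I. cnj (c i) * \<psi> (e i) w)"
    "\<psi> w (\<Sum>i\<in>I. s (c i) (e i)) = (\<Sum>i\<in>I. c i * \<psi> w (e i))"
  using assms(1,2)
proof (induction I)
  case (insert i I)
  { case 1
    then show ?case using insert assms(3) sum_in_W[of I e c] subspace_scale[OF W]
      by (simp add: form_add form_scale)
  next
    case 2
    then show ?case using insert assms(3) sum_in_W[of I e c] subspace_scale[OF W]
      by (simp add: form_add form_scale) }
qed (simp_all add: form_zero assms(3))

definition orthonormal :: "nat \<Rightarrow> (nat \<Rightarrow> 'w) \<Rightarrow> (nat \<Rightarrow> real) \<Rightarrow> bool" where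
  "orthonormal k e \<epsilon> \<longleftrightarrow> (\<forall>i<k. e i \<in> W \<and> (\<epsilon> i = 1 \<or> \<epsilon> i = - 1)) \<and>
    (\<forall>i<k. \<forall>j<k. \<psi> (e i) (e j) = (if i = j then of_real (\<epsilon> i) else 0))"

lemma orthonormalD:
  assumes "orthonormal k e \<epsilon>" "i < k"
  shows "e i \<in> W" "\<epsilon> i = 1 \<or> \<epsilon> i = - 1" "of_real (\<epsilon> i) * of_real (\<epsilon> i) = (1::complex)"
    "j < k \<Longrightarrow> \<psi> (e i) (e j) = (if i = j then of_real (\<epsilon> i) else 0)"
proof -
  show e: "e i \<in> W" "\<epsilon> i = 1 \<or> \<epsilon> i = - 1"
    "j < k \<Longrightarrow> \<psi> (e i) (e j) = (if i = j then of_real (\<epsilon> i) else 0)"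
    using assms by (auto simp: orthonormal_def)
  show "of_real (\<epsilon> i) * of_real (\<epsilon> i) = (1::complex)" using e(2) by auto
qed

lemma form_orthonormal_sum:
  assumes o: "orthonormal k e \<epsilon>" and j: "j < k" and I: "I \<subseteq> {..<k}"
  shows "\<psi> (e j) (\<Sum>i\<in>I. s (c i) (e i)) = (if j \<in> I then c j * of_real (\<epsilon> j) else 0)"
proof -
  have fin: "finite I" using I finite_subset by blast
  have "\<psi> (e j) (\<Sum>i\<in>I. s (c i) (e i)) = (\<Sum>i\<in>I. c i * \<psi> (e j) (e i))"
    using I orthonormalD(1)[OF o] j by (intro form_sum(2)[OF fin]) auto
  also have "\<dots> = (\<Sum>i\<in>I. if i = j then c i * of_real (\<epsilon> j) else 0)"
    using I orthonormalD(4)[OF o j] by (intro sum.cong) auto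
  finally show ?thesis using fin by simp
qed

lemma orthonormal_independent:
  assumes o: "orthonormal k e \<epsilon>"
  shows "inj_on e {..<k}" "independent (e ` {..<k})"
proof -
  have "c i = 0" if "(\<Sum>i<k. s (c i) (e i)) = 0" "i < k" for c i
    using form_orthonormal_sum[OF o that(2) subset_refl, of c] orthonormalD[OF o that(2)] that form_zero(2)
    by auto
  then show "inj_on e {..<k}" "independent (e ` {..<k})"
    using independent_indexed_family by blast+
qed

text \<open>The orthogonal projection onto the span of the family; each sign is its own inverse.
  That the family spans \<open>W\<close> is expressed below as \<open>proj\<close> being the
  identity there.\<close>

definition proj :: "nat \<Rightarrow> (nat \<Rightarrow> 'w) \<Rightarrow> (nat \<Rightarrow> real) \<Rightarrow> 'w \<Rightarrow> 'w" where
  "proj k e \<epsilon> w = (\<Sum>i<k. s (of_real (\<epsilon> i) * \<psi> (e i) w) (e i))"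

lemma proj_orthogonal:
  assumes o: "orthonormal k e \<epsilon>" and w: "w \<in> W"
  shows "proj k e \<epsilon> w \<in> W" "j < k \<Longrightarrow> \<psi> (e j) (w - proj k e \<epsilon> w) = 0"
proof -
  show pW: "proj k e \<epsilon> w \<in> W"
    unfolding proj_def using orthonormalD(1)[OF o] by (intro sum_in_W) auto
  show "\<psi> (e j) (w - proj k e \<epsilon> w) = 0" if j: "j < k"
    using form_orthonormal_sum[OF o j subset_refl, of "\<lambda>i. of_real (\<epsilon> i) * \<psi> (e i) w"]
      orthonormalD[OF o j] w pW j
    by (simp add: form_diff proj_def mult.commute mult.left_commute)
qed

lemma exists_anisotropic:
  assumes r: "r \<in> W" and z: "z \<in> W" and nz: "\<psi> r z \<noteq> 0"
  obtains a b where "\<psi> (s a r + s b z) (s a r + s b z) \<noteq> 0"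
proof (cases "\<psi> r r = 0 \<and> \<psi> z z = 0")
  case True
  \<comment> \<open>Both squares vanish, and this phase aligns the two mixed terms so that their sum
    is twice the squared modulus of \<open>\<psi> r z\<close>.\<close>
  let ?b = "cnj (\<psi> r z)"
  have "\<psi> (s 1 r + s ?b z) (s 1 r + s ?b z) = ?b * \<psi> r z + cnj ?b * \<psi> z r"
    using True r z subspace_scale[OF W] subspace_add[OF W] by (simp add: form_add form_scale)
  also have "\<dots> = 2 * (\<psi> r z * cnj (\<psi> r z))" using form_commute[OF r z] by (simp add: mult.commute)
  finally show ?thesis using that[of 1 ?b] nz by simp
next
  case False
  then show ?thesis using that[of 1 0] that[of 0 1] by auto
qed

text \<open>A longest orthonormal family. A nonzero residual \<open>r\<close> has, by nondegeneracy,
  a partner orthogonal to the family; some combination of the two is anisotropic, and normalizing it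
  to length \<open>1\<close> or \<open>- 1\<close> would extend the family.\<close>

lemma exists_orthonormal_basis:
  assumes nd: "nondegenerate_form W \<psi>" and fin: "finite F" "W \<subseteq> span F"
  obtains k e \<epsilon> where "orthonormal k e \<epsilon>" "\<And>w. w \<in> W \<Longrightarrow> proj k e \<epsilon> w = w"
proof -
  let ?P = "\<lambda>k. \<exists>e \<epsilon>. orthonormal k e \<epsilon>"
  have bound: "k \<le> card F" if k: "?P k" for k
  proof -
    obtain e \<epsilon> where o: "orthonormal k e \<epsilon>" using k by blast
    have "e ` {..<k} \<subseteq> span F" using orthonormalD(1)[OF o] fin(2) by auto
    then have "card (e ` {..<k}) \<le> card F"
      using independent_span_bound[OF fin(1) orthonormal_independent(2)[OF o]] by blast
    then show ?thesis using orthonormal_independent(1)[OF o] by (simp add: card_image)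
  qed
  have "?P 0" by (simp add: orthonormal_def)
  define k where "k = (GREATEST k. ?P k)"
  have "?P k" unfolding k_def
    by (rule GreatestI_nat[where P = ?P, OF \<open>?P 0\<close>]) (use bound in blast)
  then obtain e \<epsilon> where o: "orthonormal k e \<epsilon>" by blast
  have max: "\<not> ?P (Suc k)"
  proof
    assume "?P (Suc k)"
    then have "Suc k \<le> k" unfolding k_def
      by (intro Greatest_le_nat[where P = ?P]) (use bound in blast)+
    then show False by simp
  qed
  have "proj k e \<epsilon> w = w" if w: "w \<in> W" for w
  proof (rule ccontr)
    assume neq: "proj k e \<epsilon> w \<noteq> w"
    define r where "r = w - proj k e \<epsilon> w"
    have r: "r \<in> W" "r \<noteq> 0" "\<And>j. j < k \<Longrightarrow> \<psi> (e j) r = 0"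
      using neq proj_orthogonal[OF o w] w subspace_diff[OF W] by (auto simp: r_def)
    obtain z0 where z0: "z0 \<in> W" "\<psi> r z0 \<noteq> 0" using nd r(1,2) by (auto simp: nondegenerate_form_def)
    \<comment> \<open>Orthogonal to the family, with the same pairing with \<open>r\<close> because
      \<open>r\<close> is orthogonal to the family as well.\<close>
    define z where "z = z0 - proj k e \<epsilon> z0"
    have z: "z \<in> W" "\<And>j. j < k \<Longrightarrow> \<psi> (e j) z = 0"
      using proj_orthogonal[OF o z0(1)] z0(1) subspace_diff[OF W] by (auto simp: z_def)
    have re: "\<psi> r (e j) = 0" if "j < k" for j
      using form_commute[OF orthonormalD(1)[OF o that] r(1)] r(3)[OF that] by simp
    have "\<psi> r (proj k e \<epsilon> z0) = 0"
      unfolding proj_def using orthonormalD(1)[OF o] r(1) re by (subst form_sum(2)) auto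
    then have "\<psi> r z \<noteq> 0"
      using z0 r(1) proj_orthogonal(1)[OF o z0(1)] by (simp add: z_def form_diff)
    then obtain a b where ab: "\<psi> (s a r + s b z) (s a r + s b z) \<noteq> 0"
      using exists_anisotropic[OF r(1) z(1)] by blast
    define t where "t = s a r + s b z"
    have t: "t \<in> W" "\<And>j. j < k \<Longrightarrow> \<psi> (e j) t = 0"
      using r z orthonormalD(1)[OF o] subspace_scale[OF W] subspace_add[OF W]
      by (auto simp: t_def form_add form_scale)
    have "\<psi> t t = of_real (Re (\<psi> t t))"
      using form_commute[OF t(1) t(1)] by (simp add: complex_eq_iff)
    then obtain q :: real where q: "\<psi> t t = of_real q" by blast
    have q0: "q \<noteq> 0" using ab q by (auto simp: t_def)
    define n where "n = s (of_real (1 / sqrt \<bar>q\<bar>)) t"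
    have sq: "of_real (1 / sqrt \<bar>q\<bar>) * (of_real (1 / sqrt \<bar>q\<bar>) * complex_of_real q) = of_real (sgn q)"
    proof -
      have "1 / sqrt \<bar>q\<bar> * (1 / sqrt \<bar>q\<bar> * q) = sgn q"
        using q0 by (auto simp: sgn_if field_simps)
      then show ?thesis by (metis of_real_mult)
    qed
    have n: "n \<in> W" "\<And>j. j < k \<Longrightarrow> \<psi> (e j) n = 0" "\<psi> n n = of_real (sgn q)"
      using t q sq orthonormalD(1)[OF o] subspace_scale[OF W] by (auto simp: n_def form_scale)
    have ne: "\<psi> n (e j) = 0" if "j < k" for j
      using form_commute[OF orthonormalD(1)[OF o that] n(1)] n(2)[OF that] by simp
    have "orthonormal (Suc k) (e(k := n)) (\<epsilon>(k := sgn q))"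
      using orthonormalD[OF o] n ne q0 unfolding orthonormal_def
      by (auto simp: less_Suc_eq sgn_if)
    then show False using max by blast
  qed
  then show ?thesis using that o by blast
qed

text \<open>The law of inertia. The basis vectors with sign 1 span a positive definite space, and
  every positive definite space projects injectively to that span.\<close>

lemma positive_index_orthonormal:
  assumes o: "orthonormal k e \<epsilon>" and full: "\<And>w. w \<in> W \<Longrightarrow> proj k e \<epsilon> w = w"
  shows "positive_index s W \<psi> = card {i. i < k \<and> \<epsilon> i = 1}"
proof -
  let ?P = "{i. i < k \<and> \<epsilon> i = 1}"
  let ?D = "{dim U | U. subspace U \<and> U \<subseteq> W \<and> (\<forall>u\<in>U. u \<noteq> 0 \<longrightarrow> 0 < Re (\<psi> u u))}"
  interpret vector_space_pair s s by unfold_locales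
  have diag: "Re (\<psi> w w) = (\<Sum>i<k. \<epsilon> i * (cmod (\<psi> (e i) w))\<^sup>2)" if w: "w \<in> W" for w
  proof -
    have "\<psi> w w = \<psi> (proj k e \<epsilon> w) w" using full[OF w] by simp
    also have "\<dots> = (\<Sum>i<k. cnj (of_real (\<epsilon> i) * \<psi> (e i) w) * \<psi> (e i) w)"
      unfolding proj_def using orthonormalD(1)[OF o] w by (intro form_sum(1)) auto
    also have "\<dots> = (\<Sum>i<k. of_real (\<epsilon> i * (cmod (\<psi> (e i) w))\<^sup>2))"
      by (intro sum.cong refl) (simp add: complex_norm_square mult.commute mult.left_commute del: of_real_power)
    finally show ?thesis by simp
  qed
  have "card ?P \<in> ?D"
  proof -
    let ?U = "span (e ` ?P)"
    have inj: "inj_on e ?P" "independent (e ` ?P)"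
      using inj_on_subset[OF orthonormal_independent(1)[OF o], of ?P]
        independent_mono[OF orthonormal_independent(2)[OF o], of "e ` ?P"] by auto
    have UW: "?U \<subseteq> W" using orthonormalD(1)[OF o] W by (intro span_minimal) auto
    have zero: "\<psi> (e j) u = 0" if uU: "u \<in> ?U" and j: "j < k" "\<epsilon> j \<noteq> 1" for u j
    proof -
      obtain f where "u = (\<Sum>i\<in>?P. s (f (e i)) (e i))"
        using uU inj(1) by (auto simp: span_finite sum.reindex)
      then show ?thesis using form_orthonormal_sum[OF o j(1), of ?P "\<lambda>i. f (e i)"] j(2) by auto
    qed
    have "0 < Re (\<psi> u u)" if u: "u \<in> ?U" "u \<noteq> 0" for u
    proof -
      have uW: "u \<in> W" using u UW by auto
      have "\<exists>i<k. \<psi> (e i) u \<noteq> 0"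
      proof (rule ccontr)
        assume "\<not> (\<exists>i<k. \<psi> (e i) u \<noteq> 0)"
        then have "proj k e \<epsilon> u = 0" by (simp add: proj_def)
        then show False using full[OF uW] u(2) by simp
      qed
      then obtain i where i: "i < k" "\<psi> (e i) u \<noteq> 0" by blast
      have "0 < (\<Sum>i<k. \<epsilon> i * (cmod (\<psi> (e i) u))\<^sup>2)"
      proof (rule sum_pos2[of _ i])
        show "0 < \<epsilon> i * (cmod (\<psi> (e i) u))\<^sup>2"
          using i zero[OF u(1) i(1)] by (cases "\<epsilon> i = 1") auto
        show "0 \<le> \<epsilon> j * (cmod (\<psi> (e j) u))\<^sup>2" if "j \<in> {..<k}" for j
          using that zero[OF u(1), of j] by (cases "\<epsilon> j = 1") auto
      qed (use i in auto)
      then show ?thesis using diag[OF uW] by simp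
    qed
    moreover have "dim ?U = card ?P"
      using dim_span_eq_card_independent[OF inj(2)] card_image[OF inj(1)] by simp
    ultimately show ?thesis using UW subspace_span by (intro CollectI exI[of _ ?U]) auto
  qed
  moreover have "n \<le> card ?P" if "n \<in> ?D" for n
  proof -
    from that obtain U where "n = dim U \<and> subspace U \<and> U \<subseteq> W \<and> (\<forall>u\<in>U. u \<noteq> 0 \<longrightarrow> 0 < Re (\<psi> u u))"
      unfolding mem_Collect_eq by (elim exE)
    then have U: "n = dim U" "subspace U" "U \<subseteq> W" "\<And>u. u \<in> U \<Longrightarrow> u \<noteq> 0 \<Longrightarrow> 0 < Re (\<psi> u u)"
      by auto
    \<comment> \<open>The positive part of \<open>u\<close>. Where it vanishes, the form is a sum of
      nonpositive terms, which excludes nonzero elements of \<open>U\<close>.\<close>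
    define T where "T u = (\<Sum>i\<in>?P. s (\<psi> (e i) u) (e i))" for u
    have finP: "finite ?P" by simp
    have eW: "e i \<in> W" if "i \<in> ?P" for i using that orthonormalD(1)[OF o] by auto
    have Tinj: "u = 0" if u: "u \<in> U" "T u = 0" for u
    proof (rule ccontr)
      assume "u \<noteq> 0"
      have uW: "u \<in> W" using u U(3) by auto
      have "\<psi> (e j) u = 0" if "j < k" "\<epsilon> j = 1" for j
        using form_orthonormal_sum[OF o that(1), of ?P "\<lambda>i. \<psi> (e i) u"] that u(2)[unfolded T_def]
          form_zero(2)[OF orthonormalD(1)[OF o that(1)]] by auto
      then have "\<epsilon> j * (cmod (\<psi> (e j) u))\<^sup>2 \<le> 0" if "j < k" for j
        using that orthonormalD(2)[OF o that] by (cases "\<epsilon> j = 1") auto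
      then have "Re (\<psi> u u) \<le> 0" unfolding diag[OF uW] by (intro sum_nonpos) auto
      then show False using U(4)[OF u(1) \<open>u \<noteq> 0\<close>] by simp
    qed
    note T_def [simp]
    have Tadd: "T (u + v) = T u + T v" if "u \<in> U" "v \<in> U" for u v
    proof -
      have "\<psi> (e i) (u + v) = \<psi> (e i) u + \<psi> (e i) v" if "i \<in> ?P" for i
        using eW[OF that] \<open>u \<in> U\<close> \<open>v \<in> U\<close> U(3) by (intro form_add) auto
      then show ?thesis by (simp add: scale_left_distrib sum.distrib)
    qed
    have Tscale: "T (s c u) = s c (T u)" if "u \<in> U" for c u
    proof -
      have "\<psi> (e i) (s c u) = c * \<psi> (e i) u" if "i \<in> ?P" for i
        using eW[OF that] \<open>u \<in> U\<close> U(3) by (intro form_scale) auto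
      then show ?thesis by (simp add: scale_sum_right)
    qed
    have "dim (T ` U) = dim U"
      by (rule image_of_subspace(2)[OF U(2)]) (rule Tadd Tscale Tinj; assumption)+
    moreover have "T ` U \<subseteq> span (e ` ?P)"
      unfolding T_def by (intro image_subsetI span_sum span_scale span_base imageI)
    then have "dim (T ` U) \<le> card (e ` ?P)" by (intro dim_le_card) auto
    moreover have "card (e ` ?P) \<le> card ?P" by (simp add: card_image_le)
    ultimately show ?thesis using U(1) by simp
  qed
  ultimately have "Sup ?D = card ?P" by (intro cSup_eq_maximum) auto
  then show ?thesis by (simp add: positive_index_def)
qed

lemma hermitian_subspace_neg: "hermitian_subspace s W (\<lambda>u v. - \<psi> u v)"
proof unfold_locales
  show "subspace W" by (rule W)
  show "hermitian_form s W (\<lambda>u v. - \<psi> u v)"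
    unfolding hermitian_form_def
  proof (intro conjI ballI)
    show "sesquilinear_form s W (\<lambda>u v. - \<psi> u v)"
      unfolding sesquilinear_form_def by (simp add: form_add form_scale)
    show "- \<psi> v u = cnj (- \<psi> u v)" if "u \<in> W" "v \<in> W" for u v
      using form_commute[OF that] by simp
  qed
qed

text \<open>Split signature allows the positive basis vectors to be matched with the negative ones;
  exchanging the matched vectors reverses the form.\<close>

lemma exists_anti_isometry:
  assumes nd: "nondegenerate_form W \<psi>" and fin: "finite F" "W \<subseteq> span F"
    and split: "positive_index s W \<psi> = positive_index s W (\<lambda>u v. - \<psi> u v)"
  obtains T where "\<And>u. u \<in> W \<Longrightarrow> T u \<in> W"
    "\<And>u v. u \<in> W \<Longrightarrow> v \<in> W \<Longrightarrow> T (u + v) = T u + T v"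
    "\<And>c u. u \<in> W \<Longrightarrow> T (s c u) = s c (T u)"
    "\<And>u v. u \<in> W \<Longrightarrow> v \<in> W \<Longrightarrow> \<psi> (T u) (T v) = - \<psi> u v"
proof -
  obtain k e \<epsilon> where o: "orthonormal k e \<epsilon>" and full: "\<And>w. w \<in> W \<Longrightarrow> proj k e \<epsilon> w = w"
    using exists_orthonormal_basis[OF nd fin] by blast
  let ?P = "{i. i < k \<and> \<epsilon> i = 1}" and ?N = "{i. i < k \<and> \<epsilon> i = - 1}"
  interpret neg: hermitian_subspace s W "\<lambda>u v. - \<psi> u v" by (rule hermitian_subspace_neg)
  have o': "neg.orthonormal k e (\<lambda>i. - \<epsilon> i)"
    using o unfolding orthonormal_def neg.orthonormal_def by auto
  have "neg.proj k e (\<lambda>i. - \<epsilon> i) w = proj k e \<epsilon> w" for w by (simp add: proj_def neg.proj_def)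
  then have "positive_index s W (\<lambda>u v. - \<psi> u v) = card {i. i < k \<and> - \<epsilon> i = 1}"
    using full by (intro neg.positive_index_orthonormal[OF o']) simp
  also have "{i. i < k \<and> - \<epsilon> i = 1} = ?N" by auto
  finally have "card ?P = card ?N" using positive_index_orthonormal[OF o full] split by simp
  then obtain \<pi> where \<pi>: "bij_betw \<pi> ?P ?N" using finite_same_card_bij[of ?P ?N] by auto
  \<comment> \<open>The involution of the index set that consists of the matching and its
    inverse.\<close>
  define \<tau> where "\<tau> i = (if \<epsilon> i = 1 then \<pi> i else inv_into ?P \<pi> i)" for i
  have \<tau>P: "\<tau> i \<in> ?N" if "i \<in> ?P" for i using that \<pi> by (auto simp: \<tau>_def bij_betw_def)
  have \<tau>N: "\<tau> i \<in> ?P" if "i \<in> ?N" for i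
  proof -
    have "i \<in> \<pi> ` ?P" using \<pi> that by (simp add: bij_betw_def)
    from inv_into_into[OF this] show ?thesis using that by (simp add: \<tau>_def)
  qed
  have \<tau>\<tau>: "\<tau> (\<tau> i) = i" if "i < k" for i
  proof (cases "\<epsilon> i = 1")
    case True
    then have "\<epsilon> (\<pi> i) \<noteq> 1" using \<tau>P[of i] that by (simp add: \<tau>_def)
    then show ?thesis using True \<pi> that by (simp add: \<tau>_def bij_betw_def inv_into_f_f)
  next
    case False
    then have i: "i \<in> ?N" using orthonormalD(2)[OF o that] that by auto
    have "i \<in> \<pi> ` ?P" using \<pi> i by (simp add: bij_betw_def)
    then show ?thesis using False \<tau>N[OF i] by (simp add: \<tau>_def f_inv_into_f)
  qed
  have \<tau>k: "\<tau> i < k" "\<epsilon> (\<tau> i) = - \<epsilon> i" if "i < k" for i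
    using \<tau>P[of i] \<tau>N[of i] orthonormalD(2)[OF o that] that by auto
  have \<tau>inj: "\<tau> i = \<tau> j \<longleftrightarrow> i = j" if "i < k" "j < k" for i j using \<tau>\<tau> that by metis
  have o\<tau>: "\<psi> (e (\<tau> i)) (e (\<tau> j)) = (if i = j then - of_real (\<epsilon> i) else 0)" if "i < k" "j < k" for i j
    using orthonormalD(4)[OF o \<tau>k(1)[OF that(1)] \<tau>k(1)[OF that(2)]] \<tau>inj[OF that] \<tau>k(2)[OF that(1)] by auto
  define T where "T u = (\<Sum>i<k. s (of_real (\<epsilon> i) * \<psi> (e i) u) (e (\<tau> i)))" for u
  have eW: "e i \<in> W" if "i < k" for i using orthonormalD(1)[OF o that] .
  have e\<tau>W: "e (\<tau> i) \<in> W" if "i < k" for i using eW \<tau>k(1)[OF that] by blast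
  have TW: "T u \<in> W" for u unfolding T_def using e\<tau>W by (intro sum_in_W) auto
  show ?thesis
  proof
    show "T u \<in> W" for u by (rule TW)
    show "T (u + v) = T u + T v" if "u \<in> W" "v \<in> W" for u v
      using that eW by (simp add: T_def form_add scale_left_distrib sum.distrib distrib_left)
    show "T (s c u) = s c (T u)" if "u \<in> W" for c u
      using that eW by (simp add: T_def form_scale scale_sum_right mult.left_commute)
    fix u v assume u: "u \<in> W" and v: "v \<in> W"
    have eT: "\<psi> (e (\<tau> i)) (T v) = - \<psi> (e i) v" if i: "i < k" for i
    proof -
      have "\<psi> (e (\<tau> i)) (T v) = (\<Sum>j<k. (of_real (\<epsilon> j) * \<psi> (e j) v) * \<psi> (e (\<tau> i)) (e (\<tau> j)))"
        unfolding T_def using e\<tau>W i by (intro form_sum(2)) auto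
      also have "\<dots> = (\<Sum>j<k. if j = i then - (of_real (\<epsilon> i) * of_real (\<epsilon> i)) * \<psi> (e i) v else 0)"
        using o\<tau>[OF i] by (intro sum.cong) auto
      finally show ?thesis using i orthonormalD(3)[OF o i] by simp
    qed
    have "\<psi> (T u) (T v) = (\<Sum>i<k. cnj (of_real (\<epsilon> i) * \<psi> (e i) u) * \<psi> (e (\<tau> i)) (T v))"
      unfolding T_def[of u] using e\<tau>W TW by (intro form_sum(1)) auto
    also have "\<dots> = - (\<Sum>i<k. cnj (of_real (\<epsilon> i) * \<psi> (e i) u) * \<psi> (e i) v)"
      using eT by (simp add: sum_negf)
    also have "(\<Sum>i<k. cnj (of_real (\<epsilon> i) * \<psi> (e i) u) * \<psi> (e i) v) = \<psi> (proj k e \<epsilon> u) v"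
      unfolding proj_def using eW v by (intro form_sum(1)[symmetric]) auto
    finally show "\<psi> (T u) (T v) = - \<psi> u v" using full[OF u] by simp
  qed
qed

end

text \<open>Maximal definite subspaces of either sign meet only in 0, so by dimension they span. For
  \<open>a + b\<close> in the radical, pairing with \<open>a\<close> and with \<open>b\<close> gives
  \<open>Re (B a a) = Re (B b b)\<close>, where the left side is nonnegative and the right side
  nonpositive.\<close>

lemma nondegenerate_of_signature:
  fixes B :: "complex^'n \<Rightarrow> complex^'n::finite \<Rightarrow> complex"
  assumes herm: "hermitian_form (*s) UNIV B" and sig: "hermitian_signature (*s) UNIV B = (p, q)"
    and pq: "CARD('n) = p + q"
  shows "nondegenerate_form UNIV B"
proof -
  interpret h: hermitian_subspace "(*s)" UNIV B
    by unfold_locales (use herm vec.subspace_UNIV in auto)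
  let ?D = "\<lambda>\<psi>. {vec.dim U | U. vec.subspace U \<and> U \<subseteq> UNIV \<and> (\<forall>u\<in>U. u \<noteq> 0 \<longrightarrow> 0 < Re (\<psi> u u))}"
  \<comment> \<open>The supremum is taken over a nonempty set of naturals bounded by the dimension,
    hence it is a maximum.\<close>
  have attained: "\<exists>U. vec.subspace U \<and> vec.dim U = positive_index (*s) UNIV \<psi> \<and> (\<forall>u\<in>U. u \<noteq> 0 \<longrightarrow> 0 < Re (\<psi> u u))"
    for \<psi> :: "complex^'n \<Rightarrow> complex^'n \<Rightarrow> complex"
  proof -
    define D where "D = ?D \<psi>"
    have "vec.dim {0 :: complex^'n} \<in> D"
      unfolding D_def using vec.subspace_single_0 by (intro CollectI exI[of _ "{0}"]) auto
    moreover have "finite D"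
    proof (rule finite_subset)
      show "D \<subseteq> {..CARD('n)}" unfolding D_def using dim_subset_UNIV_cart_gen by auto
    qed simp
    ultimately have "Sup D \<in> D" by (auto simp: Sup_nat_def intro: Max_in)
    then have "positive_index (*s) UNIV \<psi> \<in> D" by (simp add: positive_index_def D_def)
    then show ?thesis by (auto simp: D_def)
  qed
  obtain U V where U: "vec.subspace U" "vec.dim U = p" "\<And>u. u \<in> U \<Longrightarrow> u \<noteq> 0 \<Longrightarrow> 0 < Re (B u u)"
    and V: "vec.subspace V" "vec.dim V = q" "\<And>u. u \<in> V \<Longrightarrow> u \<noteq> 0 \<Longrightarrow> 0 < Re (- B u u)"
    using attained[of B] attained[of "\<lambda>u v. - B u v"] sig by (auto simp: hermitian_signature_def)
  have "U \<inter> V = {0}"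
  proof -
    have "u = 0" if "u \<in> U" "u \<in> V" for u using U(3)[OF that(1)] V(3)[OF that(2)] by fastforce
    then show ?thesis using vec.subspace_0[OF U(1)] vec.subspace_0[OF V(1)] by auto
  qed
  then have "vec.dim {a + b |a b. a \<in> U \<and> b \<in> V} = CARD('n)"
    using vec.dim_sums_Int[OF U(1) V(1)] U(2) V(2) pq by simp
  moreover have sub: "vec.subspace {a + b |a b. a \<in> U \<and> b \<in> V}"
    using U(1) V(1) by (rule vec.subspace_sums)
  ultimately have all: "{a + b |a b. a \<in> U \<and> b \<in> V} = UNIV"
    using vec.subspace_dim_equal[OF sub vec.subspace_UNIV] card_cart_basis[where 'i='n and 'a=complex] by simp
  show ?thesis
    unfolding nondegenerate_form_def
  proof (intro ballI impI)
    fix v assume 0: "\<forall>w\<in>UNIV. B v w = 0"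
    have "v \<in> {a + b |a b. a \<in> U \<and> b \<in> V}" using all by simp
    then obtain a b where ab: "a \<in> U" "b \<in> V" "v = a + b" by blast
    have "B a a + B b a = 0" "B a b + B b b = 0"
      using 0 ab(3) h.form_add(1)[of a b a] h.form_add(1)[of a b b] by auto
    moreover have "Re (B a b) = Re (B b a)" using h.form_commute[of a b] by simp
    ultimately have "Re (B a a) = Re (B b b)" by (simp add: complex_eq_iff)
    then have "a = 0 \<and> b = 0"
      using U(3)[OF ab(1)] V(3)[OF ab(2)] h.form_zero(1)[of 0] by (cases "a = 0"; cases "b = 0") auto
    then show "v = 0" using ab(3) by simp
  qed
qed

section \<open>The isotypic decomposition\<close>

locale isotypic = su_form B + vs: vector_space s
  for B :: "complex^'n \<Rightarrow> complex^'n::finite \<Rightarrow> complex"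
    and s :: "complex \<Rightarrow> 'w::ab_group_add \<Rightarrow> 'w" +
  fixes W :: "nat \<Rightarrow> 'w set" and \<phi> :: "nat \<Rightarrow> 'w \<Rightarrow> 'w \<Rightarrow> complex"
    and x :: "complex^'n^'n" and \<Phi> :: "(nat \<Rightarrow> nat \<Rightarrow> 'w) \<Rightarrow> complex^'n"
  assumes W: "vs.subspace (W r)" and sesq: "sesquilinear_form s (W r) (\<phi> r)"
    and bij: "bij_betw \<Phi> (isotypic_sum W) UNIV"
    and \<Phi>_add: "f \<in> isotypic_sum W \<Longrightarrow> g \<in> isotypic_sum W \<Longrightarrow> \<Phi> (\<lambda>r i. f r i + g r i) = \<Phi> f + \<Phi> g"
    and \<Phi>_form: "f \<in> isotypic_sum W \<Longrightarrow> g \<in> isotypic_sum W \<Longrightarrow> B (\<Phi> f) (\<Phi> g) = isotypic_form \<phi> f g"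
    and \<Phi>_scale: "f \<in> isotypic_sum W \<Longrightarrow> \<Phi> (\<lambda>r i. s c (f r i)) = c *s \<Phi> f"
    and \<Phi>_X: "f \<in> isotypic_sum W \<Longrightarrow> \<Phi> (isotypic_action s irrep_X f) = x *v \<Phi> f"
begin

abbreviation I where "I \<equiv> isotypic_sum W"

lemma W_closed: "0 \<in> W r" "u \<in> W r \<Longrightarrow> v \<in> W r \<Longrightarrow> u + v \<in> W r" "u \<in> W r \<Longrightarrow> s c u \<in> W r"
  using W vs.subspace_0 vs.subspace_add vs.subspace_scale by blast+

lemma form_add: "u \<in> W r \<Longrightarrow> v \<in> W r \<Longrightarrow> w \<in> W r \<Longrightarrow> \<phi> r (u + v) w = \<phi> r u w + \<phi> r v w"
  "u \<in> W r \<Longrightarrow> v \<in> W r \<Longrightarrow> w \<in> W r \<Longrightarrow> \<phi> r w (u + v) = \<phi> r w u + \<phi> r w v"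
  using sesq[of r] unfolding sesquilinear_form_def by blast+

lemma form_scale: "u \<in> W r \<Longrightarrow> v \<in> W r \<Longrightarrow> \<phi> r (s c u) v = cnj c * \<phi> r u v"
  "u \<in> W r \<Longrightarrow> v \<in> W r \<Longrightarrow> \<phi> r u (s c v) = c * \<phi> r u v"
  using sesq[of r] unfolding sesquilinear_form_def by blast+

lemma form_zero: "v \<in> W r \<Longrightarrow> \<phi> r 0 v = 0" "v \<in> W r \<Longrightarrow> \<phi> r v 0 = 0"
  using form_scale(1)[of 0 r v 0] form_scale(2)[of v r 0 0] W_closed(1) by simp_all

lemma I_D: "f \<in> I \<Longrightarrow> i \<le> r \<Longrightarrow> f r i \<in> W r" "f \<in> I \<Longrightarrow> r < i \<Longrightarrow> f r i = 0"
  "f \<in> I \<Longrightarrow> finite {r. \<exists>i. f r i \<noteq> 0}"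
  by (auto simp: isotypic_sum_def)

lemma I_I: "(\<And>r i. i \<le> r \<Longrightarrow> f r i \<in> W r) \<Longrightarrow> (\<And>r i. r < i \<Longrightarrow> f r i = 0) \<Longrightarrow>
   finite {r. \<exists>i. f r i \<noteq> 0} \<Longrightarrow> f \<in> I"
  by (auto simp: isotypic_sum_def)

lemma I_in_W: "f \<in> I \<Longrightarrow> f r i \<in> W r"
  using I_D(1)[of f i r] I_D(2)[of f r i] W_closed(1) by (cases "i \<le> r") auto

lemma I_image:
  assumes f: "f \<in> I" and W': "\<And>r i u. u \<in> W r \<Longrightarrow> T r i u \<in> W r" and T0: "\<And>r i. T r i 0 = 0"
  shows "(\<lambda>r i. T r i (f r i)) \<in> I"
proof (rule I_I)
  show "finite {r. \<exists>i. T r i (f r i) \<noteq> 0}"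
    by (rule finite_subset[OF _ I_D(3)[OF f]]) (use T0 in \<open>auto, metis\<close>)
qed (simp_all add: W' T0 I_D(1)[OF f] I_D(2)[OF f])

lemma I_scale: "f \<in> I \<Longrightarrow> (\<lambda>r i. s c (f r i)) \<in> I"
  by (rule I_image) (auto simp: W_closed)

lemma I_add: "f \<in> I \<Longrightarrow> g \<in> I \<Longrightarrow> (\<lambda>r i. f r i + g r i) \<in> I"
proof (rule I_I)
  assume fg: "f \<in> I" "g \<in> I"
  have "{r. \<exists>i. f r i + g r i \<noteq> 0} \<subseteq> {r. \<exists>i. f r i \<noteq> 0} \<union> {r. \<exists>i. g r i \<noteq> 0}" by force
  then show "finite {r. \<exists>i. f r i + g r i \<noteq> 0}" using I_D(3)[OF fg(1)] I_D(3)[OF fg(2)] finite_subset by blast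
qed (auto simp: I_D W_closed)

lemma I_zero: "(\<lambda>r i. 0) \<in> I" by (rule I_I) (auto simp: W_closed)

lemma \<Phi>_zero: "\<Phi> (\<lambda>r i. 0) = 0"
  using \<Phi>_scale[OF I_zero, of 0] by simp

lemma \<Phi>_inj: "f \<in> I \<Longrightarrow> g \<in> I \<Longrightarrow> \<Phi> f = \<Phi> g \<Longrightarrow> f = g"
  using bij by (auto simp: bij_betw_def inj_on_def)

definition \<Psi> where "\<Psi> = inv_into I \<Phi>"

lemma \<Psi>: "\<Psi> v \<in> I" "\<Phi> (\<Psi> v) = v" "f \<in> I \<Longrightarrow> \<Psi> (\<Phi> f) = f"
proof -
  have *: "v \<in> \<Phi> ` I" for v using bij by (auto simp: bij_betw_def)
  show "\<Psi> v \<in> I" "\<Phi> (\<Psi> v) = v" unfolding \<Psi>_def using inv_into_into[OF *] f_inv_into_f[OF *] by auto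
  show "f \<in> I \<Longrightarrow> \<Psi> (\<Phi> f) = f" unfolding \<Psi>_def using bij by (simp add: bij_betw_def inv_into_f_f)
qed

lemma \<Psi>_add: "\<Psi> (u + v) = (\<lambda>r i. \<Psi> u r i + \<Psi> v r i)"
  using \<Phi>_add[OF \<Psi>(1)[of u] \<Psi>(1)[of v]] by (intro \<Phi>_inj \<Psi> I_add) (simp add: \<Psi>)

lemma \<Psi>_scale: "\<Psi> (c *s u) = (\<lambda>r i. s c (\<Psi> u r i))"
  using \<Phi>_scale[OF \<Psi>(1)[of u]] by (intro \<Phi>_inj \<Psi> I_scale) (simp add: \<Psi>)

text \<open>The pure tensor \<open>e\<^sub>i \<otimes> w\<close> in the summand of index
  \<open>r\<close>.\<close>

definition tensor :: "nat \<Rightarrow> nat \<Rightarrow> 'w \<Rightarrow> nat \<Rightarrow> nat \<Rightarrow> 'w" where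
  "tensor r i w = (\<lambda>r' i'. if r' = r \<and> i' = i then w else 0)"

lemma tensor_I: "i \<le> r \<Longrightarrow> w \<in> W r \<Longrightarrow> tensor r i w \<in> I"
proof (rule I_I)
  show "finite {r'. \<exists>i'. tensor r i w r' i' \<noteq> 0}"
    by (rule finite_subset[of _ "{r}"]) (auto simp: tensor_def)
qed (auto simp: tensor_def W_closed)

lemma tensor_add: "tensor r i (u + v) = (\<lambda>r' i'. tensor r i u r' i' + tensor r i v r' i')"
  by (auto simp: tensor_def fun_eq_iff)

lemma tensor_scale: "tensor r i (s c u) = (\<lambda>r' i'. s c (tensor r i u r' i'))"
  by (auto simp: tensor_def fun_eq_iff)

lemma irrep_form_sum:
  assumes "i \<le> r"
  shows "(\<Sum>j\<le>r. of_real (irrep_form r i j) * c j) = of_real (irrep_form r i (r - i)) * (c (r - i) :: complex)"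
proof -
  have "(\<Sum>j\<le>r. of_real (irrep_form r i j) * c j) = (\<Sum>j\<le>r. if j = r - i then of_real (irrep_form r i (r - i)) * c (r - i) else 0)"
    using assms by (intro sum.cong) (auto simp: irrep_form_def)
  then show ?thesis by simp
qed

lemma irrep_form_nonzero: "i \<le> r \<Longrightarrow> irrep_form r i (r - i) \<noteq> 0"
  by (simp add: irrep_form_def)

text \<open>Frees the sum from the support of \<open>f\<close>, so that forms of different vectors
  can be compared over one index set, and keeps only the opposite weights \<open>i\<close> and
  \<open>r - i\<close>.\<close>

lemma form_extend_support:
  assumes f: "f \<in> I" and g: "g \<in> I" and R: "finite R" "{r. \<exists>i. f r i \<noteq> 0} \<subseteq> R"
  shows "isotypic_form \<phi> f g = (\<Sum>r\<in>R. \<Sum>i\<le>r. of_real (irrep_form r i (r - i)) * \<phi> r (f r i) (g r (r - i)))"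
proof -
  have "isotypic_form \<phi> f g = (\<Sum>r\<in>{r. \<exists>i. f r i \<noteq> 0}. \<Sum>i\<le>r. of_real (irrep_form r i (r - i)) * \<phi> r (f r i) (g r (r - i)))"
    unfolding isotypic_form_def by (intro sum.cong refl) (simp add: irrep_form_sum)
  also have "\<dots> = (\<Sum>r\<in>R. \<Sum>i\<le>r. of_real (irrep_form r i (r - i)) * \<phi> r (f r i) (g r (r - i)))"
    using R I_in_W[OF g] by (intro sum.mono_neutral_left) (auto simp: form_zero)
  finally show ?thesis .
qed

lemma B_tensor:
  assumes "i \<le> r" "u \<in> W r" "g \<in> I"
  shows "B (\<Phi> (tensor r i u)) (\<Phi> g) = of_real (irrep_form r i (r - i)) * \<phi> r u (g r (r - i))"
proof -
  have "B (\<Phi> (tensor r i u)) (\<Phi> g) = (\<Sum>r'\<in>{r}. \<Sum>i'\<le>r'. of_real (irrep_form r' i' (r' - i')) * \<phi> r' (tensor r i u r' i') (g r' (r' - i')))"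
    unfolding \<Phi>_form[OF tensor_I[OF assms(1,2)] assms(3)]
    by (rule form_extend_support[OF tensor_I[OF assms(1,2)] assms(3)]) (auto simp: tensor_def split: if_splits)
  also have "\<dots> = (\<Sum>i'\<le>r. if i' = i then of_real (irrep_form r i (r - i)) * \<phi> r u (g r (r - i)) else 0)"
  proof -
    have "of_real (irrep_form r i' (r - i')) * \<phi> r (tensor r i u r i') (g r (r - i'))
      = (if i' = i then of_real (irrep_form r i (r - i)) * \<phi> r u (g r (r - i)) else 0)" for i'
      using form_zero(1)[OF I_in_W[OF assms(3)]] by (simp add: tensor_def)
    then show ?thesis by simp
  qed
  finally show ?thesis using assms(1) by simp
qed

text \<open>Compare the pairings of \<open>e\<^sub>0 \<otimes> u\<close> and
  \<open>e\<^sub>r \<otimes> v\<close> in both orders: \<open>B\<close> is Hermitian, while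
  \<open>irrep_form\<close> changes by \<open>(- 1) ^ r\<close> under exchange of its
  indices.\<close>

lemma form_symmetry:
  assumes u: "u \<in> W r" and v: "v \<in> W r"
  shows "\<phi> r v u = (- 1) ^ r * cnj (\<phi> r u v)"
proof -
  let ?e = "irrep_form r 0 r" and ?e' = "irrep_form r r 0"
  have "B (\<Phi> (tensor r 0 u)) (\<Phi> (tensor r r v)) = of_real ?e * \<phi> r u v"
    using B_tensor[of 0 r u "tensor r r v"] u v tensor_I[of r r v] by (simp add: tensor_def)
  moreover have "B (\<Phi> (tensor r r v)) (\<Phi> (tensor r 0 u)) = of_real ?e' * \<phi> r v u"
    using B_tensor[of r r v "tensor r 0 u"] u v tensor_I[of 0 r u] by (simp add: tensor_def)
  ultimately have "of_real ?e' * \<phi> r v u = cnj (of_real ?e * \<phi> r u v)" using B_commute by metis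
  then have *: "of_real ?e' * \<phi> r v u = of_real ?e * cnj (\<phi> r u v)" by simp
  have e: "?e' * ?e' = 1" "?e' * ?e = (- 1) ^ r"
    by (simp add: irrep_form_def) (simp add: irrep_form_def power_add mult.assoc)
  have "\<phi> r v u = of_real (?e' * ?e') * \<phi> r v u" by (simp add: e)
  also have "\<dots> = of_real ?e' * (of_real ?e' * \<phi> r v u)" by simp
  also have "\<dots> = of_real (?e' * ?e) * cnj (\<phi> r u v)" unfolding * by simp
  finally show ?thesis by (simp add: e)
qed

lemma form_nondegenerate: "nondegenerate_form (W r) (\<phi> r)"
  unfolding nondegenerate_form_def
proof (intro ballI impI)
  fix u assume u: "u \<in> W r" and 0: "\<forall>v\<in>W r. \<phi> r u v = 0"
  have t: "tensor r 0 u \<in> I" using u by (simp add: tensor_I)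
  have "B (\<Phi> (tensor r 0 u)) v = 0" for v
  proof -
    have "B (\<Phi> (tensor r 0 u)) (\<Phi> (\<Psi> v)) = of_real (irrep_form r 0 (r - 0)) * \<phi> r u (\<Psi> v r (r - 0))"
      by (rule B_tensor) (auto simp: u \<Psi>)
    then show ?thesis using 0 I_in_W[OF \<Psi>(1)] by (simp add: \<Psi>)
  qed
  then have "\<Phi> (tensor r 0 u) = 0" using nondegenerate unfolding nondegenerate_form_def by blast
  then have "tensor r 0 u = (\<lambda>r i. 0)" using \<Phi>_inj[OF t I_zero] \<Phi>_zero by simp
  then have "tensor r 0 u r 0 = 0" by simp
  then show "u = 0" by (simp add: tensor_def)
qed

lemma odd_form_skew: "odd r \<Longrightarrow> skew_hermitian_form s (W r) (\<phi> r)"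
  unfolding skew_hermitian_form_def
proof (intro conjI ballI)
  show "\<phi> r v u = - cnj (\<phi> r u v)" if "odd r" "u \<in> W r" "v \<in> W r" for u v
    using form_symmetry[OF that(2,3)] that(1) by simp
qed (rule sesq)

text \<open>The highest weight vectors \<open>e\<^sub>0 \<otimes> u\<close> embed \<open>W r\<close>
  into the finite-dimensional space on which \<open>B\<close> lives.\<close>

lemma finite_dim_W:
  obtains F where "finite F" "W r \<subseteq> vs.span F"
proof -
  interpret vector_space_pair s "(*s) :: complex \<Rightarrow> complex^'n \<Rightarrow> complex^'n"
    by unfold_locales
  show ?thesis
  proof (rule finite_dim_of_injective[of "W r" "\<lambda>u. \<Phi> (tensor r 0 u)" "cart_basis"])
    show "u = 0" if "u \<in> W r" "\<Phi> (tensor r 0 u) = 0" for u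
    proof -
      have "tensor r 0 u = (\<lambda>r i. 0)"
        using that \<Phi>_zero by (intro \<Phi>_inj tensor_I I_zero) auto
      then have "tensor r 0 u r 0 = 0" by simp
      then show ?thesis by (simp add: tensor_def)
    qed
  qed (auto simp: W tensor_add tensor_scale \<Phi>_add \<Phi>_scale tensor_I finite_cart_basis intro: that)
qed

section \<open>Powers of \<open>x\<close> in isotypic coordinates, and the form on their
  kernels\<close>

abbreviation XA where "XA \<equiv> isotypic_action s irrep_X"

lemma XA_eq: "XA f r i = (if i < r then s (of_real ((real i + 1) * (real r - real i))) (f r (Suc i)) else 0)"
proof -
  have "(\<Sum>j\<le>r. s (of_real (irrep_X r i j)) (f r j))
    = (\<Sum>j\<le>r. if j = Suc i then s (of_real ((real i + 1) * (real r - real i))) (f r (Suc i)) else 0)"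
    by (intro sum.cong) (auto simp: irrep_X_def algebra_simps)
  then show ?thesis by (auto simp: isotypic_action_def)
qed

lemma XA_I: "f \<in> I \<Longrightarrow> XA f \<in> I"
proof (rule I_I)
  assume f: "f \<in> I"
  show "finite {r. \<exists>i. XA f r i \<noteq> 0}"
    by (rule finite_subset[OF _ I_D(3)[OF f]]) (auto simp: XA_eq split: if_splits)
qed (simp_all add: XA_eq W_closed I_in_W)

lemma XA_pow_I: "f \<in> I \<Longrightarrow> (XA ^^ k) f \<in> I"
  by (induction k) (auto intro: XA_I)

lemma \<Phi>_XA_pow: "f \<in> I \<Longrightarrow> \<Phi> ((XA ^^ k) f) = (((*v) x) ^^ k) (\<Phi> f)"
  by (induction k) (auto simp: \<Phi>_X XA_pow_I)

text \<open>The coefficient of \<open>e\<^sub>i\<close> in the image of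
  \<open>e\<^sub>i\<^sub>+\<^sub>k\<close> under the \<open>k\<close>-th power of \<open>X\<close>,
  meaningful for \<open>i + k \<le> r\<close>.\<close>

fun X_coeff :: "nat \<Rightarrow> nat \<Rightarrow> nat \<Rightarrow> real" where
  "X_coeff r 0 i = 1"
| "X_coeff r (Suc k) i = (real i + 1) * (real r - real i) * X_coeff r k (Suc i)"

lemma X_coeff_pos: "i + k \<le> r \<Longrightarrow> X_coeff r k i > 0"
  by (induction k arbitrary: i) auto

lemma XA_pow: "f \<in> I \<Longrightarrow> (XA ^^ k) f r i = (if i + k \<le> r then s (of_real (X_coeff r k i)) (f r (i + k)) else 0)"
  by (induction k arbitrary: i) (auto simp: XA_eq I_D(2) not_le Suc_le_eq)

text \<open>On \<open>ker x\<^sup>r\<^sup>+\<^sup>1\<close> the form \<open>B(u, x\<^sup>r u)\<close> only sees the lowest weight part of the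
  isotypic component of highest weight \<open>r\<close>.\<close>

lemma B_X_pow:
  assumes f: "f \<in> I" and ker: "\<And>r' j. r < j \<Longrightarrow> j \<le> r' \<Longrightarrow> f r' j = 0"
  shows "B (\<Phi> f) ((((*v) x) ^^ r) (\<Phi> f)) = of_real (irrep_form r r 0 * X_coeff r r 0) * \<phi> r (f r r) (f r r)"
proof -
  let ?g = "(XA ^^ r) f" and ?R = "insert r {r. \<exists>i. f r i \<noteq> 0}"
  have g: "?g \<in> I" using f by (rule XA_pow_I)
  let ?t = "\<lambda>r' i. of_real (irrep_form r' i (r' - i)) * \<phi> r' (f r' i) (?g r' (r' - i))"
  have "B (\<Phi> f) ((((*v) x) ^^ r) (\<Phi> f)) = (\<Sum>r'\<in>?R. \<Sum>i\<le>r'. ?t r' i)"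
    unfolding \<Phi>_XA_pow[OF f, symmetric] \<Phi>_form[OF f g]
    using I_D(3)[OF f] by (intro form_extend_support f g) auto
  also have "\<dots> = (\<Sum>r'\<in>?R. \<Sum>i\<le>r'. if r' = r \<and> i = r then ?t r r else 0)"
  proof (intro sum.cong refl)
    fix r' i :: nat assume i: "i \<in> {..r'}"
    show "?t r' i = (if r' = r \<and> i = r then ?t r r else 0)"
    proof (cases "r' = r \<and> i = r")
      case False
      \<comment> \<open>A nonzero second factor forces \<open>r \<le> i\<close>, and by
        \<open>ker\<close> also \<open>r' \<le> i\<close>; a nonzero first factor forces
        \<open>i \<le> r\<close>. Together with \<open>i \<le> r'\<close> only
        \<open>i = r' = r\<close> remains.\<close>
      have "f r' i = 0 \<or> ?g r' (r' - i) = 0"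
      proof (rule ccontr)
        assume n: "\<not> (f r' i = 0 \<or> ?g r' (r' - i) = 0)"
        then have a: "r' - i + r \<le> r'" "f r' (r' - i + r) \<noteq> 0"
          by (auto simp: XA_pow[OF f] split: if_splits)
        have "r' - i + r \<le> r" by (rule ccontr) (use ker[of "r' - i + r" r'] a in simp)
        then have "r' = i" using i by auto
        moreover have "i \<le> r" by (rule ccontr) (use ker[of i r'] n i in simp)
        ultimately show False using a(1) False by auto
      qed
      then show ?thesis using False I_in_W[OF f] I_in_W[OF g] by (auto simp: form_zero)
    qed auto
  qed
  also have "\<dots> = (\<Sum>r'\<in>?R. if r' = r then ?t r r else 0)"
    by (intro sum.cong refl) (auto simp: if_distrib)
  also have "\<dots> = ?t r r" using I_D(3)[OF f] by simp
  also have "\<dots> = of_real (irrep_form r r 0 * X_coeff r r 0) * \<phi> r (f r r) (f r r)"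
    using I_in_W[OF f] by (simp add: XA_pow[OF f] form_scale)
  finally show ?thesis .
qed

lemma negation_imp_split:
  assumes g: "star g ** g = mat 1" and neg: "g ** x ** star g = - x" and r: "odd r"
  shows "positive_index s (W r) (\<lambda>u v. - \<i> * \<phi> r u v) = positive_index s (W r) (\<lambda>u v. - (- \<i> * \<phi> r u v))"
proof -
  have "g ** x = (g ** x ** star g) ** g" using g by (metis matrix_mul_assoc matrix_mul_rid)
  then have gx: "g ** x = - (x ** g)" by (simp add: neg matrix_neg_left)
  have xg: "x *v (g *v v) = - (g *v (x *v v))" for v
    using arg_cong[OF gx, of "\<lambda>M. M *v v"] by (simp add: matrix_vector_mul_assoc neg_mult_vector)
  have lin: "x *v (- v) = - (x *v v)" "x *v (c *s v) = c *s (x *v v)" "g *v (c *s v) = c *s (g *v v)" for v c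
    by (simp_all add: vec.neg vec.scale)
  \<comment> \<open>Each \<open>x\<close> passes \<open>g\<close> at the cost of a sign, so
    \<open>x\<close> to the odd power \<open>r\<close> contributes \<open>- 1\<close>.\<close>
  have powg: "(((*v) x) ^^ k) (g *v v) = (- 1) ^ k *s (g *v ((((*v) x) ^^ k) v))" for k v
    by (induction k) (simp_all add: lin xg vector_smult_assoc vector_smult_lneg vector_smult_rneg)
  \<comment> \<open>The coefficient at \<open>e\<^sub>r\<close> of the image under \<open>g\<close>;
    reading it off amounts to passing to the quotient by the radical of the form. Injectivity on
    definite subspaces comes from \<open>positive_index_anti_isometry\<close>.\<close>
  define \<tau> where "\<tau> u = \<Psi> (g *v \<Phi> (tensor r r u)) r r" for u
  have tI: "tensor r r u \<in> I" if "u \<in> W r" for u using that by (simp add: tensor_I)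
  have neg\<tau>: "\<phi> r (\<tau> u) (\<tau> u) = - \<phi> r u u" if u: "u \<in> W r" for u
  proof -
    let ?t = "tensor r r u" and ?f = "\<Psi> (g *v \<Phi> (tensor r r u))"
    note t = tI[OF u]
    have f: "?f \<in> I" "\<Phi> ?f = g *v \<Phi> ?t" by (rule \<Psi>)+
    have "(XA ^^ Suc r) ?t = (\<lambda>r i. 0)"
      unfolding fun_eq_iff XA_pow[OF t] by (auto simp: tensor_def)
    then have "(((*v) x) ^^ Suc r) (\<Phi> ?t) = 0" using \<Phi>_XA_pow[OF t, of "Suc r"] \<Phi>_zero by simp
    then have "\<Phi> ((XA ^^ Suc r) ?f) = 0"
      using powg[of "Suc r" "\<Phi> ?t"] by (simp only: \<Phi>_XA_pow[OF f(1)] f(2)) simp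
    then have XA0: "(XA ^^ Suc r) ?f = (\<lambda>r i. 0)"
      by (intro \<Phi>_inj[OF XA_pow_I[OF f(1)] I_zero]) (simp only: \<Phi>_zero)
    \<comment> \<open>The power \<open>r + 1\<close> of \<open>x\<close> kills the vector and has
      nonzero coefficients \<open>X_coeff\<close>, so every coefficient at an index above
      \<open>r\<close> vanishes.\<close>
    have ker: "?f r' j = 0" if "r < j" "j \<le> r'" for r' j
    proof -
      have "(XA ^^ Suc r) ?f r' (j - Suc r) = 0" by (simp only: XA0)
      moreover have "(XA ^^ Suc r) ?f r' (j - Suc r) = s (of_real (X_coeff r' (Suc r) (j - Suc r))) (?f r' j)"
        unfolding XA_pow[OF f(1)] using that by (simp del: X_coeff.simps)
      moreover have "X_coeff r' (Suc r) (j - Suc r) \<noteq> 0" 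
        by (rule less_imp_neq[OF X_coeff_pos, THEN not_sym]) (use that in simp)
      ultimately show ?thesis by (metis vs.scale_eq_0_iff of_real_eq_0_iff)
    qed
    have ker': "?t r' j = 0" if "r < j" "j \<le> r'" for r' j using that by (auto simp: tensor_def)
    let ?c = "irrep_form r r 0 * X_coeff r r 0"
    have c: "?c \<noteq> 0" using irrep_form_nonzero[of r r] X_coeff_pos[of 0 r r] by simp
    have Bg: "B (g *v a) (g *v b) = B a b" for a b using isometry_iff[of g] g by blast
    have "of_real ?c * \<phi> r (\<tau> u) (\<tau> u) = B (g *v \<Phi> ?t) ((((*v) x) ^^ r) (g *v \<Phi> ?t))"
      using B_X_pow[OF f(1) ker] by (simp add: f(2) \<tau>_def)
    also have "\<dots> = - B (\<Phi> ?t) ((((*v) x) ^^ r) (\<Phi> ?t))"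
      using r by (simp add: powg vector_smult_lneg B_minus Bg)
    also have "\<dots> = - (of_real ?c * \<phi> r u u)"
      using B_X_pow[OF t ker'] by (simp add: tensor_def)
    finally have "of_real ?c * \<phi> r (\<tau> u) (\<tau> u) = of_real ?c * (- \<phi> r u u)" by simp
    then show ?thesis using c by (simp only: mult_cancel_left of_real_eq_0_iff simp_thms)
  qed
  show ?thesis
  proof (rule positive_index_anti_isometry[where T = \<tau>])
    show "vector_space s" by unfold_locales
    show "\<tau> (u + v) = \<tau> u + \<tau> v" if "u \<in> W r" "v \<in> W r" for u v
      using tI[OF that(1)] tI[OF that(2)] by (simp add: \<tau>_def tensor_add \<Phi>_add vec.add \<Psi>_add)
    show "\<tau> (s c u) = s c (\<tau> u)" if "u \<in> W r" for c u
      using tI[OF that] by (simp add: \<tau>_def tensor_scale \<Phi>_scale lin \<Psi>_scale)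
    show "\<tau> u \<in> W r" for u unfolding \<tau>_def by (intro I_in_W \<Psi>)
    show "- \<i> * \<phi> r (\<tau> u) (\<tau> u) = - (- \<i> * \<phi> r u u)" if "u \<in> W r" for u using neg\<tau>[OF that] by simp
  qed (auto simp: W form_zero W_closed)
qed

text \<open>A family of maps \<open>k\<^sub>i T\<close> on the weight spaces, with \<open>k\<^sub>i = c k\<^sub>i\<^sub>+\<^sub>1\<close>,
  conjugates \<open>x\<close> into \<open>c x\<close>.\<close>

lemma scaled_in_orbit:
  fixes k :: "nat \<Rightarrow> nat \<Rightarrow> real"
  assumes TW: "\<And>r u. u \<in> W r \<Longrightarrow> T r u \<in> W r"
    and Tadd: "\<And>r u v. u \<in> W r \<Longrightarrow> v \<in> W r \<Longrightarrow> T r (u + v) = T r u + T r v"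
    and Tscale: "\<And>r a u. u \<in> W r \<Longrightarrow> T r (s a u) = s a (T r u)"
    and iso: "\<And>r i u v. i \<le> r \<Longrightarrow> u \<in> W r \<Longrightarrow> v \<in> W r \<Longrightarrow>
       of_real (k r i * k r (r - i)) * \<phi> r (T r u) (T r v) = \<phi> r u v"
    and k: "\<And>r i. i < r \<Longrightarrow> k r i = c * k r (Suc i)"
  shows "c *\<^sub>R x \<in> adjoint_orbit G x"
proof -
  have T0: "T r 0 = 0" for r using Tscale[OF W_closed(1), of r 0] by simp
  define K where "K f = (\<lambda>r i. s (of_real (k r i)) (T r (f r i)))" for f
  have KI: "K f \<in> I" if "f \<in> I" for f
    unfolding K_def by (rule I_image[OF that]) (auto simp: W_closed TW T0)
  define g where "g = matrix (\<lambda>v. \<Phi> (K (\<Psi> v)))"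
  have lin: "Vector_Spaces.linear (*s) (*s) (\<lambda>v. \<Phi> (K (\<Psi> v)))"
  proof (intro Vector_Spaces.linear.intro module_hom.intro module_hom_axioms.intro)
    fix u v :: "complex^'n" and a
    have "K (\<Psi> (u + v)) = (\<lambda>r i. K (\<Psi> u) r i + K (\<Psi> v) r i)"
      using I_in_W[OF \<Psi>(1)] by (simp add: K_def \<Psi>_add Tadd vs.scale_right_distrib)
    then show "\<Phi> (K (\<Psi> (u + v))) = \<Phi> (K (\<Psi> u)) + \<Phi> (K (\<Psi> v))" using \<Phi>_add KI \<Psi>(1) by simp
    have "K (\<Psi> (a *s u)) = (\<lambda>r i. s a (K (\<Psi> u) r i))"
      using I_in_W[OF \<Psi>(1)] by (simp add: K_def \<Psi>_scale Tscale mult.commute)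
    then show "\<Phi> (K (\<Psi> (a *s u))) = a *s \<Phi> (K (\<Psi> u))" using \<Phi>_scale KI \<Psi>(1) by simp
  qed unfold_locales
  have g: "g *v v = \<Phi> (K (\<Psi> v))" for v unfolding g_def by (rule matrix_works[OF lin])
  have "B (g *v u) (g *v v) = B u v" for u v
  proof -
    let ?f = "\<Psi> u" and ?h = "\<Psi> v"
    let ?R = "{r. \<exists>i. ?f r i \<noteq> 0}"
    have fh: "?f \<in> I" "?h \<in> I" by (rule \<Psi>)+
    have sub: "{r. \<exists>i. K ?f r i \<noteq> 0} \<subseteq> ?R" using T0 by (auto simp: K_def) metis
    have "B (g *v u) (g *v v) = (\<Sum>r\<in>?R. \<Sum>i\<le>r. of_real (irrep_form r i (r - i)) * \<phi> r (K ?f r i) (K ?h r (r - i)))"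
      unfolding g \<Phi>_form[OF KI[OF fh(1)] KI[OF fh(2)]]
      by (rule form_extend_support[OF KI[OF fh(1)] KI[OF fh(2)] I_D(3)[OF fh(1)] sub])
    also have "\<dots> = (\<Sum>r\<in>?R. \<Sum>i\<le>r. of_real (irrep_form r i (r - i)) * \<phi> r (?f r i) (?h r (r - i)))"
    proof (intro sum.cong refl)
      fix r i :: nat assume "i \<in> {..r}"
      then have "\<phi> r (K ?f r i) (K ?h r (r - i)) = \<phi> r (?f r i) (?h r (r - i))"
        using iso[of i r "?f r i" "?h r (r - i)"] I_in_W[OF fh(1)] I_in_W[OF fh(2)] TW
        by (simp add: K_def form_scale W_closed mult_ac)
      then show "of_real (irrep_form r i (r - i)) * \<phi> r (K ?f r i) (K ?h r (r - i))
        = of_real (irrep_form r i (r - i)) * \<phi> r (?f r i) (?h r (r - i))" by simp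
    qed
    also have "\<dots> = B (\<Phi> ?f) (\<Phi> ?h)"
      unfolding \<Phi>_form[OF fh] by (rule form_extend_support[symmetric]) (use fh I_D(3) in auto)
    finally show ?thesis by (simp add: \<Psi>)
  qed
  then have iso_g: "star g ** g = mat 1" using isometry_iff by blast
  have "g ** x = c *\<^sub>R (x ** g)"
  proof -
    have "(g ** x) *v v = (c *\<^sub>R (x ** g)) *v v" for v
    proof -
      let ?f = "\<Psi> v"
      have f: "?f \<in> I" by (rule \<Psi>)
      have "x *v v = \<Phi> (XA ?f)" using \<Phi>_X[OF f] by (simp add: \<Psi>)
      then have "g *v (x *v v) = \<Phi> (K (XA ?f))" using \<Psi>(3)[OF XA_I[OF f]] by (simp add: g)
      also have "K (XA ?f) = (\<lambda>r i. s (of_real c) (XA (K ?f) r i))"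
      proof (intro ext)
        fix r i
        show "K (XA ?f) r i = s (of_real c) (XA (K ?f) r i)"
          using I_in_W[OF f] k[of i r] by (cases "i < r") (simp_all add: K_def XA_eq T0 Tscale mult_ac)
      qed
      also have "\<Phi> \<dots> = of_real c *s (x *v (g *v v))"
        using \<Phi>_scale[OF XA_I[OF KI[OF f]]] \<Phi>_X[OF KI[OF f]] by (simp add: g)
      also have "\<dots> = c *\<^sub>R (x *v (g *v v))" by (simp add: vec_eq_iff scaleR_conv_of_real[where 'a=complex])
      finally show ?thesis by (simp add: mult_scaleR_vector flip: matrix_vector_mul_assoc)
    qed
    then show ?thesis by (simp add: matrix_eq)
  qed
  then have "g ** x ** star g = c *\<^sub>R (x ** (g ** star g))" by (simp add: matrix_scaleR_left matrix_mul_assoc)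
  then have "g ** x ** star g = c *\<^sub>R x" by (simp add: isometry_inv(2)[OF iso_g])
  then show ?thesis using isometry_conj_in_orbit[OF iso_g, of x] by simp
qed

text \<open>\<open>2 ^ r / 4 ^ i\<close> is 2 to the power \<open>r - 2 i\<close>: the action of
  \<open>exp (ln 2 * h)\<close> on the weight space of \<open>e\<^sub>i\<close>, which multiplies
  \<open>x\<close> by the square of 2. Opposite weights cancel in the form.\<close>

lemma four_x_in_orbit: "4 *\<^sub>R x \<in> adjoint_orbit G x"
proof (rule scaled_in_orbit[where T = "\<lambda>r u. u" and k = "\<lambda>r i. 2 ^ r / 4 ^ i"])
  show "of_real (2 ^ r / 4 ^ i * (2 ^ r / 4 ^ (r - i))) * \<phi> r u v = \<phi> r u v" if "i \<le> r" for r i u v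
  proof -
    have "(4::real) ^ i * 4 ^ (r - i) = 4 ^ r" using that by (simp flip: power_add)
    moreover have "(2::real) ^ r * 2 ^ r = 4 ^ r" by (simp flip: power_mult_distrib)
    ultimately have "(2::real) ^ r / 4 ^ i * (2 ^ r / 4 ^ (r - i)) = 1" by simp
    then show ?thesis by simp
  qed
qed auto

lemma split_imp_minus_x_in_orbit:
  assumes split: "\<And>r. odd r \<Longrightarrow> positive_index s (W r) (\<lambda>u v. - \<i> * \<phi> r u v)
     = positive_index s (W r) (\<lambda>u v. - (- \<i> * \<phi> r u v))"
  shows "- x \<in> adjoint_orbit G x"
proof -
  \<comment> \<open>The factor \<open>(- 1) ^ r\<close> treats both parities uniformly: it is the
    product of the signs \<open>(- 1) ^ i\<close> and \<open>(- 1) ^ (r - i)\<close> on the weight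
    spaces that the form pairs.\<close>
  have "\<exists>T. (\<forall>u\<in>W r. T u \<in> W r) \<and> (\<forall>u\<in>W r. \<forall>v\<in>W r. T (u + v) = T u + T v) \<and>
      (\<forall>a. \<forall>u\<in>W r. T (s a u) = s a (T u)) \<and> (\<forall>u\<in>W r. \<forall>v\<in>W r. \<phi> r (T u) (T v) = (- 1) ^ r * \<phi> r u v)" for r
  proof (cases "even r")
    case True
    then show ?thesis by (intro exI[of _ "\<lambda>u. u"]) auto
  next
    case odd: False
    interpret h: hermitian_subspace s "W r" "\<lambda>u v. - \<i> * \<phi> r u v"
    proof unfold_locales
      show "vs.subspace (W r)" by (rule W)
      have "sesquilinear_form s (W r) (\<lambda>u v. - \<i> * \<phi> r u v)"
        unfolding sesquilinear_form_def by (simp add: form_add form_scale distrib_left)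
      moreover have "- \<i> * \<phi> r v u = cnj (- \<i> * \<phi> r u v)" if "u \<in> W r" "v \<in> W r" for u v
        using form_symmetry[OF that] odd by simp
      ultimately show "hermitian_form s (W r) (\<lambda>u v. - \<i> * \<phi> r u v)"
        by (simp only: hermitian_form_def simp_thms) blast
    qed
    have nd: "nondegenerate_form (W r) (\<lambda>u v. - \<i> * \<phi> r u v)"
      using form_nondegenerate[of r] by (simp add: nondegenerate_form_def)
    obtain F where F: "finite F" "W r \<subseteq> vs.span F" by (rule finite_dim_W)
    show ?thesis
    proof (rule h.exists_anti_isometry[OF nd F split[OF odd]])
      fix T
      assume T: "\<And>u. u \<in> W r \<Longrightarrow> T u \<in> W r"
        "\<And>u v. u \<in> W r \<Longrightarrow> v \<in> W r \<Longrightarrow> T (u + v) = T u + T v"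
        "\<And>c u. u \<in> W r \<Longrightarrow> T (s c u) = s c (T u)"
        "\<And>u v. u \<in> W r \<Longrightarrow> v \<in> W r \<Longrightarrow> - \<i> * \<phi> r (T u) (T v) = - (- \<i> * \<phi> r u v)"
      have "\<phi> r (T u) (T v) = - \<phi> r u v" if "u \<in> W r" "v \<in> W r" for u v
        using T(4)[OF that] by (simp add: complex_eq_iff)
      then show ?thesis using T(1-3) odd by (intro exI[of _ T]) simp
    qed
  qed
  then obtain T where T: "\<And>r. (\<forall>u\<in>W r. T r u \<in> W r) \<and> (\<forall>u\<in>W r. \<forall>v\<in>W r. T r (u + v) = T r u + T r v) \<and>
      (\<forall>a. \<forall>u\<in>W r. T r (s a u) = s a (T r u)) \<and> (\<forall>u\<in>W r. \<forall>v\<in>W r. \<phi> r (T r u) (T r v) = (- 1) ^ r * \<phi> r u v)"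
    by metis
  have "(- 1) *\<^sub>R x \<in> adjoint_orbit G x"
  proof (rule scaled_in_orbit[where T = T and k = "\<lambda>r i. (- 1) ^ i"])
    show "of_real ((- 1) ^ i * (- 1) ^ (r - i)) * \<phi> r (T r u) (T r v) = \<phi> r u v"
      if "i \<le> r" "u \<in> W r" "v \<in> W r" for r i u v
    proof -
      have "(- 1 :: real) ^ i * (- 1) ^ (r - i) = (- 1) ^ r" using that(1) by (simp flip: power_add)
      moreover have "\<phi> r (T r u) (T r v) = (- 1) ^ r * \<phi> r u v" using T that by blast
      ultimately show ?thesis by (simp flip: mult.assoc power_mult_distrib)
    qed
  qed (use T in auto)
  then show ?thesis by simp
qed

end

section \<open>Orbits stable under scaling, and their dimension\<close>

context su_form
begin

lemma adjoint_orbit_scaleR: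
  assumes "c *\<^sub>R x \<in> adjoint_orbit G x"
  shows "(*\<^sub>R) c ` adjoint_orbit G x \<subseteq> adjoint_orbit G x"
proof
  fix z assume "z \<in> (*\<^sub>R) c ` adjoint_orbit G x"
  then obtain g where g: "star g ** g = mat 1" "z = c *\<^sub>R (g ** x ** star g)"
    unfolding adjoint_orbit_eq by blast
  then have "z = g ** (c *\<^sub>R x) ** star g" by (simp add: matrix_scaleR_left matrix_scaleR_right)
  then have "z \<in> adjoint_orbit G (c *\<^sub>R x)" using g(1) unfolding adjoint_orbit_eq by blast
  then show "z \<in> adjoint_orbit G x" using adjoint_orbit_trans[OF assms] by blast
qed

lemma in_adjoint_orbit: "x \<in> adjoint_orbit G x"
  unfolding adjoint_orbit_eq by (rule CollectI, rule exI[of _ "mat 1"]) (simp add: star_mat)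

lemma neg_orbit_iff: "uminus ` adjoint_orbit G x = adjoint_orbit G x \<longleftrightarrow> - x \<in> adjoint_orbit G x"
proof
  assume "uminus ` adjoint_orbit G x = adjoint_orbit G x"
  then show "- x \<in> adjoint_orbit G x" using in_adjoint_orbit by blast
next
  assume "- x \<in> adjoint_orbit G x"
  then have sub: "uminus ` adjoint_orbit G x \<subseteq> adjoint_orbit G x"
    using adjoint_orbit_scaleR[of "- 1" x] by auto
  have "y \<in> uminus ` adjoint_orbit G x" if "y \<in> adjoint_orbit G x" for y
    using that sub by (intro image_eqI[of _ _ "- y"]) auto
  then show "uminus ` adjoint_orbit G x = adjoint_orbit G x" using sub by blast
qed

text \<open>Both \<open>x = [h / 2, x]\<close> and \<open>h = [- y, x]\<close> are tangent at
  \<open>x\<close>. They are independent because \<open>[h, x] = 2 x\<close> is nonzero, whereas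
  multiples of \<open>x\<close> commute with \<open>x\<close>.\<close>

lemma dim_orbit_tangent_standard_triple:
  assumes "standard_triple L x y h"
  shows "2 \<le> dim (orbit_tangent L x)"
proof -
  have t: "y \<in> L" "h \<in> L" "x \<noteq> 0" "lie_bracket h x = 2 *\<^sub>R x" "lie_bracket x y = h"
    using assms by (auto simp: standard_triple_def)
  have xx: "lie_bracket (c *\<^sub>R x) x = 0" for c by (simp add: lie_bracket_def matrix_ring_simps)
  have nh: "h \<noteq> c *\<^sub>R x" for c using xx[of c] t(3,4) by auto
  have "x \<in> orbit_tangent L x"
  proof -
    have "lie_bracket ((1/2) *\<^sub>R h) x = x" using t(4) by (simp add: lie_bracket_scaleR)
    moreover have "(1/2) *\<^sub>R h \<in> L" by (rule subspace_scale[OF subspace_L t(2)])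
    ultimately show ?thesis unfolding orbit_tangent_def mem_Collect_eq by metis
  qed
  moreover have "h \<in> orbit_tangent L x"
  proof -
    have "lie_bracket (- y) x = h" using t(5) by (simp add: lie_bracket_def matrix_ring_simps)
    moreover have "- y \<in> L" by (rule subspace_neg[OF subspace_L t(1)])
    ultimately show ?thesis unfolding orbit_tangent_def mem_Collect_eq by metis
  qed
  moreover have "independent {h, x}"
    using nh t(3) by (simp add: independent_insert span_singleton) auto
  moreover have "h \<noteq> x" using nh[of 1] by simp
  ultimately show ?thesis using independent_card_le_dim[of "{h, x}" "orbit_tangent L x"] by simp
qed

end

theorem theorem4p7:
  fixes p q :: nat
    and B :: "complex^'n \<Rightarrow> complex^'n \<Rightarrow> complex"
    and x y h :: "complex^'n^'n::finite"
    and s :: "complex \<Rightarrow> 'w::ab_group_add \<Rightarrow> 'w"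
    and W :: "nat \<Rightarrow> 'w set"
    and \<phi> :: "nat \<Rightarrow> 'w \<Rightarrow> 'w \<Rightarrow> complex"
    and P Q :: "nat \<Rightarrow> nat"
  assumes "1 \<le> p" and "1 \<le> q" and "CARD('n) = p + q"
    and "hermitian_form (*s) UNIV B" and "hermitian_signature (*s) UNIV B = (p, q)"
    and "standard_triple (special_unitary_algebra B) x y h"
    and "vector_space s"
    and "multiplicity_spaces B x y h s W \<phi>"
    and "\<And>r. odd r \<Longrightarrow> hermitian_signature s (W r) (\<lambda>u v. - \<i> * \<phi> r u v) = (P r, Q r)"
  shows "(\<forall>r. odd r \<longrightarrow> skew_hermitian_form s (W r) (\<phi> r) \<and> nondegenerate_form (W r) (\<phi> r)) \<and>
    (uminus ` adjoint_orbit (special_unitary_group B) x = adjoint_orbit (special_unitary_group B) x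
       \<longleftrightarrow> (\<forall>r. odd r \<longrightarrow> P r = Q r)) \<and>
    (uminus ` adjoint_orbit (special_unitary_group B) x = adjoint_orbit (special_unitary_group B) x
       \<longrightarrow> \<not> admits_gibbs_state (special_unitary_group B) (special_unitary_algebra B) x)"
proof -
  interpret su_form B
    using assms(4) nondegenerate_of_signature[OF assms(4,5,3)] by unfold_locales
  obtain \<Phi> where \<Phi>: "bij_betw \<Phi> (isotypic_sum W) UNIV"
    "\<forall>f\<in>isotypic_sum W. \<forall>g\<in>isotypic_sum W.
       \<Phi> (\<lambda>r i. f r i + g r i) = \<Phi> f + \<Phi> g \<and> B (\<Phi> f) (\<Phi> g) = isotypic_form \<phi> f g"
    "\<forall>f\<in>isotypic_sum W. (\<forall>c. \<Phi> (\<lambda>r i. s c (f r i)) = c *s \<Phi> f) \<and>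
       \<Phi> (isotypic_action s irrep_X f) = x *v \<Phi> f"
    and W: "\<forall>r. module.subspace s (W r) \<and> sesquilinear_form s (W r) (\<phi> r)"
    using assms(8) unfolding multiplicity_spaces_def by blast
  interpret vs: vector_space s by (rule assms(7))
  interpret isotypic B s W \<phi> x \<Phi>
    by unfold_locales (use W \<Phi> in blast)+
  have sig: "P r = positive_index s (W r) (\<lambda>u v. - \<i> * \<phi> r u v)"
    "Q r = positive_index s (W r) (\<lambda>u v. - (- \<i> * \<phi> r u v))" if "odd r" for r
    using assms(9)[OF that] by (simp_all add: hermitian_signature_def)
  have x: "x \<in> L" using assms(6) by (simp add: standard_triple_def)
  have iff: "- x \<in> adjoint_orbit G x \<longleftrightarrow> (\<forall>r. odd r \<longrightarrow> P r = Q r)"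
  proof
    assume "- x \<in> adjoint_orbit G x"
    then obtain g where "star g ** g = mat 1" "g ** x ** star g = - x"
      unfolding adjoint_orbit_eq by (smt (verit) mem_Collect_eq)
    then show "\<forall>r. odd r \<longrightarrow> P r = Q r" using negation_imp_split sig by simp
  next
    assume "\<forall>r. odd r \<longrightarrow> P r = Q r"
    then show "- x \<in> adjoint_orbit G x" using sig by (intro split_imp_minus_x_in_orbit) simp
  qed
  \<comment> \<open>The ratio \<open>1/4\<close> is chosen because its inverse is the factor of
    \<open>four_x_in_orbit\<close>.\<close>
  have "\<not> admits_gibbs_state G L x" if neg: "- x \<in> adjoint_orbit G x"
  proof (rule no_gibbs_state[OF x dim_orbit_tangent_standard_triple[OF assms(6)], of "1/4"])
    show "(*\<^sub>R) (inverse (1/4)) ` adjoint_orbit G x \<subseteq> adjoint_orbit G x"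
      using adjoint_orbit_scaleR[OF four_x_in_orbit] by simp
    show "uminus ` adjoint_orbit G x \<subseteq> adjoint_orbit G x" using neg neg_orbit_iff by blast
  qed simp_all
  then show ?thesis using odd_form_skew form_nondegenerate iff neg_orbit_iff by blast
qed

end
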